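(* Let $n\ge 1$ and let $q$ be a power of an odd prime. (1) The number of $z$-classes of unipotent elements in $U_n(q)$ is $p(n)$, which is equal to the number of $z$-classes of unipotent elements in $GL_n(q)$. (2) If $q>n$, the number of $z$-classes of semisimple elements in $U_n(q)$ is equal to the number of $z$-classes of semisimple elements in $GL_n(q)$.
   Context: $p(n)$ denotes the number of partitions of $n$. $GL_n(q)=GL_n(\mathbb F_q)$. Let $\mathbb F=\mathbb F_{q^2}$ with the involution $\bar a=a^q$, whose fixed field is $\mathbb F_q$. Then $U_n(q)=\{g\in GL_n(\mathbb F_{q^2})\mid {}^t g J\bar g=J\}$, where $J$ is an invertible hermitian matrix (for example the identity matrix); over a finite field there is a unique non-degenerate hermitian form of each dimension up to equivalence, so this group is unique up to conjugation. $z$-classes: for a group $G$, two elements $x,y\in G$ are $z$-equivalent if their centralizers in $G$ are conjugate in $G$; the equivalence classes are called $z$-classes. The number of $z$-classes of elements of a given type is the number of $z$-equivalence classes (in the group considered) of elements of that type. *)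

theory Defs
  imports
    "Jordan_Normal_Form.Matrix"
    "HOL-Algebra.Coset"
    "HOL-Algebra.Algebraic_Closure_Type"
    "HOL-Library.Multiset"
begin

section \<open>\<open>z\<close>-classes of a group\<close>

definition centralizer :: "('g, 'm) monoid_scheme \<Rightarrow> 'g \<Rightarrow> 'g set" where
  "centralizer G x = {c \<in> carrier G. c \<otimes>\<^bsub>G\<^esub> x = x \<otimes>\<^bsub>G\<^esub> c}"

definition conjugate_subsets :: "('g, 'm) monoid_scheme \<Rightarrow> 'g set \<Rightarrow> 'g set \<Rightarrow> bool" where
  "conjugate_subsets G H K \<longleftrightarrow>
     (\<exists>g \<in> carrier G. g <#\<^bsub>G\<^esub> H #>\<^bsub>G\<^esub> inv\<^bsub>G\<^esub> g = K)"

definition z_rel :: "('g, 'm) monoid_scheme \<Rightarrow> ('g \<times> 'g) set" where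
  "z_rel G = {(x, y). x \<in> carrier G \<and> y \<in> carrier G \<and>
                conjugate_subsets G (centralizer G x) (centralizer G y)}"

text \<open>The number of \<open>z\<close>-classes of \<open>G\<close> that contain an element with property \<open>P\<close>.\<close>

definition num_z_classes :: "('g, 'm) monoid_scheme \<Rightarrow> ('g \<Rightarrow> bool) \<Rightarrow> nat" where
  "num_z_classes G P = card ({x \<in> carrier G. P x} // z_rel G)"

section \<open>General linear and unitary groups\<close>

definition general_linear_group :: "'a :: field itself \<Rightarrow> nat \<Rightarrow> 'a mat monoid" where
  "general_linear_group ty n = units_of (ring_mat ty n ())"

text \<open>
  In a field with \<open>q\<^sup>2\<close> elements, the map \<open>a \<mapsto> a ^ q\<close> is the involution whose
  fixed field has \<open>q\<close> elements; below, \<open>q\<close> always has this meaning.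
\<close>

definition bar_mat :: "nat \<Rightarrow> 'b :: field mat \<Rightarrow> 'b mat" where
  "bar_mat q A = map_mat (\<lambda>a. a ^ q) A"

definition hermitian_mat :: "nat \<Rightarrow> 'b :: field mat \<Rightarrow> bool" where
  "hermitian_mat q J \<longleftrightarrow> square_mat J \<and> transpose_mat J = bar_mat q J"

definition unitary_group :: "nat \<Rightarrow> nat \<Rightarrow> 'b :: field mat \<Rightarrow> 'b mat monoid" where
  "unitary_group q n J = (general_linear_group TYPE('b) n)
     \<lparr>carrier := {g \<in> carrier (general_linear_group TYPE('b) n). transpose_mat g * J * bar_mat q g = J}\<rparr>"

section \<open>Unipotent and semisimple matrices\<close>

definition unipotent_mat :: "'a :: field mat \<Rightarrow> bool" where
  "unipotent_mat g \<longleftrightarrow> square_mat g \<and>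
     (\<exists>k. (g - 1\<^sub>m (dim_row g)) ^\<^sub>m k = 0\<^sub>m (dim_row g) (dim_row g))"

text \<open>Semisimple means diagonalizable over the algebraic closure.\<close>

definition semisimple_mat :: "'a :: field mat \<Rightarrow> bool" where
  "semisimple_mat g \<longleftrightarrow> (\<exists>D. diagonal_mat D \<and> similar_mat (map_mat to_ac g) D)"

section \<open>Partitions\<close>

definition num_partitions :: "nat \<Rightarrow> nat" where
  "num_partitions n = card {M :: nat multiset. 0 \<notin># M \<and> sum_mset M = n}"

end

(*
  For both groups, two elements s and t are z-equivalent iff some conjugate of s has the same
  commutant in the full matrix algebra as t. This rests on two facts: elements of U_n(q) that are
  conjugate in GL_n(q^2) are conjugate in U_n(q), because a unit fixed by an involution of a finite
  commutative ring is a norm; and every matrix commuting with s lies in the algebra generated by the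
  group elements commuting with s.

  A unipotent u is determined up to similarity by its commutant, through the dimensions of the
  kernels of (u - 1)^k, so z-classes of unipotents correspond to Jordan types. Every Jordan type
  occurs in U_n(q): a nilpotent matrix is skew-adjoint for a suitable hermitian form, and its Cayley
  transform is unitary; all hermitian forms are equivalent.

  Over the algebraic closure, conjugation of diagonal matrices into the group amounts to a condition
  on the eigenvalues involving only psi(x) = x^q for GL_n(q) and psi(x) = x^(-q) for U_n(q). Hence
  the spectra of semisimple elements are the psi-stable multisets of n nonzero elements, and two
  semisimple elements are z-equivalent iff their spectra correspond under a psi-equivariant
  bijection. For q > n both maps psi have enough points of every exact period for any such
  configuration of one group to be realized in the other.
*)
theory Submission
  imports Defs
    "Jordan_Normal_Form.Jordan_Normal_Form_Existence"
    "Jordan_Normal_Form.Jordan_Normal_Form_Uniqueness"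
begin

section \<open>Finite rings with involution\<close>

text \<open>The conjugacy and the commutation statement for the unitary group are not derived from a
  classification of centralizers. Each is reduced to one self-adjoint or skew element, whose double
  commutant is a finite commutative ring stable under the involution. This ring may contain
  nilpotents and need not be local, so the formulas familiar over a field, \<open>1 + u\<close> in
  Hilbert 90 and the Cayley transform of a skew element, can fail to produce units. The remedy is
  the same both times: some power of the critical element is an idempotent fixed by the involution;
  the formula is kept where that element is invertible and altered, by means of a scalar that the
  involution negates, where it is nilpotent. The norm statement then follows by counting. The bound
  \<open>q > n\<close> acts in two places. It leaves enough scalars in the base field to descend a
  similarity from the algebraic closure one weight at a time, and it is what the count of points of
  period one allows: \<open>x^q = x\<close> has \<open>q - 1\<close> nonzero solutions.\<close>

lemma (in monoid) idempotent_power: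
  assumes "finite (carrier G)" and x: "x \<in> carrier G"
  shows "\<exists>m>0. x [^] m \<otimes> x [^] (m::nat) = x [^] m"
proof -
  have "finite (range (\<lambda>i::nat. x [^] i))"
    using assms by (intro finite_subset[OF _ assms(1)]) auto
  then have "\<not> inj (\<lambda>i::nat. x [^] i)" using finite_imageD infinite_UNIV_nat by blast
  then obtain i j :: nat where "x [^] i = x [^] j" "i \<noteq> j"
    unfolding inj_def by blast
  then have "\<exists>i j::nat. x [^] i = x [^] j \<and> i < j" using nat_neq_iff by fastforce
  then obtain i j :: nat where "x [^] i = x [^] j" "i < j" by blast
  then obtain i p :: nat where p: "p > 0" and eq: "x [^] (i + p) = x [^] i"
    using less_imp_add_positive[of i j] that[of _ i] by force
  have step: "x [^] (k + p) = x [^] k" if "k \<ge> i" for k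
  proof -
    obtain l where l: "k = i + l" using \<open>i \<le> k\<close> le_Suc_ex by blast
    have "x [^] (k + p) = x [^] (i + p) \<otimes> x [^] l"
      using x by (simp add: l nat_pow_mult ac_simps)
    also have "\<dots> = x [^] k" using x by (simp add: eq l nat_pow_mult)
    finally show ?thesis .
  qed
  have "x [^] (k + m * p) = x [^] k" if "k \<ge> i" for k m :: nat
  proof (induction m)
    case (Suc m)
    have "x [^] (k + Suc m * p) = x [^] ((k + m * p) + p)" by (simp add: algebra_simps)
    also have "\<dots> = x [^] k" using step[of "k + m * p"] that Suc by simp
    finally show ?case .
  qed simp
  \<comment> \<open>An exponent that is a multiple of the period \<open>p\<close> and not below the
    preperiod \<open>i\<close> gives an idempotent; the factor \<open>Suc i\<close> instead of
    \<open>i\<close> keeps it positive for \<open>i = 0\<close>.\<close>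
  moreover have "i \<le> Suc i * p" using p by (cases p) auto
  ultimately have "x [^] (Suc i * p + Suc i * p) = x [^] (Suc i * p)" by blast
  then show ?thesis using p x by (intro exI[of _ "Suc i * p"]) (simp add: nat_pow_mult)
qed

text \<open>Multiplication by a regular element is injective on the finite carrier, hence
  surjective, and so it attains \<open>1\<close>. Invertibility is established below by this
  criterion rather than by exhibiting inverses.\<close>

lemma (in cring) regular_imp_unit:
  assumes "finite (carrier R)" and c: "c \<in> carrier R"
    and reg: "\<And>v. v \<in> carrier R \<Longrightarrow> c \<otimes> v = \<zero> \<Longrightarrow> v = \<zero>"
  shows "c \<in> Units R"
proof -
  have "inj_on (\<lambda>v. c \<otimes> v) (carrier R)"
  proof (rule inj_onI)
    fix v w assume *: "v \<in> carrier R" "w \<in> carrier R" "c \<otimes> v = c \<otimes> w"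
    then have "c \<otimes> (v \<ominus> w) = \<zero>" using c by algebra
    then show "v = w" using reg[of "v \<ominus> w"] * by simp
  qed
  then have "(\<lambda>v. c \<otimes> v) ` carrier R = carrier R"
    using assms(1) c by (intro endo_inj_surj) auto
  then have "\<one> \<in> (\<lambda>v. c \<otimes> v) ` carrier R" by simp
  then obtain d where "d \<in> carrier R" "c \<otimes> d = \<one>" by auto
  then show ?thesis using c m_comm[of c d] by (auto simp: Units_def)
qed

text \<open>Multiplication by \<open>eps\<close> exchanges elements fixed and elements negated by
  the involution, which is how expressions that fail to be units are repaired. The last axiom makes
  both \<open>2 - eps\<close> and \<open>2 + eps\<close> units; the repair of \<open>1 + A\<close>
  for a skew \<open>A\<close> depends on it.\<close>

locale inv_cring = cring R for R (structure) +
  fixes star :: "'a \<Rightarrow> 'a" and eps :: 'a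
  assumes fin: "finite (carrier R)"
    and star_closed [simp]: "x \<in> carrier R \<Longrightarrow> star x \<in> carrier R"
    and star_star [simp]: "x \<in> carrier R \<Longrightarrow> star (star x) = x"
    and star_add: "x \<in> carrier R \<Longrightarrow> y \<in> carrier R \<Longrightarrow> star (x \<oplus> y) = star x \<oplus> star y"
    and star_mult: "x \<in> carrier R \<Longrightarrow> y \<in> carrier R \<Longrightarrow> star (x \<otimes> y) = star x \<otimes> star y"
    and eps: "eps \<in> Units R" "star eps = \<ominus> eps"
    and two: "\<one> \<oplus> \<one> \<in> Units R"
    and eps4: "(\<one> \<oplus> \<one>) \<otimes> (\<one> \<oplus> \<one>) \<ominus> eps \<otimes> eps \<in> Units R"
begin

lemma eps_closed [simp]: "eps \<in> carrier R" using eps(1) by (rule Units_closed)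

lemma star_one [simp]: "star \<one> = \<one>"
proof -
  have "star (star \<one>) \<otimes> star \<one> = star (star \<one> \<otimes> \<one>)" by (rule star_mult[symmetric]) auto
  then show ?thesis by simp
qed

lemma star_zero [simp]: "star \<zero> = \<zero>"
proof -
  have "star \<zero> \<oplus> star \<zero> = star \<zero> \<oplus> \<zero>" using star_add[of \<zero> \<zero>] by simp
  then show ?thesis using add.l_cancel star_closed zero_closed by blast
qed

lemma star_uminus:
  assumes x: "x \<in> carrier R" shows "star (\<ominus> x) = \<ominus> star x"
proof -
  have "star (\<ominus> x) \<oplus> star x = \<zero>" using star_add[of "\<ominus> x" x] x by (simp add: l_neg)
  then show ?thesis using minus_equality[of "star (\<ominus> x)" "star x"] x by simp
qed

lemma star_minus: "x \<in> carrier R \<Longrightarrow> y \<in> carrier R \<Longrightarrow> star (x \<ominus> y) = star x \<ominus> star y"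
  by (simp add: a_minus_def star_add star_uminus)

lemma star_pow: "x \<in> carrier R \<Longrightarrow> star (x [^] (k::nat)) = star x [^] k"
  by (induction k) (auto simp: star_mult)

lemma star_Units: "x \<in> Units R \<Longrightarrow> star x \<in> Units R"
proof -
  assume "x \<in> Units R"
  then obtain y where y: "x \<in> carrier R" "y \<in> carrier R" "x \<otimes> y = \<one>" "y \<otimes> x = \<one>"
    by (auto simp: Units_def)
  then have "star x \<otimes> star y = \<one>" "star y \<otimes> star x = \<one>" by (simp_all flip: star_mult)
  then show ?thesis using y unfolding Units_def by auto
qed

lemma unit_cancel_zero:
  assumes "u \<in> Units R" "v \<in> carrier R" "u \<otimes> v = \<zero>" shows "v = \<zero>"
proof -
  have "u \<otimes> v = u \<otimes> \<zero>" using assms by (simp add: Units_closed)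
  then show ?thesis using assms Units_l_cancel by blast
qed

text \<open>\<open>star e\<close> is a unit multiple of \<open>e\<close>, so both idempotents
  generate the same ideal and must coincide. Thus the involution respects the Fitting decomposition
  of \<open>v\<close>, which is invertible on \<open>e\<close> and nilpotent on
  \<open>1 - e\<close>.\<close>

lemma fitting_idempotent:
  assumes v: "v \<in> carrier R" and w: "w \<in> Units R" and sv: "star v = w \<otimes> v"
  obtains e m where "e \<in> carrier R" "e \<otimes> e = e" "star e = e" "m > 0" "e = v [^] (m::nat)"
proof -
  obtain m :: nat where m: "m > 0" "v [^] m \<otimes> v [^] m = v [^] m"
    using idempotent_power[OF fin v] by blast
  define e where "e = v [^] m"
  define f where "f = star e"
  have e: "e \<in> carrier R" "e \<otimes> e = e" using m v by (auto simp: e_def)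
  have f: "f \<in> carrier R" "f \<otimes> f = f" using e star_mult[of e e] by (auto simp: f_def)
  define a where "a = w [^] m"
  have a: "a \<in> Units R" using w by (simp add: a_def Units_pow_closed)
  have fa: "f = a \<otimes> e" using v w by (simp add: f_def e_def a_def star_pow sv nat_pow_distrib Units_closed)
  have "a \<otimes> (e \<otimes> f) = a \<otimes> e"
  proof -
    have "a \<otimes> (e \<otimes> f) = (a \<otimes> e) \<otimes> f" using Units_closed[OF a] e f by (simp add: m_assoc)
    then show ?thesis using f fa by simp
  qed
  then have "e \<otimes> f = e" using a e(1) f(1) by simp
  moreover have "e \<otimes> f = f"
  proof -
    have "e \<otimes> f = a \<otimes> (e \<otimes> e)" using Units_closed[OF a] e(1) by (simp add: fa m_lcomm)
    then show ?thesis by (simp add: e(2) fa)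
  qed
  ultimately show ?thesis using that[of e m] e m by (auto simp: f_def e_def)
qed

text \<open>The classical solution \<open>c = 1 + u\<close> may be a zero divisor. Where
  \<open>1 + u\<close> is nilpotent, \<open>1 - u = 2 - (1 + u)\<close> is invertible, and
  \<open>eps (1 - u)\<close> solves the same equation because \<open>star eps = - eps\<close>. The
  two solutions are glued along the idempotent of \<open>1 + u\<close>.\<close>

lemma hilbert90:
  assumes u: "u \<in> carrier R" and uu: "u \<otimes> star u = \<one>"
  shows "\<exists>c\<in>Units R. u \<otimes> star c = c"
proof -
  define v where "v = \<one> \<oplus> u"
  have v: "v \<in> carrier R" using u by (simp add: v_def)
  have su: "star u \<in> Units R" unfolding Units_def using u uu m_comm[of u "star u"] by auto
  have "star v = star u \<otimes> v"
    using u uu by (simp add: v_def star_add r_distr m_comm a_comm)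
  then obtain e m where e: "e \<in> carrier R" "e \<otimes> e = e" "star e = e" and m: "m > 0" "e = v [^] (m::nat)"
    using fitting_idempotent[OF v su] by blast
  define c where "c = e \<otimes> v \<oplus> eps \<otimes> (\<one> \<ominus> e) \<otimes> (\<one> \<ominus> u)"
  have c: "c \<in> carrier R" using e u v by (simp add: c_def)
  have sc: "star c = e \<otimes> (\<one> \<oplus> star u) \<oplus> (\<ominus> eps) \<otimes> (\<one> \<ominus> e) \<otimes> (\<one> \<ominus> star u)"
    using e u v by (simp add: c_def v_def star_add star_mult star_minus eps)
  have "u \<otimes> star c = e \<otimes> (u \<oplus> u \<otimes> star u) \<oplus> (\<ominus> eps) \<otimes> (\<one> \<ominus> e) \<otimes> (u \<ominus> u \<otimes> star u)"
    unfolding sc using e(1) u star_closed[OF u] eps_closed apply - apply algebra done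
  also have "\<dots> = c" unfolding uu c_def v_def using e(1) u eps_closed by algebra
  finally have cu: "u \<otimes> star c = c" .
  have "c \<in> Units R"
  proof (rule regular_imp_unit[OF fin c])
    fix w assume w: "w \<in> carrier R" and cw: "c \<otimes> w = \<zero>"
    have "e \<otimes> (c \<otimes> w) = (e \<otimes> e) \<otimes> v \<otimes> w \<oplus> eps \<otimes> (e \<ominus> e \<otimes> e) \<otimes> (\<one> \<ominus> u) \<otimes> w"
      unfolding c_def using e(1) u v w eps_closed by algebra
    then have evw: "e \<otimes> v \<otimes> w = \<zero>" using e u v w cw by (simp add: r_neg a_minus_def)
    obtain k where k: "m = Suc k" using m(1) by (cases m) auto
    have "e \<otimes> w = e \<otimes> e \<otimes> w" using e by simp
    also have "\<dots> = v [^] k \<otimes> (e \<otimes> v \<otimes> w)" using e v w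
      by (subst (2) m(2)) (simp add: k m_ac)
    finally have ew: "e \<otimes> w = \<zero>" using evw v by simp
    have "c \<otimes> w = v \<otimes> (e \<otimes> w) \<oplus> eps \<otimes> ((\<one> \<ominus> u) \<otimes> (w \<ominus> e \<otimes> w))"
      unfolding c_def using e(1) u v w eps_closed by algebra
    then have "eps \<otimes> ((\<one> \<ominus> u) \<otimes> w) = \<zero>" using ew cw v w u by (simp add: a_minus_def)
    then have "(\<one> \<ominus> u) \<otimes> w = \<zero>" using unit_cancel_zero[OF eps(1)] u w by simp
    moreover have "v \<otimes> w = (\<one> \<oplus> \<one>) \<otimes> w \<ominus> (\<one> \<ominus> u) \<otimes> w" 
      unfolding v_def using u w by algebra
    ultimately have vw: "v \<otimes> w = (\<one> \<oplus> \<one>) \<otimes> w" using w by (simp add: a_minus_def)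
    \<comment> \<open>On \<open>w\<close> the element \<open>v\<close> acts as the unit
      \<open>2\<close>, while its power \<open>v^m = e\<close> kills \<open>w\<close>.\<close>
    have "v [^] k \<otimes> w = (\<one> \<oplus> \<one>) [^] k \<otimes> w" for k :: nat
    proof (induction k)
      case (Suc k)
      have "v [^] Suc k \<otimes> w = v [^] k \<otimes> (v \<otimes> w)" using v w by (simp add: m_ac)
      also have "\<dots> = (\<one> \<oplus> \<one>) \<otimes> (v [^] k \<otimes> w)" unfolding vw using v w by (simp add: m_ac)
      also have "\<dots> = (\<one> \<oplus> \<one>) [^] Suc k \<otimes> w" unfolding Suc using w by (simp add: m_ac)
      finally show ?case .
    qed (use w in simp)
    from this[of m] have "(\<one> \<oplus> \<one>) [^] m \<otimes> w = \<zero>" using ew m by simp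
    then show "w = \<zero>" using unit_cancel_zero[OF Units_pow_closed[OF two]] w by blast
  qed
  then show ?thesis using cu by blast
qed

text \<open>A count in the finite unit group, using the norm \<open>N\<close> and the quotient
  \<open>D x = x / star x\<close>. The kernel of \<open>D\<close> consists of the fixed units, and
  by \<open>hilbert90\<close> its image is the kernel of \<open>N\<close>. Comparing orders, the
  image of \<open>N\<close> is as large as the group of fixed units in which it lies.\<close>

lemma fixed_unit_is_norm:
  assumes h: "h \<in> Units R" "star h = h"
  shows "\<exists>y\<in>Units R. y \<otimes> star y = h"
proof -
  define N where "N x = x \<otimes> star x" for x
  define D where "D x = x \<otimes> inv (star x)" for x
  let ?U = "Units R"
  let ?K = "{x \<in> ?U. N x = \<one>}" and ?F = "{x \<in> ?U. star x = x}"
  have U: "x \<in> carrier R" if "x \<in> ?U" for x using that by (rule Units_closed)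
  have finU: "finite ?U" using fin U by (meson finite_subset subsetI)
  have N_mult: "N (x \<otimes> y) = N x \<otimes> N y" if "x \<in> ?U" "y \<in> ?U" for x y
    using that by (simp add: N_def star_mult U m_ac)
  have D_mult: "D (x \<otimes> y) = D x \<otimes> D y" if "x \<in> ?U" "y \<in> ?U" for x y
  proof -
    have "(star x \<otimes> star y) \<otimes> (inv (star x) \<otimes> inv (star y)) =
        (star x \<otimes> inv (star x)) \<otimes> (star y \<otimes> inv (star y))"
      using that by (simp add: U star_Units m_ac del: Units_r_inv Units_l_inv)
    then have *: "(star x \<otimes> star y) \<otimes> (inv (star x) \<otimes> inv (star y)) = \<one>"
      using that by (simp add: star_Units)
    then have "inv (star x) \<otimes> inv (star y) = inv (star x \<otimes> star y)"
      using that by (intro inv_unique') (simp_all add: U star_Units m_comm)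
    then have "D (x \<otimes> y) = (x \<otimes> y) \<otimes> (inv (star x) \<otimes> inv (star y))"
      using that by (simp add: D_def star_mult U)
    then show ?thesis using that by (simp add: D_def U star_Units m_ac)
  qed
  have DU: "D x \<in> ?U" if "x \<in> ?U" for x using that by (simp add: D_def star_Units)
  have NU: "N x \<in> ?U" if "x \<in> ?U" for x using that by (simp add: N_def star_Units)
  have fibres: "card ?U = card (f ` ?U) * card {x \<in> ?U. f x = \<one>}"
    if f: "\<And>x. x \<in> ?U \<Longrightarrow> f x \<in> ?U" "\<And>x y. x \<in> ?U \<Longrightarrow> y \<in> ?U \<Longrightarrow> f (x \<otimes> y) = f x \<otimes> f y" for f
  proof -
    have fibre: "card {x \<in> ?U. f x = y} = card {x \<in> ?U. f x = \<one>}" if "y \<in> f ` ?U" for y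
    proof -
      obtain z where z: "z \<in> ?U" "y = f z" using \<open>y \<in> f ` ?U\<close> by blast
      have "bij_betw (\<lambda>x. z \<otimes> x) {x \<in> ?U. f x = \<one>} {x \<in> ?U. f x = y}"
      proof (rule bij_betw_imageI)
        show "inj_on (\<lambda>x. z \<otimes> x) {x \<in> ?U. f x = \<one>}" using z by (auto simp: inj_on_def U)
        show "(\<lambda>x. z \<otimes> x) ` {x \<in> ?U. f x = \<one>} = {x \<in> ?U. f x = y}"
        proof (intro equalityI subsetI)
          fix x assume "x \<in> (\<lambda>x. z \<otimes> x) ` {x \<in> ?U. f x = \<one>}"
          then show "x \<in> {x \<in> ?U. f x = y}" using z f by (auto simp: U)
        next
          fix x assume x: "x \<in> {x \<in> ?U. f x = y}"
          have zx: "inv z \<otimes> x \<in> ?U" "z \<otimes> (inv z \<otimes> x) = x"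
            using x z by (auto simp: U simp flip: m_assoc)
          have "f z \<otimes> f (inv z \<otimes> x) = f z \<otimes> \<one>"
            using x z zx by (simp add: U f flip: f(2))
          then have "f (inv z \<otimes> x) = \<one>"
            using Units_l_cancel[of "f z" "f (inv z \<otimes> x)" \<one>] z f(1) zx by (simp add: U)
          then show "x \<in> (\<lambda>x. z \<otimes> x) ` {x \<in> ?U. f x = \<one>}" using zx by force
        qed
      qed
      then show ?thesis by (simp add: bij_betw_same_card)
    qed
    have "card ?U = (\<Sum>x\<in>?U. 1)" by simp
    also have "\<dots> = (\<Sum>y\<in>f ` ?U. \<Sum>x\<in>{x \<in> ?U. f x = y}. 1)" by (rule sum.image_gen[OF finU])
    also have "\<dots> = (\<Sum>y\<in>f ` ?U. card {x \<in> ?U. f x = \<one>})" by (simp add: fibre)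
    finally show ?thesis by simp
  qed
  have "{x \<in> ?U. D x = \<one>} = ?F"
  proof (intro Collect_cong conj_cong refl)
    fix x assume x: "x \<in> ?U"
    have sx: "star x \<in> ?U" using x by (rule star_Units)
    have *: "D x \<otimes> star x = x" using x sx by (simp add: D_def U m_assoc)
    show "(D x = \<one>) = (star x = x)"
    proof
      assume "D x = \<one>"
      then show "star x = x" using * sx U by simp
    next
      assume "star x = x"
      then show "D x = \<one>" using sx by (simp add: D_def)
    qed
  qed
  moreover have "D ` ?U = ?K"
  proof (intro equalityI subsetI)
    fix u assume "u \<in> D ` ?U"
    then obtain x where x: "x \<in> ?U" "u = D x" by blast
    define y where "y = star x"
    have y: "y \<in> ?U" "star y = x" using x by (auto simp: y_def star_Units U)
    have "star (inv y) \<otimes> star y = star (inv y \<otimes> y)"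
      using y by (simp only: star_mult U Units_inv_closed)
    then have *: "star (inv y) \<otimes> x = \<one>" using y by simp
    have "N u = (x \<otimes> inv y) \<otimes> (y \<otimes> star (inv y))"
      using x y by (simp add: N_def D_def y_def[symmetric] star_mult U)
    also have "\<dots> = (star (inv y) \<otimes> x) \<otimes> (inv y \<otimes> y)"
      using x(1) y(1) by (simp only: m_ac U Units_inv_closed star_closed m_closed)
    also have "\<dots> = \<one>" using y by (simp add: *)
    finally have "N u = \<one>" .
    then show "u \<in> ?K" using x DU by simp
  next
    fix u assume u: "u \<in> ?K"
    then obtain c where c: "c \<in> ?U" "u \<otimes> star c = c" using hilbert90[of u] U by (auto simp: N_def)
    have "D c = u \<otimes> star c \<otimes> inv (star c)" using c(2) by (simp add: D_def)
    also have "\<dots> = u" using m_assoc[of u "star c" "inv (star c)"] c(1) u by (simp add: U star_Units)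
    finally show "u \<in> D ` ?U" using c by blast
  qed
  ultimately have "card ?U = card ?K * card ?F"
    using fibres[of D, OF DU D_mult] by simp
  moreover have "card ?U = card (N ` ?U) * card ?K" by (rule fibres[of N, OF NU N_mult])
  ultimately have "card (N ` ?U) * card ?K = card ?K * card ?F" by simp
  moreover have "card ?K \<noteq> 0"
  proof -
    have "\<one> \<in> ?K" by (simp add: N_def)
    then show ?thesis using finU by auto
  qed
  ultimately have "card (N ` ?U) = card ?F" by simp
  moreover have "N ` ?U \<subseteq> ?F" 
  proof
    fix y assume "y \<in> N ` ?U"
    then obtain x where x: "x \<in> ?U" "y = N x" by blast
    have "star (N x) = N x" using x U[of x] by (simp add: N_def star_mult m_comm)
    then show "y \<in> ?F" using x NU by simp
  qed
  ultimately have "N ` ?U = ?F" using finU by (simp add: card_subset_eq)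
  then have "h \<in> N ` ?U" using h by simp
  then show ?thesis by (auto simp: N_def)
qed

text \<open>A Cayley transform of \<open>A\<close> requires \<open>1 + A\<close> to be a unit. Let
  \<open>e\<close> be the idempotent power of \<open>1 - A^2\<close>. On \<open>e\<close> the factor
  \<open>1 + A\<close> is invertible; on \<open>1 - e\<close> the square of \<open>A\<close> is
  \<open>1\<close> up to a nilpotent, and adding \<open>eps\<close> there moves \<open>A\<close>
  away from \<open>- 1\<close> while keeping it skew.\<close>

lemma skew_cayley_decomposition:
  assumes A: "A \<in> carrier R" "star A = \<ominus> A"
  shows "\<exists>e C. e \<in> carrier R \<and> e \<otimes> e = e \<and> star e = e \<and> C \<in> carrier R \<and> star C = \<ominus> C \<and>
    \<one> \<oplus> C \<in> Units R \<and> A = C \<ominus> eps \<otimes> (\<one> \<ominus> e)"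
proof -
  define B where "B = \<one> \<ominus> A \<otimes> A"
  have B: "B \<in> carrier R" "star B = \<one> \<otimes> B"
    using A by (auto simp: B_def star_minus star_mult l_minus r_minus)
  obtain e m where e: "e \<in> carrier R" "e \<otimes> e = e" "star e = e" and m: "m > 0" "e = B [^] (m::nat)"
    using fitting_idempotent[OF B(1) Units_one_closed B(2)] by blast
  define C where "C = A \<oplus> eps \<otimes> (\<one> \<ominus> e)"
  have C: "C \<in> carrier R" using A e by (simp add: C_def)
  have sC: "star C = \<ominus> C"
    using A e by (simp add: C_def star_add star_mult star_minus eps minus_add l_minus)
  let ?t = "\<one> \<oplus> \<one>"
  define f where "f = ?t \<otimes> ?t \<ominus> eps \<otimes> eps"
  have f: "f \<in> Units R" using eps4 by (simp add: f_def)
  have "\<one> \<oplus> C \<in> Units R"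
  proof (rule regular_imp_unit[OF fin])
    show "\<one> \<oplus> C \<in> carrier R" using C by simp
    fix v assume v: "v \<in> carrier R" and Cv: "(\<one> \<oplus> C) \<otimes> v = \<zero>"
    have "e \<otimes> ((\<one> \<oplus> C) \<otimes> v) = e \<otimes> v \<oplus> e \<otimes> A \<otimes> v \<oplus> eps \<otimes> (e \<ominus> e \<otimes> e) \<otimes> v"
      unfolding C_def using e(1) A(1) v eps_closed by algebra
    then have eAv: "e \<otimes> v \<oplus> e \<otimes> A \<otimes> v = \<zero>" using e A v Cv by (simp add: r_neg a_minus_def)
    have "B \<otimes> (e \<otimes> v) = (\<one> \<ominus> A) \<otimes> (e \<otimes> v \<oplus> e \<otimes> A \<otimes> v)"
      unfolding B_def using e(1) A(1) v by algebra
    then have Bev: "B \<otimes> (e \<otimes> v) = \<zero>" using eAv A by simp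
    obtain k where k: "m = Suc k" using m(1) by (cases m) auto
    have "e \<otimes> v = e \<otimes> e \<otimes> v" using e by simp
    also have "\<dots> = B [^] k \<otimes> (B \<otimes> (e \<otimes> v))" using e v B
      by (subst (1) m(2)) (simp add: k m_ac)
    finally have ev: "e \<otimes> v = \<zero>" using Bev B by simp
    have "(\<one> \<oplus> C) \<otimes> v = A \<otimes> v \<oplus> (\<one> \<oplus> eps) \<otimes> v \<ominus> eps \<otimes> (e \<otimes> v)"
      unfolding C_def using e(1) A(1) v eps_closed by algebra
    then have Av: "A \<otimes> v \<oplus> (\<one> \<oplus> eps) \<otimes> v = \<zero>" using Cv ev A v by (simp add: a_minus_def)
    \<comment> \<open>The product \<open>(h - A) (h + A)\<close> is \<open>B + (h^2 - 1)\<close>.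
      Its second summand is \<open>eps (2 + eps)\<close>, which multiplication by
      \<open>2 - eps\<close> turns into the unit \<open>eps * f\<close>; this forces
      \<open>v\<close> to be a multiple of \<open>B v\<close>.\<close>
    define h where "h = \<one> \<oplus> eps"
    have h: "h \<in> carrier R" by (simp add: h_def)
    have "B \<otimes> v \<oplus> (h \<otimes> h \<ominus> \<one>) \<otimes> v = (h \<ominus> A) \<otimes> (A \<otimes> v \<oplus> h \<otimes> v)"
      unfolding B_def using A(1) v h by algebra
    then have *: "B \<otimes> v \<oplus> (h \<otimes> h \<ominus> \<one>) \<otimes> v = \<zero>" using Av A h by (simp add: h_def)
    have "eps \<otimes> f = (?t \<ominus> eps) \<otimes> (h \<otimes> h \<ominus> \<one>)"
      unfolding f_def h_def using eps_closed by algebra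
    then have "(?t \<ominus> eps) \<otimes> (B \<otimes> v) \<oplus> (eps \<otimes> f) \<otimes> v =
        (?t \<ominus> eps) \<otimes> (B \<otimes> v \<oplus> (h \<otimes> h \<ominus> \<one>) \<otimes> v)"
      using v h B(1) by (simp add: r_distr m_assoc)
    then have eq: "(?t \<ominus> eps) \<otimes> (B \<otimes> v) \<oplus> eps \<otimes> (f \<otimes> v) = \<zero>"
      using * f v by (simp add: m_assoc Units_closed)
    define g where "g = eps \<otimes> f"
    have g: "g \<in> Units R" using f eps by (simp add: g_def)
    \<comment> \<open>Chosen so that \<open>v = \<kappa> * (B * v)\<close>. Iterating
      \<open>m\<close> times replaces \<open>B\<close> by its power \<open>e\<close>, which kills
      \<open>v\<close>.\<close>
    define \<kappa> where "\<kappa> = \<ominus> (inv g \<otimes> (?t \<ominus> eps))"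
    have \<kappa>: "\<kappa> \<in> carrier R" using g by (simp add: \<kappa>_def)
    have "eps \<otimes> (f \<otimes> v) = g \<otimes> v" using f v by (simp add: g_def Units_closed m_assoc)
    then have "v = inv g \<otimes> (eps \<otimes> (f \<otimes> v))"
      using m_assoc[of "inv g" g v] g v by (simp add: Units_closed)
    also have "eps \<otimes> (f \<otimes> v) = \<ominus> ((?t \<ominus> eps) \<otimes> (B \<otimes> v))"
      using eq f v B(1) by (intro minus_equality[symmetric]) (auto simp: Units_closed a_comm)
    also have "inv g \<otimes> \<dots> = \<kappa> \<otimes> (B \<otimes> v)"
      unfolding \<kappa>_def using B(1) v Units_inv_closed[OF g] eps_closed by algebra
    finally have vB: "\<kappa> \<otimes> (B \<otimes> v) = v" by simp
    have "\<kappa> [^] j \<otimes> (B [^] j \<otimes> v) = v" for j :: nat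
    proof (induction j)
      case (Suc j)
      have "\<kappa> [^] Suc j \<otimes> (B [^] Suc j \<otimes> v) = \<kappa> [^] j \<otimes> (B [^] j \<otimes> (\<kappa> \<otimes> (B \<otimes> v)))"
        using \<kappa> B(1) v by (simp add: m_ac)
      then show ?case using vB Suc by simp
    qed (use v in simp)
    from this[of m] show "v = \<zero>" using ev m \<kappa> by simp
  qed
  moreover have "A = C \<ominus> eps \<otimes> (\<one> \<ominus> e)" unfolding C_def using A(1) e(1) eps_closed by algebra
  ultimately show ?thesis using e C sC by blast
qed

end

section \<open>Double commutants in a noncommutative ring\<close>

context ring
begin

text \<open>It takes the place of the algebra of polynomials in \<open>x\<close>: it is commutative,
  closed under inverses that exist in the ring, and everything commuting with \<open>x\<close>
  commutes with it.\<close>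

definition bicommutant where
  "bicommutant x = {y \<in> carrier R. \<forall>a\<in>carrier R. a \<otimes> x = x \<otimes> a \<longrightarrow> a \<otimes> y = y \<otimes> a}"

lemma minus_add_cancel: "x \<in> carrier R \<Longrightarrow> y \<in> carrier R \<Longrightarrow> (x \<ominus> y) \<oplus> y = x"
  by (simp add: a_minus_def a_assoc l_neg)

lemma bicommutantD: "y \<in> bicommutant x \<Longrightarrow> a \<in> carrier R \<Longrightarrow> a \<otimes> x = x \<otimes> a \<Longrightarrow> a \<otimes> y = y \<otimes> a"
  by (simp add: bicommutant_def)

lemma bicommutant_self: "x \<in> carrier R \<Longrightarrow> x \<in> bicommutant x"
  by (simp add: bicommutant_def)

lemma bicommutant_carrier: "y \<in> bicommutant x \<Longrightarrow> y \<in> carrier R"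
  by (simp add: bicommutant_def)

lemma bicommutant_subcring:
  assumes x: "x \<in> carrier R"
  shows "subcring (bicommutant x) R"
proof (rule subcringI)
  show "subring (bicommutant x) R"
  proof (rule subringI)
    show "bicommutant x \<subseteq> carrier R" by (auto simp: bicommutant_def)
    show "\<one> \<in> bicommutant x" by (simp add: bicommutant_def)
    show "\<ominus> y \<in> bicommutant x" if "y \<in> bicommutant x" for y
      using that by (auto simp: bicommutant_def l_minus r_minus)
    show "y \<otimes> z \<in> bicommutant x" if "y \<in> bicommutant x" "z \<in> bicommutant x" for y z
    proof -
      have "a \<otimes> (y \<otimes> z) = (y \<otimes> z) \<otimes> a" if a: "a \<in> carrier R" "a \<otimes> x = x \<otimes> a" for a
      proof -
        note yz = bicommutantD[OF \<open>y \<in> _\<close> a] bicommutantD[OF \<open>z \<in> _\<close> a]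
          bicommutant_carrier[OF \<open>y \<in> _\<close>] bicommutant_carrier[OF \<open>z \<in> _\<close>]
        have "a \<otimes> (y \<otimes> z) = y \<otimes> (a \<otimes> z)"
          using m_assoc[of a y z] m_assoc[of y a z] yz a by simp
        also have "\<dots> = (y \<otimes> z) \<otimes> a" unfolding yz(2) using yz(3,4) a(1) by (simp add: m_assoc)
        finally show ?thesis .
      qed
      then show ?thesis using that by (auto simp: bicommutant_def)
    qed
    show "y \<oplus> z \<in> bicommutant x" if "y \<in> bicommutant x" "z \<in> bicommutant x" for y z
      using that by (auto simp: bicommutant_def l_distr r_distr)
  qed
  show "y \<otimes> z = z \<otimes> y" if "y \<in> bicommutant x" "z \<in> bicommutant x" for y z
  proof -
    have "x \<otimes> y = y \<otimes> x" using bicommutantD[OF that(1) x] by simp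
    then show ?thesis using bicommutantD[OF that(2) bicommutant_carrier[OF that(1)]] by simp
  qed
qed

text \<open>Strips invertible factors such as \<open>2\<close>, \<open>eps\<close> or the inverse of
  \<open>1 + C\<close> from a commutation relation.\<close>

lemma commute_unit_cancel:
  assumes "u \<in> Units R" "a \<in> carrier R" "t \<in> carrier R" "u \<otimes> t = t \<otimes> u"
    and "(u \<otimes> a) \<otimes> t = t \<otimes> (u \<otimes> a)"
  shows "a \<otimes> t = t \<otimes> a"
proof -
  have u: "u \<in> carrier R" using assms(1) by (rule Units_closed)
  have "u \<otimes> (a \<otimes> t) = (t \<otimes> u) \<otimes> a" using assms u by (simp add: m_assoc)
  also have "\<dots> = u \<otimes> (t \<otimes> a)" unfolding assms(4)[symmetric] using assms(2,3) u by (simp add: m_assoc)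
  finally show ?thesis using assms by simp
qed

lemma Units_bicommutant:
  assumes "y \<in> Units R" "y \<in> bicommutant x"
  shows "y \<in> Units (R\<lparr>carrier := bicommutant x\<rparr>)"
proof -
  have y: "y \<in> carrier R" using assms(1) by (rule Units_closed)
  have "inv y \<in> bicommutant x"
    unfolding bicommutant_def
  proof (intro CollectI conjI ballI impI)
    fix a assume a: "a \<in> carrier R" "a \<otimes> x = x \<otimes> a"
    have *: "y \<otimes> a = a \<otimes> y" using bicommutantD[OF assms(2) a] by simp
    have "(y \<otimes> inv y) \<otimes> a = a \<otimes> (y \<otimes> inv y)" using assms(1) a by simp
    then have "y \<otimes> (inv y \<otimes> a) = y \<otimes> (a \<otimes> inv y)"
      using assms(1) a y * by (simp flip: m_assoc del: Units_r_inv)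
    then show "a \<otimes> inv y = inv y \<otimes> a" using assms(1) a by simp
  qed (use assms in simp)
  then show ?thesis using assms y unfolding Units_def[of "R\<lparr>carrier := _\<rparr>"]
    by (auto intro!: bexI[of _ "inv y"])
qed

text \<open>In a finite ring with \<open>2\<close> invertible, every \<open>a\<close> is a combination of an idempotent power \<open>e\<close> of \<open>a\<close>
  and the units \<open>1 - 2e\<close> and \<open>a + 1 - e\<close>.\<close>

lemma commutes_if_commutes_units:
  assumes fin: "finite (carrier R)" and two: "\<one> \<oplus> \<one> \<in> Units R"
    and s: "s \<in> carrier R" and t: "t \<in> carrier R"
    and H: "\<And>g. g \<in> Units R \<Longrightarrow> g \<otimes> s = s \<otimes> g \<Longrightarrow> g \<otimes> t = t \<otimes> g"
    and a: "a \<in> carrier R" "a \<otimes> s = s \<otimes> a"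
  shows "a \<otimes> t = t \<otimes> a"
proof -
  let ?R = "R\<lparr>carrier := bicommutant a\<rparr>"
  note sub = bicommutant_subcring[OF a(1)]
  have E: "bicommutant a \<subseteq> carrier R" by (rule subcringE(1)[OF sub])
  interpret E: cring ?R using subcring_iff[OF E] sub by blast
  have aE: "a \<in> bicommutant a" by (rule bicommutant_self[OF a(1)])
  have finE: "finite (carrier ?R)" using fin E by (simp add: finite_subset)
  have commute_s: "y \<otimes> s = s \<otimes> y" if "y \<in> bicommutant a" for y
    using bicommutantD[OF that s] a by simp
  have commute_t: "y \<otimes> t = t \<otimes> y" if "y \<in> Units ?R" for y
  proof (rule H)
    show "y \<in> Units R" using that E by (auto simp: Units_def)
    show "y \<otimes> s = s \<otimes> y" using commute_s E.Units_closed[OF that] by simp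
  qed
  obtain m :: nat where m: "m > 0" "a [^]\<^bsub>?R\<^esub> m \<otimes> a [^]\<^bsub>?R\<^esub> m = a [^]\<^bsub>?R\<^esub> m"
    using E.idempotent_power[OF finE, of a] aE by auto
  define e where "e = a [^]\<^bsub>?R\<^esub> m"
  have e: "e \<in> bicommutant a" "e \<otimes> e = e" using m E.nat_pow_closed[of a m] aE by (auto simp: e_def)
  have ec: "e \<in> carrier R" using e E by blast
  have tw: "\<one> \<oplus> \<one> \<in> bicommutant a" using E.a_closed[OF E.one_closed E.one_closed] by simp
  define d where "d = (\<one> \<oplus> \<one>) \<otimes> e"
  have d: "d \<in> bicommutant a" using E.m_closed[of "\<one> \<oplus> \<one>" e] tw e by (simp add: d_def)
  have dc: "d \<in> carrier R" using d E by blast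
  define k where "k = \<one>\<^bsub>?R\<^esub> \<ominus>\<^bsub>?R\<^esub> d"
  have k: "k \<in> bicommutant a" using E.minus_closed[OF E.one_closed, of d] d by (simp add: k_def)
  have kc: "k \<in> carrier R" using k E by blast
  have kd: "k \<oplus> d = \<one>" using E.minus_add_cancel[of \<one> d] d E.one_closed by (simp add: k_def)
  have dd: "d \<otimes> d = d \<oplus> d" using ec e by (simp add: d_def l_distr r_distr)
  \<comment> \<open>\<open>k = 1 - 2e\<close> is the reflection belonging to the idempotent
    \<open>e\<close>, a unit of order at most two from which \<open>e\<close> is recovered after
    division by \<open>2\<close>.\<close>
  have "k \<otimes> k = \<one>"
  proof -
    have "k \<otimes> k \<oplus> k \<otimes> d = k \<otimes> \<one>" using kc dc by (simp add: r_distr[symmetric] kd)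
    moreover have "k \<otimes> d \<oplus> d \<otimes> d = d" using kc dc by (simp add: l_distr[symmetric] kd)
    then have "k \<otimes> d \<oplus> d \<oplus> d = \<zero> \<oplus> d" using kc dc by (simp add: dd a_assoc)
    then have kd': "k \<otimes> d \<oplus> d = \<zero>" using kc dc by (simp add: add.r_cancel)
    moreover have "k \<otimes> k \<oplus> (k \<otimes> d \<oplus> d) = (k \<otimes> k \<oplus> k \<otimes> d) \<oplus> d" using kc dc by (simp add: a_assoc)
    ultimately have "k \<otimes> k \<oplus> (k \<otimes> d \<oplus> d) = k \<oplus> d" using kc dc by simp
    then show ?thesis using kc kd kd' by simp
  qed
  then have "k \<in> Units ?R" using k by (auto simp: Units_def)
  then have kt: "k \<otimes> t = t \<otimes> k" by (rule commute_t)
  have "k \<otimes> t \<oplus> d \<otimes> t = t \<otimes> k \<oplus> t \<otimes> d"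
    using kc dc t by (simp add: l_distr[symmetric] r_distr[symmetric] kd)
  then have "d \<otimes> t = t \<otimes> d" unfolding kt using kc dc t by simp
  then have et: "e \<otimes> t = t \<otimes> e"
    using commute_unit_cancel[OF two ec t] t by (simp add: d_def l_distr r_distr)
  define c where "c = \<one>\<^bsub>?R\<^esub> \<ominus>\<^bsub>?R\<^esub> e"
  have c: "c \<in> bicommutant a" using E.minus_closed[OF E.one_closed, of e] e by (simp add: c_def)
  have cc: "c \<in> carrier R" using c E by blast
  have ce: "c \<oplus> e = \<one>" using E.minus_add_cancel[of \<one> e] e E.one_closed by (simp add: c_def)
  have ct: "c \<otimes> t = t \<otimes> c"
  proof -
    have "c \<otimes> t \<oplus> e \<otimes> t = t \<otimes> c \<oplus> t \<otimes> e"
      using cc ec t by (simp add: l_distr[symmetric] r_distr[symmetric] ce)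
    then show ?thesis unfolding et using cc ec t by simp
  qed
  \<comment> \<open>Here \<open>c = 1 - e\<close>. As \<open>a\<close> is invertible on
    \<open>e\<close> and nilpotent on \<open>c\<close>, adding \<open>1\<close> on the second part
    alone produces a unit.\<close>
  have "a \<oplus> c \<in> Units ?R"
  proof (rule E.regular_imp_unit[OF finE])
    show acE: "a \<oplus> c \<in> carrier ?R" using E.a_closed[of a c] aE c by simp
    fix v assume "v \<in> carrier ?R" and eq': "(a \<oplus> c) \<otimes>\<^bsub>?R\<^esub> v = \<zero>\<^bsub>?R\<^esub>"
    then have v: "v \<in> bicommutant a" "v \<in> carrier R" and eq: "(a \<oplus> c) \<otimes> v = \<zero>" using E by auto
    have ec0: "e \<otimes> c = \<zero>"
    proof -
      have "e \<otimes> c \<oplus> e = \<zero> \<oplus> e" using ec cc r_distr[of c e e] ce e by simp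
      then show ?thesis using ec cc add.r_cancel by simp
    qed
    have ev: "e \<otimes> v = \<zero>"
    proof -
      have "\<zero> = e \<otimes> ((a \<oplus> c) \<otimes> v)" using eq ec by simp
      also have "\<dots> = e \<otimes> a \<otimes> v" using ec cc a v ec0 by (simp add: l_distr r_distr flip: m_assoc)
      finally have "e \<otimes> a \<otimes> v = \<zero>" by simp
      moreover have "e \<otimes> a = a \<otimes> e" using E.m_comm[of e a] e aE by simp
      ultimately have aev: "a \<otimes> (e \<otimes> v) = \<zero>" using ec a v by (simp add: m_assoc)
      obtain l where l: "m = Suc l" using m(1) by (cases m) auto
      define al where "al = a [^]\<^bsub>?R\<^esub> l"
      have al: "al \<in> carrier R" using E.nat_pow_closed[of a l] aE E by (auto simp: al_def)
      have "e = al \<otimes> a" using E.nat_pow_Suc[of a l] by (simp add: e_def l al_def)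
      then have "e \<otimes> (e \<otimes> v) = al \<otimes> (a \<otimes> (e \<otimes> v))" using al a ec v by (simp add: m_assoc)
      then show ?thesis using aev al ec v e by (simp flip: m_assoc)
    qed
    have "c \<otimes> v = v"
    proof -
      have "c \<otimes> v \<oplus> e \<otimes> v = v" using cc ec v by (simp add: l_distr[symmetric] ce)
      then show ?thesis using ev cc v by simp
    qed
    then have av: "a \<otimes> v \<oplus> v = \<zero>" using eq a cc v by (simp add: l_distr)
    \<comment> \<open>From \<open>a v = - v\<close>, powers of \<open>a\<close> only change the sign
      of \<open>v\<close>, whereas \<open>a^m = e\<close> kills it.\<close>
    have pow: "a [^]\<^bsub>?R\<^esub> j \<otimes> v = v \<or> a [^]\<^bsub>?R\<^esub> j \<otimes> v = \<ominus> v" for j :: nat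
    proof (induction j)
      case 0
      then show ?case using v by simp
    next
      case (Suc j)
      have aj: "a [^]\<^bsub>?R\<^esub> j \<in> carrier R" using E.nat_pow_closed[of a j] aE E by auto
      have "a [^]\<^bsub>?R\<^esub> Suc j \<otimes> v = a [^]\<^bsub>?R\<^esub> j \<otimes> (a \<otimes> v)"
        using E.nat_pow_Suc[of a j] aj a v by (simp add: m_assoc)
      also have "a \<otimes> v = \<ominus> v" using minus_equality[OF av] v a by simp
      finally have "a [^]\<^bsub>?R\<^esub> Suc j \<otimes> v = \<ominus> (a [^]\<^bsub>?R\<^esub> j \<otimes> v)" using aj v by (simp add: r_minus)
      then show ?case using Suc v by auto
    qed
    from pow[of m] have "v = \<zero> \<or> \<ominus> v = \<zero>" using ev by (auto simp: e_def)
    then show "v = \<zero>\<^bsub>?R\<^esub>" using v by (auto simp: add.inv_eq_1_iff)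
  qed
  then have "(a \<oplus> c) \<otimes> t = t \<otimes> (a \<oplus> c)" by (rule commute_t)
  then have "a \<otimes> t \<oplus> c \<otimes> t = t \<otimes> a \<oplus> t \<otimes> c" using a cc t by (simp add: l_distr r_distr)
  then show ?thesis unfolding ct using a cc t by simp
qed

end

text \<open>A ring with an anti-automorphic involution. Arguments about one self-adjoint (or skew) element
  take place in its double commutant, which is commutative and stable under the involution.\<close>

locale star_ring = ring R for R (structure) +
  fixes star :: "'a \<Rightarrow> 'a" and eps :: 'a
  assumes fin: "finite (carrier R)"
    and star_closed [simp]: "x \<in> carrier R \<Longrightarrow> star x \<in> carrier R"
    and star_star [simp]: "x \<in> carrier R \<Longrightarrow> star (star x) = x"
    and star_add: "x \<in> carrier R \<Longrightarrow> y \<in> carrier R \<Longrightarrow> star (x \<oplus> y) = star x \<oplus> star y"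
    and star_mult: "x \<in> carrier R \<Longrightarrow> y \<in> carrier R \<Longrightarrow> star (x \<otimes> y) = star y \<otimes> star x"
    and eps: "eps \<in> Units R" "star eps = \<ominus> eps"
    and eps_central: "x \<in> carrier R \<Longrightarrow> eps \<otimes> x = x \<otimes> eps"
    and two: "\<one> \<oplus> \<one> \<in> Units R"
    and eps4: "(\<one> \<oplus> \<one>) \<otimes> (\<one> \<oplus> \<one>) \<ominus> eps \<otimes> eps \<in> Units R"
begin

lemma eps_closed [simp]: "eps \<in> carrier R" using eps(1) by (rule Units_closed)

lemma star_zero [simp]: "star \<zero> = \<zero>"
proof -
  have "star \<zero> \<oplus> star \<zero> = star \<zero> \<oplus> \<zero>" using star_add[of \<zero> \<zero>] by simp
  then show ?thesis using add.l_cancel star_closed zero_closed by blast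
qed

lemma star_one [simp]: "star \<one> = \<one>"
proof -
  have "star (star \<one> \<otimes> \<one>) = star \<one> \<otimes> star (star \<one>)" by (rule star_mult) auto
  then show ?thesis by simp
qed

lemma star_uminus:
  assumes x: "x \<in> carrier R" shows "star (\<ominus> x) = \<ominus> star x"
proof -
  have "star (\<ominus> x) \<oplus> star x = \<zero>" using star_add[of "\<ominus> x" x] x by (simp add: l_neg)
  then show ?thesis using minus_equality[of "star (\<ominus> x)" "star x"] x by simp
qed

text \<open>If \<open>a\<close> commutes with \<open>x\<close>, then \<open>star a\<close> commutes
  with \<open>star x\<close>, that is with \<open>x\<close> up to sign; so the commutant is stable
  under the involution and the double commutant inherits this. By commutativity the order reversal
  in \<open>star_mult\<close> disappears there.\<close>

lemma bicommutant_inv_cring: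
  assumes x: "x \<in> carrier R" and sx: "star x = x \<or> star x = \<ominus> x"
  shows "inv_cring (R\<lparr>carrier := bicommutant x\<rparr>) star eps"
proof -
  let ?E = "bicommutant x" and ?R = "R\<lparr>carrier := bicommutant x\<rparr>"
  note sub = bicommutant_subcring[OF x]
  have E: "?E \<subseteq> carrier R" by (rule subcringE(1)[OF sub])
  interpret E: cring ?R using subcring_iff[OF E] sub by blast
  have uminus: "\<ominus>\<^bsub>?R\<^esub> y = \<ominus> y" if "y \<in> ?E" for y
  proof -
    have "\<ominus> y \<in> ?E" using subcringE(5)[OF sub that] .
    then show ?thesis using E.minus_equality[of "\<ominus> y" y] that E by (auto simp: l_neg)
  qed
  have central: "c \<in> ?E" if "c \<in> carrier R" "\<And>a. a \<in> carrier R \<Longrightarrow> a \<otimes> c = c \<otimes> a" for c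
    using that by (auto simp: bicommutant_def)
  have epsE: "eps \<in> ?E" using eps_central by (intro central) auto
  have oneE: "\<one> \<in> ?E" using subcringE(3)[OF sub] .
  have twoE: "\<one> \<oplus> \<one> \<in> ?E" using E.a_closed[of \<one> \<one>] oneE by simp
  have star_commute: "star a \<otimes> x = x \<otimes> star a" if a: "a \<in> carrier R" "a \<otimes> x = x \<otimes> a" for a
  proof -
    have "star x \<otimes> star a = star a \<otimes> star x" using a x by (simp flip: star_mult)
    then show ?thesis using sx a x by (auto simp: l_minus r_minus)
      (metis add.inv_inv m_closed star_closed)
  qed
  show ?thesis
  proof unfold_locales
    show "finite (carrier ?R)" using fin E by (simp add: finite_subset)
    show "star y \<in> carrier ?R" if "y \<in> carrier ?R" for y
    proof -
      have y: "y \<in> ?E" "y \<in> carrier R" using that E by auto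
      have "a \<otimes> star y = star y \<otimes> a" if a: "a \<in> carrier R" "a \<otimes> x = x \<otimes> a" for a
      proof -
        have "star (star a \<otimes> y) = star (y \<otimes> star a)"
          using bicommutantD[OF y(1) _ star_commute[OF a]] a by simp
        then show ?thesis using a y by (simp add: star_mult)
      qed
      then show ?thesis using y by (simp add: bicommutant_def)
    qed
    show "star (star y) = y" if "y \<in> carrier ?R" for y using that E by auto
    show "star (y \<oplus>\<^bsub>?R\<^esub> z) = star y \<oplus>\<^bsub>?R\<^esub> star z" if "y \<in> carrier ?R" "z \<in> carrier ?R" for y z
      using that E star_add[of y z] by auto
    show "star (y \<otimes>\<^bsub>?R\<^esub> z) = star y \<otimes>\<^bsub>?R\<^esub> star z" if "y \<in> carrier ?R" "z \<in> carrier ?R" for y z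
      using E.m_comm[OF that] that E star_mult[of z y] by auto
    show "eps \<in> Units ?R" using Units_bicommutant[OF eps(1) epsE] .
    show "star eps = \<ominus>\<^bsub>?R\<^esub> eps" using uminus[OF epsE] eps by simp
    show "\<one>\<^bsub>?R\<^esub> \<oplus>\<^bsub>?R\<^esub> \<one>\<^bsub>?R\<^esub> \<in> Units ?R" using Units_bicommutant[OF two twoE] by simp
    have ee: "eps \<otimes> eps \<in> ?E" using E.m_closed[of eps eps] epsE by simp
    have tt: "(\<one> \<oplus> \<one>) \<otimes> (\<one> \<oplus> \<one>) \<in> ?E" using E.m_closed[of "\<one> \<oplus> \<one>" "\<one> \<oplus> \<one>"] twoE by simp
    have *: "(\<one> \<oplus> \<one>) \<otimes> (\<one> \<oplus> \<one>) \<ominus> eps \<otimes> eps \<in> ?E"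
      unfolding a_minus_def using E.a_closed[of _ "\<ominus>\<^bsub>?R\<^esub> (eps \<otimes> eps)"] E.a_inv_closed[of "eps \<otimes> eps"] tt ee uminus[OF ee] by simp
    show "(\<one>\<^bsub>?R\<^esub> \<oplus>\<^bsub>?R\<^esub> \<one>\<^bsub>?R\<^esub>) \<otimes>\<^bsub>?R\<^esub> (\<one>\<^bsub>?R\<^esub> \<oplus>\<^bsub>?R\<^esub> \<one>\<^bsub>?R\<^esub>) \<ominus>\<^bsub>?R\<^esub> eps \<otimes>\<^bsub>?R\<^esub> eps \<in> Units ?R"
      using Units_bicommutant[OF eps4 *] uminus[OF ee] by (simp add: a_minus_def)
  qed
qed

text \<open>The norm equation is solved inside the commutative ring attached to \<open>h\<close>.
  Membership of \<open>y\<close> in that ring is recorded because it passes commutation on from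
  \<open>h\<close> to \<open>y\<close>.\<close>

lemma hermitian_unit_is_norm:
  assumes h: "h \<in> Units R" "star h = h"
  shows "\<exists>y\<in>Units R. star y \<otimes> y = h \<and> y \<in> bicommutant h"
proof -
  have hc: "h \<in> carrier R" using h(1) by (rule Units_closed)
  let ?R = "R\<lparr>carrier := bicommutant h\<rparr>"
  interpret E: inv_cring ?R star eps using bicommutant_inv_cring[OF hc] h by blast
  have "h \<in> Units ?R" using Units_bicommutant[OF h(1)] bicommutant_self[OF hc] by blast
  then obtain y where y: "y \<in> Units ?R" "y \<otimes> star y = h"
    using E.fixed_unit_is_norm[of h] h by auto
  have yE: "y \<in> bicommutant h" using E.Units_closed[OF y(1)] by simp
  have "star y \<otimes> y = h" using E.m_comm[of "star y" y] E.star_closed[of y] yE y(2) by simp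
  moreover have "y \<in> Units R"
    using y(1) bicommutant_carrier by (auto simp: Units_def)
  ultimately show ?thesis using yE by blast
qed

text \<open>A polar decomposition \<open>x = z y\<close>. Since \<open>s\<close> and
  \<open>t\<close> are unitary, \<open>h = star x * x\<close> commutes with \<open>s\<close>; a
  solution \<open>y\<close> of \<open>star y * y = h\<close> taken from the double commutant of
  \<open>h\<close> then commutes with \<open>s\<close> too, so \<open>z\<close> still intertwines
  \<open>s\<close> and \<open>t\<close>, and it is unitary.\<close>

lemma unitary_conjugacy:
  assumes s: "s \<in> carrier R" "star s \<otimes> s = \<one>" "s \<otimes> star s = \<one>"
    and t: "t \<in> carrier R" "star t \<otimes> t = \<one>" "t \<otimes> star t = \<one>"
    and x: "x \<in> Units R" "x \<otimes> s = t \<otimes> x"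
  shows "\<exists>z\<in>Units R. star z \<otimes> z = \<one> \<and> z \<otimes> s = t \<otimes> z"
proof -
  have xc: "x \<in> carrier R" using x(1) by (rule Units_closed)
  define h where "h = star x \<otimes> x"
  obtain x' where x': "x' \<in> carrier R" "x \<otimes> x' = \<one>" "x' \<otimes> x = \<one>" using x(1) by (auto simp: Units_def)
  have sx': "star x \<otimes> star x' = \<one>" "star x' \<otimes> star x = \<one>"
    using x' xc by (simp_all flip: star_mult)
  then have "star x \<in> Units R" using xc x' unfolding Units_def by auto
  then have h: "h \<in> Units R" "star h = h" using x(1) xc by (auto simp: h_def star_mult)
  have hc: "h \<in> carrier R" using h(1) by (rule Units_closed)
  have st: "star s \<otimes> star x = star x \<otimes> star t"
    using x s(1) t(1) xc by (simp flip: star_mult)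
  have "s \<otimes> h = s \<otimes> (star x \<otimes> star t) \<otimes> (t \<otimes> x)"
    using s(1) t xc by (simp add: h_def m_assoc) (simp add: t flip: m_assoc)
  also have "\<dots> = (s \<otimes> star s) \<otimes> star x \<otimes> (x \<otimes> s)"
    unfolding st[symmetric] x(2) using s(1) t(1) xc by (simp add: m_assoc)
  also have "\<dots> = h \<otimes> s" using s xc by (simp add: h_def m_assoc)
  finally have sh: "s \<otimes> h = h \<otimes> s" .
  obtain y where y: "y \<in> Units R" "star y \<otimes> y = h" "y \<in> bicommutant h"
    using hermitian_unit_is_norm[OF h] by blast
  have ys: "y \<otimes> s = s \<otimes> y" using bicommutantD[OF y(3) s(1) sh] by simp
  have yc: "y \<in> carrier R" using y(1) by (rule Units_closed)
  define z where "z = x \<otimes> inv y"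
  have z: "z \<in> Units R" using x(1) y(1) by (simp add: z_def)
  have iy: "inv y \<in> carrier R" using y(1) by simp
  have siy: "star (inv y) \<otimes> star y = \<one>" using y(1) yc iy by (simp flip: star_mult)
  have "star z \<otimes> z = star (inv y) \<otimes> h \<otimes> inv y"
    using iy xc by (simp add: z_def star_mult h_def m_assoc)
  also have "\<dots> = (star (inv y) \<otimes> star y) \<otimes> (y \<otimes> inv y)"
    unfolding y(2)[symmetric] using yc iy by (simp add: m_assoc)
  also have "\<dots> = \<one>" using siy y(1) by simp
  finally have "star z \<otimes> z = \<one>" .
  moreover have "z \<otimes> s = t \<otimes> z"
  proof -
    have "y \<otimes> (s \<otimes> inv y) = s \<otimes> (y \<otimes> inv y)"
      using yc iy s(1) ys by (simp del: Units_r_inv flip: m_assoc)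
    also have "\<dots> = (y \<otimes> inv y) \<otimes> s" using y(1) s(1) by simp
    also have "\<dots> = y \<otimes> (inv y \<otimes> s)" using yc iy s(1) by (simp add: m_assoc del: Units_r_inv)
    finally have "s \<otimes> inv y = inv y \<otimes> s" using y(1) yc iy s(1) by simp
    then have "z \<otimes> s = (x \<otimes> s) \<otimes> inv y" using xc iy s(1) by (simp add: z_def m_assoc)
    then show ?thesis using xc iy t(1) x(2) by (simp add: z_def m_assoc)
  qed
  ultimately show ?thesis using z by blast
qed

text \<open>The decomposition \<open>A = C - eps (1 - e)\<close> expresses \<open>A\<close> through
  two unitary elements of its double commutant: the Cayley transform of \<open>C\<close> and the
  reflection \<open>1 - 2e\<close>. Both commute with \<open>s\<close>, hence with
  \<open>t\<close>.\<close>

lemma commutes_skew_if_commutes_unitary: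
  assumes s: "s \<in> carrier R" and t: "t \<in> carrier R"
    and H: "\<And>g. g \<in> carrier R \<Longrightarrow> g \<otimes> star g = \<one> \<Longrightarrow> star g \<otimes> g = \<one> \<Longrightarrow> g \<otimes> s = s \<otimes> g \<Longrightarrow> g \<otimes> t = t \<otimes> g"
    and A: "A \<in> carrier R" "star A = \<ominus> A" "A \<otimes> s = s \<otimes> A"
  shows "A \<otimes> t = t \<otimes> A"
proof -
  let ?R = "R\<lparr>carrier := bicommutant A\<rparr>"
  note sub = bicommutant_subcring[OF A(1)]
  have E: "bicommutant A \<subseteq> carrier R" by (rule subcringE(1)[OF sub])
  interpret E: inv_cring ?R star eps using bicommutant_inv_cring[OF A(1)] A by blast
  have uminus: "\<ominus>\<^bsub>?R\<^esub> y = \<ominus> y" if "y \<in> bicommutant A" for y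
  proof -
    have "\<ominus> y \<in> bicommutant A" using subcringE(5)[OF sub that] .
    then show ?thesis using E.minus_equality[of "\<ominus> y" y] that E by (auto simp: l_neg)
  qed
  have minus: "y \<ominus>\<^bsub>?R\<^esub> z = y \<ominus> z" if "z \<in> bicommutant A" for y z
    using uminus[OF that] by (simp add: a_minus_def)
  have AE: "A \<in> bicommutant A" by (rule bicommutant_self[OF A(1)])
  obtain e C where e: "e \<in> bicommutant A" "e \<otimes> e = e" "star e = e"
    and C: "C \<in> bicommutant A" "star C = \<ominus> C" "\<one> \<oplus> C \<in> Units ?R"
    and A_eq: "A = C \<ominus> eps \<otimes> (\<one> \<ominus> e)"
  proof -
    obtain e C where e: "e \<in> bicommutant A" "e \<otimes> e = e" "star e = e"
      and C: "C \<in> bicommutant A" "star C = \<ominus>\<^bsub>?R\<^esub> C" "\<one> \<oplus> C \<in> Units ?R"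
      and A_eq: "A = C \<ominus>\<^bsub>?R\<^esub> eps \<otimes> (\<one> \<ominus>\<^bsub>?R\<^esub> e)"
      using E.skew_cayley_decomposition[of A] AE A uminus[OF AE] by auto
    have "eps \<otimes> (\<one> \<ominus> e) \<in> bicommutant A"
      using E.m_closed[OF E.eps_closed E.minus_closed[OF E.one_closed, of e]] e(1) minus[OF e(1), of \<one>] by simp
    then show ?thesis using that[OF e C(1) _ C(3)] C A_eq uminus minus e by simp
  qed
  have ec: "e \<in> carrier R" and Cc: "C \<in> carrier R" using e C E by auto
  have commute_s: "y \<otimes> s = s \<otimes> y" if "y \<in> bicommutant A" for y
    using bicommutantD[OF that s] A by simp
  have one_plus: "\<one> \<oplus> C \<in> carrier R" using Cc by simp
  obtain D where D: "D \<in> bicommutant A" "(\<one> \<oplus> C) \<otimes> D = \<one>" "D \<otimes> (\<one> \<oplus> C) = \<one>"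
    using C(3) by (auto simp: Units_def)
  have Dc: "D \<in> carrier R" using D E by auto
  define g where "g = (\<one> \<ominus> C) \<otimes> D"
  have sC: "star (\<one> \<oplus> C) = \<one> \<ominus> C" using Cc C by (simp add: star_add a_minus_def)
  have sC': "star (\<one> \<ominus> C) = \<one> \<oplus> C" using sC one_plus by (metis star_star)
  have mC: "\<one> \<ominus> C \<in> bicommutant A"
    using E.minus_closed[OF E.one_closed, of C] C(1) minus[OF C(1), of \<one>] by simp
  have gE: "g \<in> bicommutant A" using E.m_closed mC D by (simp add: g_def)
  have sD: "star D \<otimes> (\<one> \<ominus> C) = \<one>"
    using D(2) Dc one_plus by (metis sC star_mult star_one)
  have sg: "star g = star D \<otimes> (\<one> \<oplus> C)" using Cc Dc by (simp add: g_def star_mult sC')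
  have sgE: "star g \<in> bicommutant A" using E.star_closed gE by simp
  have "star g \<otimes> g = star D \<otimes> ((\<one> \<oplus> C) \<otimes> (\<one> \<ominus> C)) \<otimes> D"
    unfolding sg using Cc Dc by (simp add: g_def m_assoc)
  also have "(\<one> \<oplus> C) \<otimes> (\<one> \<ominus> C) = (\<one> \<ominus> C) \<otimes> (\<one> \<oplus> C)"
    using E.m_comm[of "\<one> \<oplus> C" "\<one> \<ominus> C"] mC E.a_closed[OF E.one_closed, of C] C(1) by simp
  also have "star D \<otimes> ((\<one> \<ominus> C) \<otimes> (\<one> \<oplus> C)) \<otimes> D = (star D \<otimes> (\<one> \<ominus> C)) \<otimes> ((\<one> \<oplus> C) \<otimes> D)"
    using Cc Dc by (simp add: m_assoc)
  also have "\<dots> = \<one>" by (simp add: sD D)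
  finally have gg: "star g \<otimes> g = \<one>" .
  have gg': "g \<otimes> star g = \<one>" using E.m_comm[of g "star g"] gE sgE gg by simp
  have gc: "g \<in> carrier R" using gE E by auto
  have gt: "g \<otimes> t = t \<otimes> g" using H[OF gc gg' gg commute_s[OF gE]] .
  have two_central: "(\<one> \<oplus> \<one>) \<otimes> a = a \<otimes> (\<one> \<oplus> \<one>)" if "a \<in> carrier R" for a
    using that by (simp add: l_distr r_distr)
  have two_closed: "\<one> \<oplus> \<one> \<in> carrier R" by simp
  \<comment> \<open>The Cayley transform is undone: \<open>D = (g + 1) / 2\<close> is the inverse of
    \<open>1 + C\<close>, so commutation with \<open>t\<close> passes from \<open>g\<close> to
    \<open>D\<close> and from there to \<open>C\<close>.\<close>
  have "(\<one> \<oplus> \<one>) \<otimes> D = g \<oplus> \<one>"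
  proof -
    have "g \<oplus> \<one> = (\<one> \<ominus> C) \<otimes> D \<oplus> (\<one> \<oplus> C) \<otimes> D" by (simp add: g_def D)
    also have "\<dots> = (\<one> \<oplus> \<one>) \<otimes> D" using Cc Dc by algebra
    finally show ?thesis by simp
  qed
  then have "((\<one> \<oplus> \<one>) \<otimes> D) \<otimes> t = t \<otimes> ((\<one> \<oplus> \<one>) \<otimes> D)"
    using gt gc t by (simp add: l_distr r_distr)
  then have Dt: "D \<otimes> t = t \<otimes> D" using commute_unit_cancel[OF two Dc t two_central[OF t]] by simp
  have "D \<in> Units R" using Dc one_plus D unfolding Units_def by auto
  moreover have "(D \<otimes> (\<one> \<oplus> C)) \<otimes> t = t \<otimes> (D \<otimes> (\<one> \<oplus> C))" using t D by simp
  ultimately have "(\<one> \<oplus> C) \<otimes> t = t \<otimes> (\<one> \<oplus> C)"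
    using commute_unit_cancel[OF _ one_plus t Dt] by simp
  then have Ct: "C \<otimes> t = t \<otimes> C" using Cc t by (simp add: l_distr r_distr)
  define k where "k = \<one> \<ominus> (\<one> \<oplus> \<one>) \<otimes> e"
  have kc: "k \<in> carrier R" using ec by (simp add: k_def)
  have kE: "k \<in> bicommutant A"
  proof -
    have te: "(\<one> \<oplus> \<one>) \<otimes> e \<in> bicommutant A" using E.m_closed[OF E.a_closed[OF E.one_closed E.one_closed]] e by simp
    then show ?thesis using E.minus_closed[OF E.one_closed, of "(\<one> \<oplus> \<one>) \<otimes> e"] minus[OF te, of \<one>] te by (simp add: k_def)
  qed
  have sk: "star k = k"
    using ec e two_central[OF ec] by (simp add: k_def a_minus_def star_add star_uminus star_mult)
  have kk: "k \<otimes> k = \<one>"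
  proof -
    define d where "d = (\<one> \<oplus> \<one>) \<otimes> e"
    have d: "d \<in> carrier R" using ec by (simp add: d_def)
    have "d \<otimes> d = d \<oplus> d" using ec e by (simp add: d_def l_distr r_distr)
    moreover have "k \<otimes> k = \<one> \<ominus> (d \<oplus> d) \<oplus> d \<otimes> d"
      using d by (simp add: k_def d_def[symmetric] a_minus_def l_distr r_distr l_minus r_minus minus_add a_ac)
    ultimately show ?thesis using d by (simp add: a_minus_def minus_add a_ac r_neg r_neg2 r_neg1)
  qed
  have kt: "k \<otimes> t = t \<otimes> k" using H[OF kc _ _ commute_s[OF kE]] sk kk by simp
  have "((\<one> \<oplus> \<one>) \<otimes> e) \<otimes> t = t \<otimes> ((\<one> \<oplus> \<one>) \<otimes> e)"
  proof -
    have "((\<one> \<oplus> \<one>) \<otimes> e) \<otimes> t = t \<ominus> k \<otimes> t" unfolding k_def using ec t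
      by (simp add: a_minus_def l_distr l_minus minus_add r_neg2 a_assoc[symmetric] r_neg)
    moreover have "t \<otimes> ((\<one> \<oplus> \<one>) \<otimes> e) = t \<ominus> t \<otimes> k" unfolding k_def using ec t
      by (simp add: a_minus_def l_distr r_distr r_minus minus_add r_neg2 a_assoc[symmetric] r_neg)
    ultimately show ?thesis using kt by simp
  qed
  then have et: "e \<otimes> t = t \<otimes> e" using commute_unit_cancel[OF two ec t two_central[OF t]] by simp
  have "A \<otimes> t = C \<otimes> t \<ominus> eps \<otimes> t \<oplus> eps \<otimes> (e \<otimes> t)"
    by (subst A_eq) (use Cc ec t eps_closed in algebra)
  also have "\<dots> = t \<otimes> C \<ominus> t \<otimes> eps \<oplus> (t \<otimes> eps) \<otimes> e"
    unfolding Ct et using ec t by (simp add: eps_central[OF t, symmetric] m_assoc)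
  also have "\<dots> = t \<otimes> A"
    by (subst A_eq) (use Cc ec t eps_closed in \<open>simp add: a_minus_def r_distr r_minus minus_add m_assoc a_assoc\<close>)
  finally show ?thesis .
qed

text \<open>Twice \<open>a\<close> is the sum of the skew element \<open>a - star a\<close> and of
  \<open>a + star a\<close>, which the central unit \<open>eps\<close> makes skew. The assumption
  \<open>star_s\<close> keeps both summands in the commutant of \<open>s\<close>.\<close>

lemma commutes_if_commutes_unitary:
  assumes s: "s \<in> carrier R" and t: "t \<in> carrier R"
    and star_s: "\<And>a. a \<in> carrier R \<Longrightarrow> a \<otimes> s = s \<otimes> a \<Longrightarrow> star a \<otimes> s = s \<otimes> star a"
    and H: "\<And>g. g \<in> carrier R \<Longrightarrow> g \<otimes> star g = \<one> \<Longrightarrow> star g \<otimes> g = \<one> \<Longrightarrow> g \<otimes> s = s \<otimes> g \<Longrightarrow> g \<otimes> t = t \<otimes> g"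
    and a: "a \<in> carrier R" "a \<otimes> s = s \<otimes> a"
  shows "a \<otimes> t = t \<otimes> a"
proof -
  note skew = commutes_skew_if_commutes_unitary[OF s t H]
  have sa: "star a \<otimes> s = s \<otimes> star a" using star_s[OF a] .
  have 1: "(a \<ominus> star a) \<otimes> t = t \<otimes> (a \<ominus> star a)"
  proof (rule skew)
    show "star (a \<ominus> star a) = \<ominus> (a \<ominus> star a)"
      using a by (simp add: a_minus_def star_add star_uminus minus_add a_comm)
    show "(a \<ominus> star a) \<otimes> s = s \<otimes> (a \<ominus> star a)"
      using a sa s by (simp add: a_minus_def l_distr r_distr l_minus r_minus)
  qed (use a in auto)
  have eps_s: "eps \<otimes> s = s \<otimes> eps" using eps_central[OF s] .
  have "(eps \<otimes> (a \<oplus> star a)) \<otimes> t = t \<otimes> (eps \<otimes> (a \<oplus> star a))"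
  proof (rule skew)
    show "star (eps \<otimes> (a \<oplus> star a)) = \<ominus> (eps \<otimes> (a \<oplus> star a))"
      using a eps_central[of "a \<oplus> star a"] by (simp add: star_add star_mult eps l_minus r_minus a_comm)
    have "eps \<otimes> (a \<oplus> star a) \<otimes> s = eps \<otimes> s \<otimes> (a \<oplus> star a)"
      using a sa s by (simp add: m_assoc l_distr r_distr)
    also have "\<dots> = s \<otimes> (eps \<otimes> (a \<oplus> star a))" unfolding eps_s using a s by (simp add: m_assoc)
    finally show "(eps \<otimes> (a \<oplus> star a)) \<otimes> s = s \<otimes> (eps \<otimes> (a \<oplus> star a))" .
  qed (use a in auto)
  then have 2: "(a \<oplus> star a) \<otimes> t = t \<otimes> (a \<oplus> star a)"
    using commute_unit_cancel[OF eps(1) _ t eps_central[OF t]] a by simp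
  have eq: "(\<one> \<oplus> \<one>) \<otimes> a = (a \<ominus> star a) \<oplus> (a \<oplus> star a)"
    using a(1) star_closed[OF a(1)] by algebra
  have "((\<one> \<oplus> \<one>) \<otimes> a) \<otimes> t = t \<otimes> ((\<one> \<oplus> \<one>) \<otimes> a)"
    unfolding eq l_distr[OF minus_closed[OF a(1) star_closed[OF a(1)]] a_closed[OF a(1) star_closed[OF a(1)]] t]
      r_distr[OF minus_closed[OF a(1) star_closed[OF a(1)]] a_closed[OF a(1) star_closed[OF a(1)]] t] 1 2 ..
  then show ?thesis
    using commute_unit_cancel[OF two a(1) t] t by (simp add: l_distr r_distr)
qed

end

section \<open>Invertible matrices and hermitian forms\<close>

abbreviation GL :: "nat \<Rightarrow> 'a :: field mat set" where
  "GL n \<equiv> Units (ring_mat TYPE('a) n ())"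

lemma square_mult_closed [simp]:
  "A \<in> carrier_mat n n \<Longrightarrow> B \<in> carrier_mat n n \<Longrightarrow> A * B \<in> carrier_mat n n"
  by (rule mult_carrier_mat)

lemma square_mult_assoc:
  "A \<in> carrier_mat n n \<Longrightarrow> B \<in> carrier_mat n n \<Longrightarrow> C \<in> carrier_mat n n \<Longrightarrow> A * B * C = A * (B * C)"
  by (rule assoc_mult_mat)

lemma square_transpose_mult:
  fixes A :: "'a :: comm_semiring_0 mat"
  shows "A \<in> carrier_mat n n \<Longrightarrow> B \<in> carrier_mat n n \<Longrightarrow> (A * B)\<^sup>T = B\<^sup>T * A\<^sup>T"
  by (rule transpose_mult)

lemma square_mult_one [simp]:
  "A \<in> carrier_mat n n \<Longrightarrow> 1\<^sub>m n * A = (A :: 'a :: semiring_1 mat)"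
  "A \<in> carrier_mat n n \<Longrightarrow> A * 1\<^sub>m n = A"
  by auto

lemma smult_one_mult: "A \<in> carrier_mat n n \<Longrightarrow> (c \<cdot>\<^sub>m 1\<^sub>m n) * A = c \<cdot>\<^sub>m (A :: 'a :: comm_ring_1 mat)"
  using mult_smult_assoc_mat[of "1\<^sub>m n" n n A n c] by simp

lemma smult_one_commute: "A \<in> carrier_mat n n \<Longrightarrow> (c \<cdot>\<^sub>m 1\<^sub>m n) * A = (A :: 'a :: comm_ring_1 mat) * (c \<cdot>\<^sub>m 1\<^sub>m n)"
  using mult_smult_distrib[of A n n "1\<^sub>m n" n c] by (simp add: smult_one_mult)

lemma square_inv_cancel:
  fixes A :: "'a :: semiring_1 mat"
  assumes "A \<in> carrier_mat n n" "B \<in> carrier_mat n n" "C \<in> carrier_mat n n" "A * B = 1\<^sub>m n"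
  shows "A * (B * C) = C"
  using assms by (simp flip: square_mult_assoc[where n = n])

lemma GL_iff: "A \<in> GL n \<longleftrightarrow> A \<in> carrier_mat n n \<and> (\<exists>B\<in>carrier_mat n n. A * B = 1\<^sub>m n \<and> B * A = 1\<^sub>m n)"
  by (auto simp: Units_def ring_mat_simps)

lemma GL_carrier: "A \<in> GL n \<Longrightarrow> A \<in> carrier_mat n n"
  by (simp add: GL_iff)

lemma GL_I: "A \<in> carrier_mat n n \<Longrightarrow> B \<in> carrier_mat n n \<Longrightarrow> A * B = 1\<^sub>m n \<Longrightarrow> A \<in> GL n"
  using mat_mult_left_right_inverse[of A n B] by (auto simp: GL_iff)

lemma GL_E:
  assumes "A \<in> GL n"
  obtains B where "A \<in> carrier_mat n n" "B \<in> carrier_mat n n" "A * B = 1\<^sub>m n" "B * A = 1\<^sub>m n" "B \<in> GL n"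
  using assms by (auto simp: GL_iff)

lemma GL_iff_det: "A \<in> GL n \<longleftrightarrow> A \<in> carrier_mat n n \<and> det A \<noteq> 0"
  using unit_imp_det_non_zero[of A n "()"] det_non_zero_imp_unit[of A n "()"] GL_carrier by blast

lemma GL_mult: "A \<in> GL n \<Longrightarrow> B \<in> GL n \<Longrightarrow> A * B \<in> GL n"
  by (auto simp: GL_iff_det det_mult[of A n B])

lemma GL_transpose: "A \<in> GL n \<Longrightarrow> A\<^sup>T \<in> GL n"
  by (auto simp: GL_iff_det det_transpose[of A n])

lemma similar_mat_iff_GL:
  assumes "A \<in> carrier_mat n n" "B \<in> carrier_mat n n"
  shows "similar_mat A B \<longleftrightarrow> (\<exists>W\<in>GL n. W * B = A * W)"
proof
  assume "similar_mat A B"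
  then obtain P Q where "similar_mat_wit A B P Q" by (auto simp: similar_mat_def)
  note w = similar_mat_witD2[OF assms(1) this]
  have "P * B = P * B * (Q * P)" using w by simp
  also have "\<dots> = (P * B * Q) * P" using w by (simp add: square_mult_assoc[where n = n])
  finally show "\<exists>W\<in>GL n. W * B = A * W" using w GL_I[of P n Q] by metis
next
  assume "\<exists>W\<in>GL n. W * B = A * W"
  then obtain W Y where W: "W \<in> carrier_mat n n" "Y \<in> carrier_mat n n" "W * Y = 1\<^sub>m n" "Y * W = 1\<^sub>m n"
    and eq: "W * B = A * W" by (metis GL_E)
  have "A = A * (W * Y)" using W assms by simp
  also have "\<dots> = W * B * Y" unfolding eq using W assms by (simp add: square_mult_assoc[where n = n])
  finally show "similar_mat A B" using W assms by (intro similar_matI[of _ _ W Y n]) auto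
qed

lemma finite_carrier_mat: "finite (carrier_mat n m :: 'a :: finite mat set)"
proof -
  have "(carrier_mat n m :: 'a mat set) \<subseteq> (\<lambda>f. mat n m f) ` (({..<n} \<times> {..<m}) \<rightarrow>\<^sub>E UNIV)"
  proof
    fix A :: "'a mat" assume A: "A \<in> carrier_mat n m"
    let ?f = "restrict (\<lambda>ij. A $$ ij) ({..<n} \<times> {..<m})"
    have "A = mat n m ?f" using A by (intro eq_matI) auto
    then show "A \<in> (\<lambda>f. mat n m f) ` (({..<n} \<times> {..<m}) \<rightarrow>\<^sub>E UNIV)"
      by (intro image_eqI[of _ _ ?f]) auto
  qed
  then show ?thesis by (rule finite_subset) (intro finite_imageI finite_PiE, auto)
qed

section \<open>Characteristic and power maps of a finite field\<close>

lemma char_of_card_prime_power: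
  assumes "Factorial_Ring.prime p" "card (UNIV :: 'a :: {finite, field} set) = p ^ m"
  shows "CHAR('a) = p"
proof -
  have "CHAR('a) > 0" by (rule finite_imp_CHAR_pos) simp
  then have "Factorial_Ring.prime CHAR('a)" by (rule prime_CHAR_semidom)
  moreover have "CHAR('a) dvd p ^ m" 
  proof -
    have "(\<Sum>x\<in>UNIV. x + 1) = (\<Sum>x\<in>(UNIV :: 'a set). x)"
      by (rule sum.reindex_bij_witness[of _ "\<lambda>x. x - 1" "\<lambda>x. x + 1"]) auto
    then have "of_nat (card (UNIV :: 'a set)) = (0 :: 'a)" by (simp add: sum.distrib)
    then show ?thesis using assms(2) by (simp only: of_nat_eq_0_iff_char_dvd)
  qed
  ultimately show ?thesis using assms(1) prime_dvd_power primes_dvd_imp_eq by blast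
qed

lemma power_card_UNIV:
  fixes x :: "'a :: {finite, field}"
  shows "x ^ card (UNIV :: 'a set) = x"
proof (cases "x = 0")
  case True
  then show ?thesis by (simp add: card_gt_0_iff)
next
  case False
  have "bij_betw ((*) x) (UNIV - {0}) (UNIV - {0})"
    using False by (intro bij_betw_byWitness[of _ "\<lambda>y. y / x"]) auto
  then have "\<Prod>(UNIV - {0}) = (\<Prod>y\<in>UNIV - {0}. x * y)"
    by (rule prod.reindex_bij_betw[symmetric])
  also have "\<dots> = x ^ card (UNIV - {0 :: 'a}) * \<Prod>(UNIV - {0})" by (simp add: prod.distrib)
  finally have "x ^ (card (UNIV :: 'a set) - 1) = 1" by (simp add: card_Diff_singleton)
  then have "x * x ^ (card (UNIV :: 'a set) - 1) = x" by simp
  then show ?thesis by (metis power_minus_mult card_gt_0_iff finite UNIV_not_empty mult.commute)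
qed

text \<open>The field enters through three properties of the \<open>q\<close>-power map: it is
  additive, an involution, and not the identity. The unipotent count for the unitary group is
  carried out from these together with \<open>two\<close>, without fixing a cardinality.\<close>

locale hermitian_space =
  fixes n q :: nat and J :: "'b :: {finite, field} mat"
  assumes frob_add: "\<And>x y :: 'b. (x + y) ^ q = x ^ q + y ^ q"
    and frob2: "\<And>x :: 'b. (x ^ q) ^ q = x"
    and frob_nontriv: "\<exists>a :: 'b. a ^ q \<noteq> a"
    and two: "(2 :: 'b) \<noteq> 0"
    and J: "J \<in> GL n" and hermitian: "J\<^sup>T = bar_mat q J"
begin

lemma q_pos: "q > 0"
  using frob_nontriv frob2 frob_add[of 0 0] by (cases q) auto

sublocale frob: semiring_hom "\<lambda>x :: 'b. x ^ q"
  by unfold_locales (auto simp: frob_add power_mult_distrib q_pos)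

lemma bar_closed [simp]: "bar_mat q A \<in> carrier_mat r c \<longleftrightarrow> A \<in> carrier_mat r c"
  by (simp add: bar_mat_def)

lemma bar_mult: "A \<in> carrier_mat n n \<Longrightarrow> B \<in> carrier_mat n n \<Longrightarrow> bar_mat q (A * B :: 'b mat) = bar_mat q A * bar_mat q B"
  unfolding bar_mat_def by (rule frob.mat_hom_mult)

lemma bar_one: "bar_mat q (1\<^sub>m n :: 'b mat) = 1\<^sub>m n"
  unfolding bar_mat_def by (rule frob.mat_hom_one)

lemma bar_add: "A \<in> carrier_mat n n \<Longrightarrow> B \<in> carrier_mat n n \<Longrightarrow> bar_mat q (A + B :: 'b mat) = bar_mat q A + bar_mat q B"
  unfolding bar_mat_def by (intro eq_matI) (auto simp: frob_add)

lemma bar_bar: "bar_mat q (bar_mat q A) = (A :: 'b mat)"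
  unfolding bar_mat_def by (intro eq_matI) (auto simp: frob2)

lemma bar_transpose: "bar_mat q (A\<^sup>T) = (bar_mat q (A :: 'b mat))\<^sup>T"
  unfolding bar_mat_def by (simp add: map_mat_transpose)

lemma J_closed [simp]: "J \<in> carrier_mat n n" using J by (rule GL_carrier)

definition J' :: "'b mat" where "J' = (SOME B. B \<in> carrier_mat n n \<and> J * B = 1\<^sub>m n \<and> B * J = 1\<^sub>m n)"

lemma J': "J' \<in> carrier_mat n n" "J * J' = 1\<^sub>m n" "J' * J = 1\<^sub>m n"
proof -
  have "\<exists>B. B \<in> carrier_mat n n \<and> J * B = 1\<^sub>m n \<and> B * J = 1\<^sub>m n" using J by (auto simp: GL_iff)
  from someI_ex[OF this] show "J' \<in> carrier_mat n n" "J * J' = 1\<^sub>m n" "J' * J = 1\<^sub>m n"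
    by (auto simp: J'_def)
qed

lemma J_cancel:
  assumes "C \<in> carrier_mat n n"
  shows "J * (J' * C) = C" "J' * (J * C) = C"
  using assms J' square_inv_cancel[of J n J' C] square_inv_cancel[of J' n J C] by auto

lemma bar_J: "(bar_mat q J)\<^sup>T = J"
  using hermitian by (metis transpose_transpose)

lemma J'_hermitian: "(bar_mat q J')\<^sup>T = J'"
proof -
  have c: "(bar_mat q J')\<^sup>T \<in> carrier_mat n n" using J' by simp
  have "(bar_mat q J * bar_mat q J')\<^sup>T = 1\<^sub>m n"
    by (simp flip: bar_mult[OF J_closed J'(1), unfolded J'(2) bar_one])
  then have *: "(bar_mat q J')\<^sup>T * J = 1\<^sub>m n"
    using J' square_transpose_mult[of "bar_mat q J" n "bar_mat q J'"] by (simp add: bar_J)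
  have "(bar_mat q J')\<^sup>T = (bar_mat q J')\<^sup>T * (J * J')" using J' square_mult_one(2)[OF c] by simp
  also have "\<dots> = ((bar_mat q J')\<^sup>T * J) * J'" using square_mult_assoc[OF c J_closed J'(1)] by simp
  also have "\<dots> = J'" unfolding * using J' by simp
  finally show ?thesis .
qed

text \<open>The adjoint with respect to the form \<open>(x, y) \<mapsto> x\<^sup>T J y\<close> twisted by the involution in \<open>y\<close>.\<close>

definition dagger :: "'b mat \<Rightarrow> 'b mat" where "dagger W = (J * bar_mat q W * J')\<^sup>T"

lemma dagger_closed: "W \<in> carrier_mat n n \<Longrightarrow> dagger W \<in> carrier_mat n n"
  using J' by (simp add: dagger_def)

lemma dagger_add:
  "W \<in> carrier_mat n n \<Longrightarrow> Y \<in> carrier_mat n n \<Longrightarrow> dagger (W + Y) = dagger W + dagger Y"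
  unfolding dagger_def using J'
  by (simp add: bar_add mult_add_distrib_mat[of _ n n _ n] add_mult_distrib_mat[of _ n n _ _ n]
      transpose_add[of _ n n])

lemma dagger_mult:
  assumes W: "W \<in> carrier_mat n n" and Y: "Y \<in> carrier_mat n n"
  shows "dagger (W * Y) = dagger Y * dagger W"
proof -
  have "(J * bar_mat q W * J') * (J * bar_mat q Y * J') = J * bar_mat q W * (J' * J) * bar_mat q Y * J'"
    using J' W Y by (simp add: square_mult_assoc[where n = n] J_cancel)
  also have "\<dots> = J * bar_mat q (W * Y) * J'"
    using J' W Y by (simp add: bar_mult square_mult_assoc[where n = n])
  finally show ?thesis using J' W Y by (simp add: dagger_def flip: square_transpose_mult[where n = n])
qed

lemma bar_dagger:
  assumes W: "W \<in> carrier_mat n n"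
  shows "bar_mat q (dagger W) = J' * W\<^sup>T * J"
proof -
  have "bar_mat q (dagger W) = (bar_mat q J * W * bar_mat q J')\<^sup>T"
    using J' W by (simp add: dagger_def bar_transpose bar_mult bar_bar)
  also have "\<dots> = (bar_mat q J')\<^sup>T * (W\<^sup>T * (bar_mat q J)\<^sup>T)"
    using J' W by (simp add: square_transpose_mult[where n = n])
  finally show ?thesis using J' W by (simp add: bar_J J'_hermitian square_mult_assoc[where n = n])
qed

lemma dagger_dagger:
  assumes W: "W \<in> carrier_mat n n" shows "dagger (dagger W) = W"
proof -
  have "J * bar_mat q (dagger W) * J' = (J * J') * W\<^sup>T * (J * J')"
    using J' W by (simp add: bar_dagger square_mult_assoc[where n = n] J_cancel)
  then have "J * bar_mat q (dagger W) * J' = W\<^sup>T" using J' W by simp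
  then show ?thesis unfolding dagger_def by simp
qed

text \<open>The transpose of \<open>dagger g * g\<close> is \<open>g^T * J * bar g\<close> times the
  inverse of \<open>J\<close>. This identifies the group with the unitary elements of the matrix
  ring with involution \<open>dagger\<close>.\<close>

lemma unitary_iff:
  assumes g: "g \<in> carrier_mat n n"
  shows "g\<^sup>T * J * bar_mat q g = J \<longleftrightarrow> dagger g * g = 1\<^sub>m n"
proof -
  have "dagger g * g = 1\<^sub>m n \<longleftrightarrow> (dagger g * g)\<^sup>T = (1\<^sub>m n)\<^sup>T" by (simp only: transpose_mat_eq)
  also have "(dagger g * g)\<^sup>T = g\<^sup>T * J * bar_mat q g * J'"
    using J' g by (simp add: square_transpose_mult[where n = n] dagger_closed) (simp add: dagger_def square_mult_assoc[where n = n])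
  also have "g\<^sup>T * J * bar_mat q g * J' = (1\<^sub>m n)\<^sup>T \<longleftrightarrow> g\<^sup>T * J * bar_mat q g = J"
  proof
    let ?A = "g\<^sup>T * J * bar_mat q g"
    have A: "?A \<in> carrier_mat n n" using g by simp
    assume "?A * J' = (1\<^sub>m n)\<^sup>T"
    then have "?A * J' * J = J" by (simp add: square_mult_one(1)[OF J_closed])
    then have "?A * (J' * J) = J" using square_mult_assoc[OF A J'(1) J_closed] by simp
    then show "?A = J" using A J' by (simp add: square_mult_one(2)[OF A])
  qed (use J' in simp)
  finally show ?thesis by simp
qed

definition skew_scalar :: 'b where "skew_scalar = (SOME e. e ^ q = - e \<and> e \<noteq> 0)"

lemma frob_uminus: "(- x) ^ q = - (x ^ q)" for x :: 'b
  using frob_add[of "- x" x] q_pos by (simp add: eq_neg_iff_add_eq_0)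

lemma frob_diff: "(x - y) ^ q = x ^ q - y ^ q" for x y :: 'b
  using frob_add[of x "- y"] by (simp add: frob_uminus)

text \<open>A skew scalar is obtained as \<open>a^q - a\<close> from any \<open>a\<close> that the
  involution moves. The last claim holds because \<open>2\<close> and \<open>- 2\<close> are fixed
  by the involution, which a nonzero skew element is not when \<open>2\<close> is nonzero.\<close>

lemma skew_scalar: "skew_scalar ^ q = - skew_scalar" "skew_scalar \<noteq> 0" "4 - skew_scalar ^ 2 \<noteq> 0"
proof -
  obtain a :: 'b where a: "a ^ q \<noteq> a" using frob_nontriv by blast
  have "(a ^ q - a) ^ q = - (a ^ q - a)" by (simp add: frob_diff frob2)
  then have "\<exists>e :: 'b. e ^ q = - e \<and> e \<noteq> 0" using a by (intro exI[of _ "a ^ q - a"]) simp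
  from someI_ex[OF this] show s: "skew_scalar ^ q = - skew_scalar" "skew_scalar \<noteq> 0"
    by (auto simp: skew_scalar_def)
  have "(2 :: 'b) ^ q = 2" using frob_add[of 1 1] by simp
  show "4 - skew_scalar ^ 2 \<noteq> 0"
  proof
    assume "4 - skew_scalar ^ 2 = 0"
    then have "(2 - skew_scalar) * (2 + skew_scalar) = 0" by (simp add: algebra_simps power2_eq_square)
    then have "skew_scalar = 2 \<or> skew_scalar = - 2" by (auto simp: eq_neg_iff_add_eq_0 add.commute)
    then have "skew_scalar ^ q = skew_scalar" using \<open>2 ^ q = 2\<close> by (auto simp: frob_uminus)
    then have "2 * skew_scalar = 0" using s by (simp add: eq_neg_iff_add_eq_0)
    then show False using two s by simp
  qed
qed

lemma scalar_GL: "c \<noteq> 0 \<Longrightarrow> c \<cdot>\<^sub>m 1\<^sub>m n \<in> GL n" for c :: 'b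
  by (intro GL_I[of _ _ "inverse c \<cdot>\<^sub>m 1\<^sub>m n"] eq_matI) auto

sublocale star: star_ring "ring_mat TYPE('b) n ()" dagger "skew_scalar \<cdot>\<^sub>m 1\<^sub>m n"
proof -
  interpret ring "ring_mat TYPE('b) n ()" by (rule ring_mat)
  have uminus: "\<ominus>\<^bsub>ring_mat TYPE('b) n ()\<^esub> A = - A" if "A \<in> carrier_mat n n" for A :: "'b mat"
    using that by (intro minus_equality) (auto simp: ring_mat_simps)
  show "star_ring (ring_mat TYPE('b) n ()) dagger (skew_scalar \<cdot>\<^sub>m 1\<^sub>m n)"
  proof unfold_locales
    show "finite (carrier (ring_mat TYPE('b) n ()))" by (simp add: ring_mat_simps finite_carrier_mat)
    show "skew_scalar \<cdot>\<^sub>m 1\<^sub>m n \<in> GL n" using skew_scalar scalar_GL by blast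
    show "skew_scalar \<cdot>\<^sub>m 1\<^sub>m n \<otimes>\<^bsub>ring_mat TYPE('b) n ()\<^esub> W = W \<otimes>\<^bsub>ring_mat TYPE('b) n ()\<^esub> (skew_scalar \<cdot>\<^sub>m 1\<^sub>m n)"
      if "W \<in> carrier (ring_mat TYPE('b) n ())" for W
      using that smult_one_commute[of W n skew_scalar] by (simp add: ring_mat_simps)
    have "bar_mat q (skew_scalar \<cdot>\<^sub>m 1\<^sub>m n) = - skew_scalar \<cdot>\<^sub>m 1\<^sub>m n"
      using q_pos unfolding bar_mat_def by (intro eq_matI) (auto simp: skew_scalar)
    then have "dagger (skew_scalar \<cdot>\<^sub>m 1\<^sub>m n) = (- skew_scalar \<cdot>\<^sub>m (J * J'))\<^sup>T"
      using J' mult_smult_distrib[OF J_closed, of "1\<^sub>m n" n "- skew_scalar"]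
        mult_smult_assoc_mat[OF J_closed J'(1), of "- skew_scalar"]
      by (simp add: dagger_def square_mult_one(2)[OF J_closed])
    also have "\<dots> = - (skew_scalar \<cdot>\<^sub>m 1\<^sub>m n)" using J' by (intro eq_matI) auto
    finally show "dagger (skew_scalar \<cdot>\<^sub>m 1\<^sub>m n) = \<ominus>\<^bsub>ring_mat TYPE('b) n ()\<^esub> (skew_scalar \<cdot>\<^sub>m 1\<^sub>m n)"
      by (simp add: uminus)
    have "1\<^sub>m n + 1\<^sub>m n = (2 :: 'b) \<cdot>\<^sub>m 1\<^sub>m n" by (intro eq_matI) auto
    then show "\<one>\<^bsub>ring_mat TYPE('b) n ()\<^esub> \<oplus>\<^bsub>ring_mat TYPE('b) n ()\<^esub> \<one>\<^bsub>ring_mat TYPE('b) n ()\<^esub> \<in> GL n"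
      using scalar_GL[OF two] by (simp add: ring_mat_simps)
    have "(1\<^sub>m n + 1\<^sub>m n) * (1\<^sub>m n + 1\<^sub>m n) + - (skew_scalar \<cdot>\<^sub>m 1\<^sub>m n * (skew_scalar \<cdot>\<^sub>m 1\<^sub>m n)) =
        (4 - skew_scalar ^ 2) \<cdot>\<^sub>m (1\<^sub>m n :: 'b mat)"
      unfolding \<open>1\<^sub>m n + 1\<^sub>m n = (2 :: 'b) \<cdot>\<^sub>m 1\<^sub>m n\<close>
      by (intro eq_matI) (auto simp: smult_one_mult[of "c \<cdot>\<^sub>m 1\<^sub>m n" n for c] power2_eq_square)
    then show "(\<one>\<^bsub>ring_mat TYPE('b) n ()\<^esub> \<oplus>\<^bsub>ring_mat TYPE('b) n ()\<^esub> \<one>\<^bsub>ring_mat TYPE('b) n ()\<^esub>)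
        \<otimes>\<^bsub>ring_mat TYPE('b) n ()\<^esub> (\<one>\<^bsub>ring_mat TYPE('b) n ()\<^esub> \<oplus>\<^bsub>ring_mat TYPE('b) n ()\<^esub> \<one>\<^bsub>ring_mat TYPE('b) n ()\<^esub>)
        \<ominus>\<^bsub>ring_mat TYPE('b) n ()\<^esub> skew_scalar \<cdot>\<^sub>m 1\<^sub>m n \<otimes>\<^bsub>ring_mat TYPE('b) n ()\<^esub> (skew_scalar \<cdot>\<^sub>m 1\<^sub>m n) \<in> GL n"
      using scalar_GL[OF skew_scalar(3)] by (simp add: a_minus_def uminus ring_mat_simps)
  qed (auto simp: ring_mat_simps dagger_closed dagger_dagger dagger_add dagger_mult)
qed

text \<open>The quotient of the two Gram matrices gives a unit \<open>h\<close> that is self-adjoint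
  for \<open>dagger\<close>; a factorization \<open>h = dagger y * y\<close> is precisely an
  isometry \<open>y\<close> between the forms.\<close>

lemma hermitian_forms_equivalent:
  assumes "J0 \<in> GL n" "J0\<^sup>T = bar_mat q J0"
  shows "\<exists>P\<in>GL n. P\<^sup>T * J * bar_mat q P = J0"
proof -
  have J0: "J0 \<in> carrier_mat n n" using assms(1) by (rule GL_carrier)
  have bJ0: "(bar_mat q J0)\<^sup>T = J0" using assms(2) by (metis transpose_transpose)
  define h where "h = (J0 * J')\<^sup>T"
  have hc: "h \<in> carrier_mat n n" using J0 J' by (simp add: h_def)
  have "J' \<in> GL n" using GL_I[of J' n J] J' by simp
  then have h: "h \<in> GL n" using assms(1) by (simp add: h_def GL_mult GL_transpose del: transpose_mult)
  have "bar_mat q h = (bar_mat q J')\<^sup>T * (bar_mat q J0)\<^sup>T"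
    using J0 J' by (simp add: h_def bar_transpose bar_mult square_transpose_mult[where n = n])
  then have "J * bar_mat q h * J' = (J * J') * J0 * J'"
    using J0 J' by (simp add: J'_hermitian bJ0 square_mult_assoc[where n = n] J_cancel)
  then have "dagger h = h" using J0 J' by (simp add: dagger_def h_def)
  from star.hermitian_unit_is_norm[OF h this]
  obtain y where y: "y \<in> GL n" "dagger y * y = h" by (auto simp: ring_mat_simps)
  have yc: "y \<in> carrier_mat n n" using y(1) by (rule GL_carrier)
  have "y\<^sup>T * (dagger y)\<^sup>T = h\<^sup>T" using y(2) yc by (metis dagger_closed transpose_mult)
  then have "y\<^sup>T * (J * bar_mat q y * J') = J0 * J'" by (simp add: dagger_def h_def)
  then have "y\<^sup>T * (J * bar_mat q y * J') * J = J0 * J' * J" by simp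
  then have "y\<^sup>T * J * bar_mat q y = J0"
    using yc J0 J' by (simp add: square_mult_assoc[where n = n] J_cancel)
  then show ?thesis using y(1) by blast
qed

end

section \<open>\<open>z\<close>-classes and commutants\<close>

lemma (in group) inv_cancel_left:
  assumes "g \<in> carrier G" "x \<in> carrier G"
  shows "inv g \<otimes> (g \<otimes> x) = x" "g \<otimes> (inv g \<otimes> x) = x"
  using assms by (simp_all flip: m_assoc)

lemma centralizer_conjugate:
  fixes G (structure)
  assumes "group G" and g: "g \<in> carrier G" and x: "x \<in> carrier G"
  shows "g <# centralizer G x #> inv g = centralizer G (g \<otimes> x \<otimes> inv g)"
proof -
  interpret group G by fact
  have comm: "(g \<otimes> c \<otimes> inv g) \<otimes> (g \<otimes> x \<otimes> inv g) = g \<otimes> (c \<otimes> x) \<otimes> inv g"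
    "(g \<otimes> x \<otimes> inv g) \<otimes> (g \<otimes> c \<otimes> inv g) = g \<otimes> (x \<otimes> c) \<otimes> inv g" if "c \<in> carrier G" for c
    using that g x by (simp_all add: m_assoc inv_cancel_left)
  show ?thesis
  proof (intro equalityI subsetI)
    fix y assume "y \<in> g <# centralizer G x #> inv g"
    then obtain c where c: "c \<in> carrier G" "c \<otimes> x = x \<otimes> c" "y = g \<otimes> c \<otimes> inv g"
      by (auto simp: l_coset_def r_coset_def centralizer_def)
    then show "y \<in> centralizer G (g \<otimes> x \<otimes> inv g)"
      using comm[OF c(1)] g by (simp add: centralizer_def)
  next
    fix y assume "y \<in> centralizer G (g \<otimes> x \<otimes> inv g)"
    then have y: "y \<in> carrier G" "y \<otimes> (g \<otimes> x \<otimes> inv g) = (g \<otimes> x \<otimes> inv g) \<otimes> y"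
      by (auto simp: centralizer_def)
    define c where "c = inv g \<otimes> y \<otimes> g"
    have c: "c \<in> carrier G" "y = g \<otimes> c \<otimes> inv g"
      using y g by (simp_all add: c_def m_assoc inv_cancel_left)
    have "g \<otimes> (c \<otimes> x) \<otimes> inv g = g \<otimes> (x \<otimes> c) \<otimes> inv g"
      using y(2) comm[OF c(1)] c(2) by simp
    then have "c \<otimes> x = x \<otimes> c" using c g x by simp
    then show "y \<in> g <# centralizer G x #> inv g"
      using c by (auto simp: l_coset_def r_coset_def centralizer_def)
  qed
qed

lemma z_rel_iff:
  fixes G (structure)
  assumes "group G"
  shows "(x, y) \<in> z_rel G \<longleftrightarrow> x \<in> carrier G \<and> y \<in> carrier G \<and>
    (\<exists>g\<in>carrier G. centralizer G (g \<otimes> x \<otimes> inv g) = centralizer G y)"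
  using centralizer_conjugate[OF assms, of _ x]
  by (auto simp: z_rel_def conjugate_subsets_def)

lemma equiv_z_rel:
  fixes G (structure)
  assumes "group G"
  shows "equiv (carrier G) (z_rel G)"
proof -
  interpret group G by fact
  note z = z_rel_iff[OF assms]
  have conj: "centralizer G (g \<otimes> x \<otimes> inv g) = centralizer G (g \<otimes> y \<otimes> inv g)"
    if "centralizer G x = centralizer G y" "g \<in> carrier G" "x \<in> carrier G" "y \<in> carrier G" for g x y
    using centralizer_conjugate[OF assms, of g x] centralizer_conjugate[OF assms, of g y] that by simp
  show ?thesis
  proof (rule equivI)
    show "z_rel G \<subseteq> carrier G \<times> carrier G" by (auto simp: z_rel_def)
    show "refl_on (carrier G) (z_rel G)"
      by (rule refl_onI) (auto simp: z intro!: bexI[of _ \<one>])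
    show "sym (z_rel G)"
    proof (rule symI)
      fix x y assume "(x, y) \<in> z_rel G"
      then obtain g where g: "x \<in> carrier G" "y \<in> carrier G" "g \<in> carrier G"
        "centralizer G (g \<otimes> x \<otimes> inv g) = centralizer G y" by (auto simp: z)
      have "inv g \<otimes> (g \<otimes> x \<otimes> inv g) \<otimes> inv (inv g) = x" using g by (simp add: m_assoc inv_cancel_left)
      then have "centralizer G (inv g \<otimes> y \<otimes> inv (inv g)) = centralizer G x"
        using conj[OF g(4)[symmetric], of "inv g"] g by simp
      then show "(y, x) \<in> z_rel G" using g unfolding z by (intro conjI bexI[of _ "inv g"]) simp_all
    qed
    show "trans (z_rel G)"
    proof (rule transI)
      fix x y w assume "(x, y) \<in> z_rel G" "(y, w) \<in> z_rel G"
      then obtain g h where g: "x \<in> carrier G" "y \<in> carrier G" "g \<in> carrier G"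
        "centralizer G (g \<otimes> x \<otimes> inv g) = centralizer G y"
        and h: "w \<in> carrier G" "h \<in> carrier G" "centralizer G (h \<otimes> y \<otimes> inv h) = centralizer G w"
        by (auto simp: z)
      have "h \<otimes> (g \<otimes> x \<otimes> inv g) \<otimes> inv h = (h \<otimes> g) \<otimes> x \<otimes> inv (h \<otimes> g)"
        using g h by (simp add: inv_mult_group m_assoc)
      then have "centralizer G ((h \<otimes> g) \<otimes> x \<otimes> inv (h \<otimes> g)) = centralizer G w"
        using conj[OF g(4), of h] g h by simp
      then show "(x, w) \<in> z_rel G" using g h unfolding z by (intro conjI bexI[of _ "h \<otimes> g"]) simp_all
    qed
  qed
qed

text \<open>A relation instead of a map: totality on both sides and compatibility with the
  equivalences suffice, so no canonical partner has to be selected for an element.\<close>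

lemma card_quotient_eq:
  assumes r: "equiv A r" and s: "equiv B s" and "P \<subseteq> A" "Q \<subseteq> B"
    and left: "\<And>x. x \<in> P \<Longrightarrow> \<exists>y\<in>Q. T x y" and right: "\<And>y. y \<in> Q \<Longrightarrow> \<exists>x\<in>P. T x y"
    and compat: "\<And>x y x' y'. x \<in> P \<Longrightarrow> x' \<in> P \<Longrightarrow> y \<in> Q \<Longrightarrow> y' \<in> Q \<Longrightarrow> T x y \<Longrightarrow> T x' y' \<Longrightarrow>
      (x, x') \<in> r \<longleftrightarrow> (y, y') \<in> s"
  shows "card (P // r) = card (Q // s)"
proof -
  obtain f where f: "\<And>x. x \<in> P \<Longrightarrow> f x \<in> Q \<and> T x (f x)" using left by metis
  have r_class: "r `` {x} = r `` {x'} \<longleftrightarrow> (x, x') \<in> r" if "x \<in> P" "x' \<in> P" for x x'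
    using eq_equiv_class_iff[OF r, of x x'] that \<open>P \<subseteq> A\<close> by blast
  have s_class: "s `` {y} = s `` {y'} \<longleftrightarrow> (y, y') \<in> s" if "y \<in> Q" "y' \<in> Q" for y y'
    using eq_equiv_class_iff[OF s, of y y'] that \<open>Q \<subseteq> B\<close> by blast
  have "\<forall>c\<in>P // r. \<exists>x. x \<in> P \<and> c = r `` {x}" by (auto elim!: quotientE)
  then obtain h where h: "\<And>c. c \<in> P // r \<Longrightarrow> h c \<in> P \<and> c = r `` {h c}" by metis
  have "bij_betw (\<lambda>c. s `` {f (h c)}) (P // r) (Q // s)"
  proof (rule bij_betw_imageI)
    show "inj_on (\<lambda>c. s `` {f (h c)}) (P // r)"
    proof (rule inj_onI)
      fix c d assume c: "c \<in> P // r" and d: "d \<in> P // r" and eq: "s `` {f (h c)} = s `` {f (h d)}"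
      have "(f (h c), f (h d)) \<in> s" using eq s_class f h[OF c] h[OF d] by blast
      then have "(h c, h d) \<in> r" using compat[of "h c" "h d" "f (h c)" "f (h d)"] f h[OF c] h[OF d] by blast
      then show "c = d" using r_class h[OF c] h[OF d] by blast
    qed
    show "(\<lambda>c. s `` {f (h c)}) ` (P // r) = Q // s"
    proof (intro equalityI subsetI)
      fix c assume "c \<in> (\<lambda>c. s `` {f (h c)}) ` (P // r)"
      then show "c \<in> Q // s" using f h by (auto intro!: quotientI)
    next
      fix c assume "c \<in> Q // s"
      then obtain y where y: "y \<in> Q" "c = s `` {y}" by (rule quotientE)
      obtain x where x: "x \<in> P" "T x y" using right[OF y(1)] by blast
      define d where "d = r `` {x}"
      have d: "d \<in> P // r" using x by (simp add: d_def quotientI)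
      have "(x, h d) \<in> r" using h[OF d] r_class[of x "h d"] x by (auto simp: d_def)
      then have "(y, f (h d)) \<in> s" using compat[of x "h d" y "f (h d)"] x y f h[OF d] by blast
      then have "c = s `` {f (h d)}" using s_class[of y "f (h d)"] y f h[OF d] by auto
      then show "c \<in> (\<lambda>c. s `` {f (h c)}) ` (P // r)" using d by blast
    qed
  qed
  then show ?thesis by (rule bij_betw_same_card)
qed

lemma card_quotient_eq_card:
  assumes "equiv A r" "P \<subseteq> A"
    and "\<And>x. x \<in> P \<Longrightarrow> \<exists>y\<in>Q. T x y" and "\<And>y. y \<in> Q \<Longrightarrow> \<exists>x\<in>P. T x y"
    and "\<And>x y x' y'. x \<in> P \<Longrightarrow> x' \<in> P \<Longrightarrow> y \<in> Q \<Longrightarrow> y' \<in> Q \<Longrightarrow> T x y \<Longrightarrow> T x' y' \<Longrightarrow>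
      (x, x') \<in> r \<longleftrightarrow> y = y'"
  shows "card (P // r) = card Q"
proof -
  have "card (P // r) = card (Q // Id)"
  proof (rule card_quotient_eq[OF assms(1) _ assms(2), where B = UNIV and T = T])
    show "equiv UNIV (Id :: ('b \<times> 'b) set)" by (auto simp: equiv_def refl_on_def sym_def trans_def)
    show "(x, x') \<in> r \<longleftrightarrow> (y, y') \<in> Id"
      if "x \<in> P" "x' \<in> P" "y \<in> Q" "y' \<in> Q" "T x y" "T x' y'" for x y x' y'
      unfolding pair_in_Id_conv by (rule assms(5)[OF that])
  qed (rule assms(3,4) subset_UNIV; assumption?)+
  also have "Q // Id = (\<lambda>y. {y}) ` Q" by (auto simp: quotient_def)
  also have "card \<dots> = card Q" by (rule card_image) (auto simp: inj_on_def)
  finally show ?thesis .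
qed

text \<open>The two features shared by \<open>GL\<^sub>n(q)\<close> and \<open>U\<^sub>n(q)\<close> that make centralizers in the group as informative
  as commutants in the matrix algebra.\<close>

locale ample_matrix_group =
  fixes n :: nat and G :: "'a :: {finite, field} mat monoid"
  assumes G_def: "G = (general_linear_group TYPE('a) n)\<lparr>carrier := carrier G\<rparr>"
    and group_G: "group G"
    and G_GL: "carrier G \<subseteq> GL n"
    and conj: "s \<in> carrier G \<Longrightarrow> t \<in> carrier G \<Longrightarrow> W \<in> GL n \<Longrightarrow> W * s = t * W \<Longrightarrow>
      \<exists>Z\<in>carrier G. Z * s = t * Z"
    and commute: "s \<in> carrier G \<Longrightarrow> t \<in> carrier_mat n n \<Longrightarrow>
      (\<And>g. g \<in> carrier G \<Longrightarrow> g * s = s * g \<Longrightarrow> g * t = t * g) \<Longrightarrow>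
      A \<in> carrier_mat n n \<Longrightarrow> A * s = s * A \<Longrightarrow> A * t = t * A"
begin

lemma mult_G: "x \<otimes>\<^bsub>G\<^esub> y = x * y"
  using arg_cong[OF G_def, of monoid.mult] by (simp add: general_linear_group_def units_of_def ring_mat_simps)

lemma G_carrier: "x \<in> carrier G \<Longrightarrow> x \<in> carrier_mat n n"
  using G_GL GL_carrier by blast

text \<open>By \<open>conj\<close>, conjugation in the group is similarity between group elements;
  by \<open>commute\<close>, equal centralizers in the group amount to equal commutants in the
  matrix algebra. From here on \<open>z\<close>-equivalence is a question of linear algebra.\<close>

theorem z_rel_iff_similar:
  "(s, t) \<in> z_rel G \<longleftrightarrow> s \<in> carrier G \<and> t \<in> carrier G \<and>
    (\<exists>s'\<in>carrier G. similar_mat s s' \<and>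
      (\<forall>A\<in>carrier_mat n n. A * s' = s' * A \<longleftrightarrow> A * t = t * A))"
proof -
  interpret group G by (rule group_G)
  note z = z_rel_iff[OF group_G]
  have conjugate: "similar_mat s (g \<otimes>\<^bsub>G\<^esub> s \<otimes>\<^bsub>G\<^esub> inv\<^bsub>G\<^esub> g)" if "s \<in> carrier G" "g \<in> carrier G" for s g
  proof -
    let ?t = "g \<otimes>\<^bsub>G\<^esub> s \<otimes>\<^bsub>G\<^esub> inv\<^bsub>G\<^esub> g"
    have "inv\<^bsub>G\<^esub> g \<otimes>\<^bsub>G\<^esub> ?t = s \<otimes>\<^bsub>G\<^esub> inv\<^bsub>G\<^esub> g" using that by (simp add: m_assoc inv_cancel_left)
    then have "inv\<^bsub>G\<^esub> g * ?t = s * inv\<^bsub>G\<^esub> g" by (simp add: mult_G)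
    moreover have "inv\<^bsub>G\<^esub> g \<in> GL n" using inv_closed[OF that(2)] G_GL by blast
    moreover have "?t \<in> carrier G" using that by simp
    ultimately show ?thesis
      unfolding similar_mat_iff_GL[OF G_carrier[OF that(1)] G_carrier[OF \<open>?t \<in> carrier G\<close>]] by blast
  qed
  show ?thesis
  proof (intro iffI conjI; (elim conjE)?)
    assume "(s, t) \<in> z_rel G"
    then obtain g where s: "s \<in> carrier G" and t: "t \<in> carrier G" and g: "g \<in> carrier G"
      and eq: "centralizer G (g \<otimes>\<^bsub>G\<^esub> s \<otimes>\<^bsub>G\<^esub> inv\<^bsub>G\<^esub> g) = centralizer G t" by (auto simp: z)
    define s' where "s' = g \<otimes>\<^bsub>G\<^esub> s \<otimes>\<^bsub>G\<^esub> inv\<^bsub>G\<^esub> g"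
    have s': "s' \<in> carrier G" using s g by (simp add: s'_def)
    have same: "c * s' = s' * c \<longleftrightarrow> c * t = t * c" if "c \<in> carrier G" for c
    proof -
      have "c \<in> centralizer G s' \<longleftrightarrow> c \<in> centralizer G t" using eq by (simp add: s'_def)
      then show ?thesis using that unfolding centralizer_def mult_G mem_Collect_eq by blast
    qed
    show "s \<in> carrier G" "t \<in> carrier G" by fact+
    show "\<exists>s'\<in>carrier G. similar_mat s s' \<and>
      (\<forall>A\<in>carrier_mat n n. A * s' = s' * A \<longleftrightarrow> A * t = t * A)"
    proof (intro bexI[OF _ s'] conjI ballI iffI)
      show "similar_mat s s'" using conjugate[OF s g] by (simp add: s'_def)
      fix A :: "'a mat" assume A: "A \<in> carrier_mat n n"
      show "A * t = t * A" if "A * s' = s' * A"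
        by (rule commute[OF s' G_carrier[OF t] _ A that]) (simp only: same)
      show "A * s' = s' * A" if "A * t = t * A"
        by (rule commute[OF t G_carrier[OF s'] _ A that]) (simp only: same)
    qed
  next
    assume s: "s \<in> carrier G" and t: "t \<in> carrier G"
      and "\<exists>s'\<in>carrier G. similar_mat s s' \<and>
        (\<forall>A\<in>carrier_mat n n. A * s' = s' * A \<longleftrightarrow> A * t = t * A)"
    then obtain s' where s': "s' \<in> carrier G" "similar_mat s' s"
      "\<And>A. A \<in> carrier_mat n n \<Longrightarrow> A * s' = s' * A \<longleftrightarrow> A * t = t * A"
      using similar_mat_sym by blast
    obtain W where "W \<in> GL n" "W * s = s' * W"
      using s'(2) unfolding similar_mat_iff_GL[OF G_carrier[OF s'(1)] G_carrier[OF s]] by blast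
    then obtain g where g: "g \<in> carrier G" "g \<otimes>\<^bsub>G\<^esub> s = s' \<otimes>\<^bsub>G\<^esub> g"
      using conj[OF s s'(1)] by (auto simp: mult_G)
    have e: "g \<otimes>\<^bsub>G\<^esub> s \<otimes>\<^bsub>G\<^esub> inv\<^bsub>G\<^esub> g = s'" using g s s'(1) by (simp add: m_assoc)
    have "centralizer G s' = centralizer G t"
      unfolding centralizer_def mult_G by (intro Collect_cong conj_cong refl) (use s'(3) G_carrier in blast)
    then show "(s, t) \<in> z_rel G" unfolding z using s t g(1) e by blast
  qed
qed

corollary z_rel_if_similar:
  "s \<in> carrier G \<Longrightarrow> t \<in> carrier G \<Longrightarrow> similar_mat s t \<Longrightarrow> (s, t) \<in> z_rel G"
  unfolding z_rel_iff_similar by blast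

end

section \<open>The general linear and the unitary group as ample groups\<close>

lemma ample_general_linear_group:
  assumes "(2 :: 'a :: {finite, field}) \<noteq> 0"
  shows "ample_matrix_group n (general_linear_group TYPE('a) n)"
proof -
  let ?R = "ring_mat TYPE('a) n ()"
  interpret ring ?R by (rule ring_mat)
  have carrier: "carrier (general_linear_group TYPE('a) n) = GL n"
    by (simp add: general_linear_group_def units_of_def)
  show ?thesis
  proof (rule ample_matrix_group.intro)
    show "general_linear_group TYPE('a) n = general_linear_group TYPE('a) n\<lparr>carrier := carrier (general_linear_group TYPE('a) n)\<rparr>"
      by simp
    show "group (general_linear_group TYPE('a) n)" unfolding general_linear_group_def by (rule units_group)
    show "carrier (general_linear_group TYPE('a) n) \<subseteq> GL n" by (simp add: carrier)
    show "\<exists>Z\<in>carrier (general_linear_group TYPE('a) n). Z * s = t * Z"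
      if "W \<in> GL n" "W * s = t * W" for s t W :: "'a mat" using that by (auto simp: carrier)
    show "A * t = t * A"
      if s: "s \<in> carrier (general_linear_group TYPE('a) n)" and t: "t \<in> carrier_mat n n"
        and H: "\<And>g. g \<in> carrier (general_linear_group TYPE('a) n) \<Longrightarrow> g * s = s * g \<Longrightarrow> g * t = t * g"
        and A: "A \<in> carrier_mat n n" "A * s = s * A" for s t A :: "'a mat"
    proof -
      have "1\<^sub>m n + 1\<^sub>m n = (2 :: 'a) \<cdot>\<^sub>m 1\<^sub>m n" by (intro eq_matI) auto
      moreover have "(2 :: 'a) \<cdot>\<^sub>m 1\<^sub>m n \<in> GL n"
        using assms by (intro GL_I[of _ _ "inverse 2 \<cdot>\<^sub>m 1\<^sub>m n"] eq_matI) auto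
      ultimately have two: "\<one>\<^bsub>?R\<^esub> \<oplus>\<^bsub>?R\<^esub> \<one>\<^bsub>?R\<^esub> \<in> Units ?R" by (simp add: ring_mat_simps)
      show ?thesis
        using commutes_if_commutes_units[OF _ two, of s t A, unfolded ring_mat_simps, OF finite_carrier_mat]
          GL_carrier s t H A unfolding carrier by blast
    qed
  qed
qed

context hermitian_space
begin

lemma carrier_unitary_group: "carrier (unitary_group q n J) = {g \<in> GL n. dagger g * g = 1\<^sub>m n}"
  using unitary_iff GL_carrier by (auto simp: unitary_group_def general_linear_group_def units_of_def)

lemma unitary_group_eqs:
  assumes "g \<in> carrier (unitary_group q n J)"
  shows "g \<in> carrier_mat n n" "dagger g * g = 1\<^sub>m n" "g * dagger g = 1\<^sub>m n"
proof -
  show g: "g \<in> carrier_mat n n" "dagger g * g = 1\<^sub>m n"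
    using assms GL_carrier by (auto simp: carrier_unitary_group)
  then show "g * dagger g = 1\<^sub>m n" using mat_mult_left_right_inverse[of "dagger g" n g] dagger_closed by blast
qed

lemma unitaryI: "g \<in> carrier_mat n n \<Longrightarrow> dagger g * g = 1\<^sub>m n \<Longrightarrow> g \<in> carrier (unitary_group q n J)"
  using GL_I[of g n "dagger g"] mat_mult_left_right_inverse[of "dagger g" n g] dagger_closed[of g]
  by (auto simp: carrier_unitary_group)

lemma dagger_one: "dagger (1\<^sub>m n) = 1\<^sub>m n"
  using star.star_one by (simp add: ring_mat_simps)

sublocale unitary: ample_matrix_group n "unitary_group q n J"
proof -
  let ?R = "ring_mat TYPE('b) n ()" and ?U = "unitary_group q n J"
  interpret GL: group "general_linear_group TYPE('b) n"
    unfolding general_linear_group_def using monoid.units_group[OF ring.is_monoid[OF ring_mat]] .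
  have sub: "subgroup (carrier ?U) (general_linear_group TYPE('b) n)"
  proof (rule GL.subgroupI)
    show "carrier ?U \<subseteq> carrier (general_linear_group TYPE('b) n)" by (auto simp: unitary_group_def)
    have "1\<^sub>m n \<in> carrier ?U" by (rule unitaryI) (auto simp: dagger_one)
    then show "carrier ?U \<noteq> {}" by blast
    fix g assume g: "g \<in> carrier ?U"
    note G = unitary_group_eqs[OF g]
    have dU: "dagger g \<in> carrier ?U"
      using G dagger_closed[OF G(1)] by (intro unitaryI) (auto simp: dagger_dagger)
    have "inv\<^bsub>general_linear_group TYPE('b) n\<^esub> g = dagger g"
      using g dU G by (intro GL.inv_equality)
        (auto simp: general_linear_group_def units_of_def ring_mat_simps carrier_unitary_group)
    then show "inv\<^bsub>general_linear_group TYPE('b) n\<^esub> g \<in> carrier ?U" using dU by simp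
    fix h assume h: "h \<in> carrier ?U"
    note H = unitary_group_eqs[OF h]
    have "dagger (g * h) * (g * h) = dagger h * ((dagger g * g) * h)"
      using G(1) H(1) dagger_closed by (simp only: dagger_mult square_mult_assoc[where n = n] square_mult_closed)
    also have "\<dots> = 1\<^sub>m n" unfolding G(2) using H by simp
    finally have "g * h \<in> carrier ?U" using G H by (intro unitaryI) auto
    then show "g \<otimes>\<^bsub>general_linear_group TYPE('b) n\<^esub> h \<in> carrier ?U"
      by (simp add: general_linear_group_def units_of_def ring_mat_simps)
  qed
  show "ample_matrix_group n ?U"
  proof (rule ample_matrix_group.intro)
    show eq: "?U = general_linear_group TYPE('b) n\<lparr>carrier := carrier ?U\<rparr>" by (simp add: unitary_group_def)
    show "group ?U" using GL.subgroup_imp_group[OF sub] eq by simp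
    show "carrier ?U \<subseteq> GL n" by (auto simp: carrier_unitary_group)
    show "\<exists>Z\<in>carrier ?U. Z * s = t * Z"
      if st: "s \<in> carrier ?U" "t \<in> carrier ?U" "W \<in> GL n" "W * s = t * W" for s t W
    proof -
      note S = unitary_group_eqs[OF st(1)] and T = unitary_group_eqs[OF st(2)]
      obtain z where "z \<in> GL n" "dagger z * z = 1\<^sub>m n" "z * s = t * z"
        using star.unitary_conjugacy[of s t W, unfolded ring_mat_simps, OF S T st(3,4)] by blast
      then show ?thesis unfolding carrier_unitary_group by blast
    qed
    show "A * t = t * A"
      if s: "s \<in> carrier ?U" and t: "t \<in> carrier_mat n n"
        and H: "\<And>g. g \<in> carrier ?U \<Longrightarrow> g * s = s * g \<Longrightarrow> g * t = t * g"
        and A: "A \<in> carrier_mat n n" "A * s = s * A" for s t A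
    proof -
      note S = unitary_group_eqs[OF s]
      \<comment> \<open>As \<open>dagger s\<close> is the inverse of \<open>s\<close>, taking
        adjoints of \<open>a * s = s * a\<close> shows that the commutant of \<open>s\<close> is
        stable under \<open>dagger\<close>.\<close>
      have d: "dagger a * s = s * dagger a" if a: "a \<in> carrier_mat n n" "a * s = s * a" for a
      proof -
        note c = S(1) a(1) dagger_closed[OF S(1)] dagger_closed[OF a(1)]
        have "dagger (a * s) = dagger (s * a)" using a by simp
        then have e: "dagger s * dagger a = dagger a * dagger s" using a(1) S(1) by (simp add: dagger_mult)
        have "s * (dagger s * dagger a) * s = s * (dagger a * dagger s) * s" by (simp only: e)
        then have "(s * dagger s) * (dagger a * s) = (s * dagger a) * (dagger s * s)"
          using c by (simp only: square_mult_assoc[where n = n] square_mult_closed)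
        then show ?thesis unfolding S(2,3) using c by simp
      qed
      show ?thesis
      proof (rule star.commutes_if_commutes_unitary[of s t A, unfolded ring_mat_simps])
        fix g assume "g \<in> carrier_mat n n" "dagger g * g = 1\<^sub>m n" "g * s = s * g"
        then show "g * t = t * g" using H unitaryI by blast
      qed (use S t d A in blast)+
    qed
  qed
qed

end

section \<open>Unipotent elements\<close>

lemma similar_mat_permute:
  fixes A :: "'a :: field mat"
  assumes A: "A \<in> carrier_mat n n" and p: "bij_betw p {0..<n} {0..<n}"
  shows "similar_mat (mat n n (\<lambda>(i, j). A $$ (p i, p j))) A"
proof -
  let ?B = "mat n n (\<lambda>(i, j). A $$ (p i, p j))"
  define P :: "'a mat" where "P = mat n n (\<lambda>(i, j). if j = p i then 1 else 0)"
  have P: "P \<in> carrier_mat n n" by (simp add: P_def)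
  have pn: "p i < n" if "i < n" for i using bij_betwE[OF p] that by auto
  have p_eq: "p i = p j \<longleftrightarrow> i = j" if "i < n" "j < n" for i j
    using bij_betw_imp_inj_on[OF p] that by (auto simp: inj_on_def)
  have PA: "P * A = mat n n (\<lambda>(i, j). A $$ (p i, j))"
  proof (rule eq_matI)
    fix i j assume "i < dim_row (mat n n (\<lambda>(i, j). A $$ (p i, j)))" "j < dim_col (mat n n (\<lambda>(i, j). A $$ (p i, j)))"
    then have ij: "i < n" "j < n" by auto
    have "(P * A) $$ (i, j) = (\<Sum>k\<in>{0..<n}. (if k = p i then 1 else 0) * A $$ (k, j))"
      using A ij by (simp add: P_def scalar_prod_def)
    also have "\<dots> = (\<Sum>k\<in>{0..<n}. if k = p i then A $$ (k, j) else 0)" by (intro sum.cong) auto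
    also have "\<dots> = A $$ (p i, j)" using pn[OF ij(1)] by simp
    finally show "(P * A) $$ (i, j) = mat n n (\<lambda>(i, j). A $$ (p i, j)) $$ (i, j)" using ij by simp
  qed (use A P in auto)
  have BP: "?B * P = mat n n (\<lambda>(i, j). A $$ (p i, j))"
  proof (rule eq_matI)
    fix i j assume "i < dim_row (mat n n (\<lambda>(i, j). A $$ (p i, j)))" "j < dim_col (mat n n (\<lambda>(i, j). A $$ (p i, j)))"
    then have ij: "i < n" "j < n" by auto
    have "(?B * P) $$ (i, j) = (\<Sum>k\<in>{0..<n}. A $$ (p i, p k) * (if j = p k then 1 else 0))"
      using ij by (simp add: P_def scalar_prod_def)
    also have "\<dots> = (\<Sum>k\<in>{0..<n}. A $$ (p i, k) * (if j = k then 1 else 0))"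
      by (rule sum.reindex_bij_betw[OF p])
    also have "\<dots> = (\<Sum>k\<in>{0..<n}. if j = k then A $$ (p i, k) else 0)" by (intro sum.cong) auto
    also have "\<dots> = A $$ (p i, j)" using ij by simp
    finally show "(?B * P) $$ (i, j) = mat n n (\<lambda>(i, j). A $$ (p i, j)) $$ (i, j)" using ij by simp
  qed (use A P in auto)
  have "P * P\<^sup>T = 1\<^sub>m n"
  proof (rule eq_matI)
    fix i j assume "i < dim_row (1\<^sub>m n :: 'a mat)" "j < dim_col (1\<^sub>m n :: 'a mat)"
    then have ij: "i < n" "j < n" by auto
    have "(P * P\<^sup>T) $$ (i, j) = (\<Sum>k\<in>{0..<n}. (if k = p i then 1 else 0) * (if k = p j then 1 else 0))"
      using ij P by (simp add: scalar_prod_def) (simp add: P_def)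
    also have "\<dots> = (\<Sum>k\<in>{0..<n}. if k = p i then (if i = j then 1 else 0) else 0)"
      using p_eq[OF ij] by (intro sum.cong) auto
    also have "\<dots> = (if i = j then 1 else 0)" using pn[OF ij(1)] by simp
    finally show "(P * P\<^sup>T) $$ (i, j) = 1\<^sub>m n $$ (i, j)" using ij by simp
  qed (use P in auto)
  then have "P \<in> GL n" using P by (intro GL_I[of _ _ "P\<^sup>T"]) auto
  then have "\<exists>W\<in>GL n. W * A = ?B * W" using PA BP by (intro bexI[of _ P]) simp_all
  then show ?thesis using similar_mat_iff_GL[of ?B n A] A by simp
qed

lemma similar_mat_swap_blocks:
  fixes A B :: "'a :: field mat"
  assumes A: "A \<in> carrier_mat a a" and B: "B \<in> carrier_mat b b"
  shows "similar_mat (four_block_mat B (0\<^sub>m b a) (0\<^sub>m a b) A) (four_block_mat A (0\<^sub>m a b) (0\<^sub>m b a) B)"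
proof -
  let ?C = "four_block_mat A (0\<^sub>m a b) (0\<^sub>m b a) B"
  define p where "p i = (if i < b then i + a else i - b)" for i
  have p: "bij_betw p {0..<a + b} {0..<a + b}"
    by (rule bij_betw_byWitness[of _ "\<lambda>i. if i < a then i + b else i - a"]) (auto simp: p_def)
  have "four_block_mat B (0\<^sub>m b a) (0\<^sub>m a b) A = mat (a + b) (a + b) (\<lambda>(i, j). ?C $$ (p i, p j))"
    using A B by (intro eq_matI) (auto simp: p_def)
  then show ?thesis using similar_mat_permute[of ?C "a + b" p] p A B by simp
qed

lemma jordan_matrix_append:
  "jordan_matrix (xs @ ys) = four_block_mat (jordan_matrix xs)
    (0\<^sub>m (sum_list (map fst xs)) (sum_list (map fst ys))) (0\<^sub>m (sum_list (map fst ys)) (sum_list (map fst xs)))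
    (jordan_matrix ys)"
  using jordan_matrix_dim[of xs] jordan_matrix_dim[of ys]
  unfolding jordan_matrix_def map_append diag_block_mat_append Let_def by simp

text \<open>The head of \<open>xs\<close> is located in \<open>ys\<close> and brought to the front
  by a cyclic rotation, which is a swap of two diagonal blocks; the tails are then treated by
  induction.\<close>

lemma similar_jordan_matrix_mset:
  fixes xs ys :: "(nat \<times> 'a :: field) list"
  shows "mset xs = mset ys \<Longrightarrow> similar_mat (jordan_matrix xs) (jordan_matrix ys)"
proof (induction xs arbitrary: ys)
  case Nil
  then show ?case by (auto intro: similar_mat_refl[of _ 0] simp: jordan_matrix_def)
next
  case (Cons x xs)
  have "x \<in> set ys" using Cons.prems by (metis list.set_intros(1) mset_eq_setD)
  then obtain us vs where ys: "ys = us @ x # vs" by (meson split_list)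
  have "mset xs = mset (vs @ us)" using Cons.prems by (simp add: ys)
  note IH = Cons.IH[OF this]
  obtain k a where x: "x = (k, a)" by force
  let ?m = "sum_list (map fst xs)"
  have m: "sum_list (map fst (vs @ us)) = ?m"
    using \<open>mset xs = mset (vs @ us)\<close> by (metis mset_map sum_mset_sum_list)
  have cm: "jordan_matrix (vs @ us) \<in> carrier_mat ?m ?m" using jordan_matrix_carrier[of "vs @ us"] unfolding m .
  have "similar_mat (jordan_matrix (x # xs)) (jordan_matrix (x # (vs @ us)))"
    unfolding x jordan_matrix_Cons m
    by (rule similar_mat_four_block_0_0[OF similar_mat_refl IH]) auto
  also have "x # (vs @ us) = (x # vs) @ us" by simp
  finally have 1: "similar_mat (jordan_matrix (x # xs)) (jordan_matrix ((x # vs) @ us))" .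
  have 2: "similar_mat (jordan_matrix ((x # vs) @ us)) (jordan_matrix (us @ (x # vs)))"
    unfolding jordan_matrix_append by (rule similar_mat_swap_blocks) (rule jordan_matrix_carrier)+
  show ?case using similar_mat_trans[OF 1 2] by (simp add: ys)
qed

section \<open>Jordan types of unipotent matrices\<close>

lemma pow_mat_commute:
  assumes "A \<in> carrier_mat n n" "B \<in> carrier_mat n n" "A * B = B * (A :: 'a :: semiring_1 mat)"
  shows "A ^\<^sub>m i * B = B * A ^\<^sub>m i"
proof (induction i)
  case 0
  then show ?case using assms by simp
next
  case (Suc i)
  have "A ^\<^sub>m Suc i * B = A ^\<^sub>m i * (A * B)" using assms by (simp add: square_mult_assoc[where n = n])
  also have "\<dots> = (A ^\<^sub>m i * B) * A" unfolding assms(3) using assms by (simp add: square_mult_assoc[where n = n])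
  also have "\<dots> = B * A ^\<^sub>m Suc i" unfolding Suc using assms by (simp add: square_mult_assoc[where n = n])
  finally show ?case .
qed

lemma GL_pow: "A \<in> GL n \<Longrightarrow> A ^\<^sub>m k \<in> (GL n :: 'a :: field mat set)"
proof (induction k)
  case 0
  then show ?case using GL_carrier[of A n] GL_I[of "1\<^sub>m n" n "1\<^sub>m n"] by auto
qed (simp add: GL_mult)

text \<open>A nilpotent matrix is singular. Once a kernel vector has become the first basis vector,
  the first column vanishes and the remaining diagonal block is nilpotent again, of size one
  less.\<close>

lemma nilpotent_triangular:
  fixes A :: "'a :: field mat"
  assumes "A \<in> carrier_mat n n" "A ^\<^sub>m k = 0\<^sub>m n n"
  shows "\<exists>B\<in>carrier_mat n n. upper_triangular B \<and> similar_mat A B"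
  using assms
proof (induction n arbitrary: A)
  case 0
  then show ?case by (auto intro!: bexI[of _ A] similar_mat_refl[of A 0])
next
  case (Suc n)
  let ?N = "Suc n"
  note A = Suc.prems(1)
  have "det A = 0"
  proof (rule ccontr)
    assume "det A \<noteq> 0"
    then have "A ^\<^sub>m k \<in> GL ?N" using A GL_pow GL_iff_det by blast
    then show False using Suc.prems(2) det_zero[of ?N] by (simp add: GL_iff_det)
  qed
  then obtain v where v: "v \<in> carrier_vec ?N" "v \<noteq> 0\<^sub>v ?N" "A *\<^sub>v v = 0\<^sub>v ?N"
    using det_0_iff_vec_prod_zero_field[OF A] by blast
  obtain l where l: "l < ?N" "v $ l \<noteq> 0" using v by (metis carrier_vecD eq_vecI index_zero_vec)
  \<comment> \<open>The identity with column \<open>l\<close> replaced by the kernel vector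
    \<open>v\<close>; its inverse \<open>W'\<close> exists because \<open>v $ l\<close> is
    nonzero.\<close>
  define W where "W = mat ?N ?N (\<lambda>(i, j). if j = l then v $ i else if i = j then 1 else 0)"
  define W' where "W' = mat ?N ?N (\<lambda>(i, j). if j = l then (if i = l then 1 / v $ l else - (v $ i / v $ l)) else if i = j then 1 else 0)"
  have W: "W \<in> carrier_mat ?N ?N" "W' \<in> carrier_mat ?N ?N" by (simp_all add: W_def W'_def)
  have colW: "col W l = v" using v l by (intro eq_vecI) (auto simp: W_def)
  have "W' * W = 1\<^sub>m ?N"
  proof (rule eq_matI)
    fix i j assume "i < dim_row (1\<^sub>m ?N :: 'a mat)" "j < dim_col (1\<^sub>m ?N :: 'a mat)"
    then have ij: "i < ?N" "j < ?N" by auto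
    have "(W' * W) $$ (i, j) = (\<Sum>m\<in>{0..<?N}. W' $$ (i, m) * W $$ (m, j))"
      using ij W by (simp add: scalar_prod_def del: sum.op_ivl_Suc)
    also have "\<dots> = (\<Sum>m\<in>{0..<?N}. (if m = l then W' $$ (i, l) * W $$ (l, j) else 0) +
        (if m = i then (if i = l then 0 else W $$ (i, j)) else 0))"
      using ij l by (intro sum.cong) (auto simp: W'_def)
    also have "\<dots> = W' $$ (i, l) * W $$ (l, j) + (if i = l then 0 else W $$ (i, j))"
      using ij l by (subst sum.distrib) (simp del: sum.op_ivl_Suc)
    also have "\<dots> = 1\<^sub>m ?N $$ (i, j)" using ij l by (auto simp: W_def W'_def field_simps)
    finally show "(W' * W) $$ (i, j) = 1\<^sub>m ?N $$ (i, j)" .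
  qed (use W in auto)
  then have WW': "W' * W = 1\<^sub>m ?N" "W * W' = 1\<^sub>m ?N" using W mat_mult_left_right_inverse[of W' ?N W] by auto
  define C where "C = W' * A * W"
  have C: "C \<in> carrier_mat ?N ?N" using W A by (simp add: C_def)
  have simC: "similar_mat C A" using W A C WW' by (intro similar_matI[of _ _ W' W ?N]) (auto simp: C_def)
  have C_col: "C $$ (i, l) = 0" if "i < ?N" for i
  proof -
    have "col C l = (W' * A) *\<^sub>v v" using W A l unfolding C_def by (subst col_mult[where nr = ?N and n = ?N and nc = ?N]) (auto simp: colW)
    also have "\<dots> = W' *\<^sub>v 0\<^sub>v ?N" using W A v by simp
    also have "\<dots> = 0\<^sub>v ?N" using W by (intro eq_vecI) auto
    finally show ?thesis using that l C by (metis carrier_matD index_col index_zero_vec(1))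
  qed
  define p where "p i = (if i = 0 then l else if i = l then 0 else i)" for i
  have p: "bij_betw p {0..<?N} {0..<?N}"
    using l by (intro bij_betw_byWitness[of _ p]) (auto simp: p_def)
  define D where "D = mat ?N ?N (\<lambda>(i, j). C $$ (p i, p j))"
  have D: "D \<in> carrier_mat ?N ?N" by (simp add: D_def)
  have simD: "similar_mat D A"
    using similar_mat_trans[OF similar_mat_permute[OF C p] simC] by (simp add: D_def)
  have D_col: "D $$ (i, 0) = 0" if "i < ?N" for i
    using C_col[of "p i"] bij_betwE[OF p] that by (auto simp: D_def p_def)
  obtain A1 A2 A0 A3 where split: "split_block D 1 1 = (A1, A2, A0, A3)" by (cases "split_block D 1 1") auto
  have dims: "dim_row D = 1 + n" "dim_col D = 1 + n" using D by auto
  note sb = split_block[OF split dims]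
  have A1: "A1 = 0\<^sub>m 1 1" using split D_col[of 0] dims sb(1)
    by (intro eq_matI) (auto simp: split_block_def Let_def)
  have A0: "A0 = 0\<^sub>m n 1" using split D_col dims sb(3)
    by (intro eq_matI) (auto simp: split_block_def Let_def)
  have pow: "\<exists>E\<in>carrier_mat 1 n. D ^\<^sub>m j = four_block_mat (A1 ^\<^sub>m j) E (0\<^sub>m n 1) (A3 ^\<^sub>m j)" for j
  proof (induction j)
    case 0
    then show ?case using sb D by (intro bexI[of _ "0\<^sub>m 1 n"]) auto
  next
    case (Suc j)
    then obtain E where E: "E \<in> carrier_mat 1 n" "D ^\<^sub>m j = four_block_mat (A1 ^\<^sub>m j) E (0\<^sub>m n 1) (A3 ^\<^sub>m j)" by blast
    have c: "A1 ^\<^sub>m j \<in> carrier_mat 1 1" "A3 ^\<^sub>m j \<in> carrier_mat n n" using sb by simp_all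
    have "D ^\<^sub>m Suc j = four_block_mat (A1 ^\<^sub>m j) E (0\<^sub>m n 1) (A3 ^\<^sub>m j) * four_block_mat A1 A2 A0 A3"
      using E sb(5) by simp
    also have "\<dots> = four_block_mat (A1 ^\<^sub>m j * A1 + E * A0) (A1 ^\<^sub>m j * A2 + E * A3)
        (0\<^sub>m n 1 * A1 + A3 ^\<^sub>m j * A0) (0\<^sub>m n 1 * A2 + A3 ^\<^sub>m j * A3)"
      by (rule mult_four_block_mat[OF c(1) E(1) zero_carrier_mat c(2) sb(1-4)])
    also have "\<dots> = four_block_mat (A1 ^\<^sub>m Suc j) (A1 ^\<^sub>m j * A2 + E * A3) (0\<^sub>m n 1) (A3 ^\<^sub>m Suc j)"
      using c E sb unfolding A0 by (intro cong_four_block_mat) (auto simp: left_add_zero_mat[of _ n n])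
    finally show ?case using c E sb by (intro bexI[of _ "A1 ^\<^sub>m j * A2 + E * A3"]) auto
  qed
  obtain P Q where wit: "similar_mat_wit D A P Q" using simD by (auto simp: similar_mat_def)
  have Dk: "D ^\<^sub>m k = 0\<^sub>m ?N ?N"
    using similar_mat_wit_pow_id[OF wit, of k] Suc.prems(2) similar_mat_witD2[OF D wit] by simp
  obtain E where E: "E \<in> carrier_mat 1 n" "D ^\<^sub>m k = four_block_mat (A1 ^\<^sub>m k) E (0\<^sub>m n 1) (A3 ^\<^sub>m k)" using pow by blast
  have "A3 ^\<^sub>m k = 0\<^sub>m n n"
  proof (rule eq_matI)
    fix i j assume "i < dim_row (0\<^sub>m n n :: 'a mat)" "j < dim_col (0\<^sub>m n n :: 'a mat)"
    then have ij: "i < n" "j < n" by auto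
    have "(D ^\<^sub>m k) $$ (Suc i, Suc j) = (A3 ^\<^sub>m k) $$ (i, j)"
      unfolding E(2) using ij sb(1,4) by (subst index_mat_four_block) auto
    then show "(A3 ^\<^sub>m k) $$ (i, j) = 0\<^sub>m n n $$ (i, j)" using ij by (simp add: Dk)
  qed (use sb in auto)
  then obtain B where B: "B \<in> carrier_mat n n" "upper_triangular B" "similar_mat A3 B" using Suc.IH[OF sb(4)] by blast
  obtain B0 where B0: "B0 \<in> carrier_mat 1 n"
    "similar_mat (four_block_mat A1 A2 (0\<^sub>m n 1) A3) (four_block_mat A1 B0 (0\<^sub>m n 1) B)"
    using similar_mat_four_block_0_ex[OF similar_mat_refl[OF sb(1)] B(3) sb(2) sb(1) sb(4)] by blast
  have "similar_mat A (four_block_mat A1 B0 (0\<^sub>m n 1) B)"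
    using similar_mat_trans[OF similar_mat_sym[OF simD]] B0(2) sb(5) A0 by simp
  moreover have "upper_triangular (four_block_mat A1 B0 (0\<^sub>m n 1) B)"
    by (rule upper_triangular_four_block[OF sb(1) B(1) _ B(2)]) (simp add: A1)
  moreover have "four_block_mat A1 B0 (0\<^sub>m n 1) B \<in> carrier_mat ?N ?N"
    using four_block_carrier_mat[OF sb(1) B(1), of B0 "0\<^sub>m n 1"] by simp
  ultimately show ?case by blast
qed

text \<open>Sorting merely fixes one order of the blocks; up to similarity the matrix depends on the
  multiset of sizes.\<close>

definition unipotent_jordan :: "nat multiset \<Rightarrow> 'a :: field mat" where
  "unipotent_jordan M = jordan_matrix (map (\<lambda>k. (k, 1)) (sorted_list_of_multiset M))"

lemma sum_list_jordan: "sum_list (map fst (map (\<lambda>k. (k, a)) (sorted_list_of_multiset M))) = sum_mset M"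
proof -
  have "map fst (map (\<lambda>k. (k, a)) (sorted_list_of_multiset M)) = sorted_list_of_multiset M"
    by (simp add: o_def)
  then show ?thesis by (metis mset_sorted_list_of_multiset sum_mset_sum_list)
qed

lemma unipotent_jordan_carrier: "unipotent_jordan M \<in> carrier_mat (sum_mset M) (sum_mset M)"
  unfolding unipotent_jordan_def using jordan_matrix_carrier[of "map (\<lambda>k. (k, 1)) (sorted_list_of_multiset M)"]
  by (simp only: sum_list_jordan)

lemma unipotent_mat_iff:
  assumes "s \<in> carrier_mat n n"
  shows "unipotent_mat s \<longleftrightarrow> (\<exists>k. (s - 1\<^sub>m n) ^\<^sub>m k = 0\<^sub>m n n)"
  using assms by (simp add: unipotent_mat_def)

lemma similar_mat_shift:
  fixes A B :: "'a :: comm_ring_1 mat"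
  assumes "similar_mat A B" "A \<in> carrier_mat n n"
  shows "similar_mat (A + c \<cdot>\<^sub>m 1\<^sub>m n) (B + c \<cdot>\<^sub>m 1\<^sub>m n)"
proof -
  obtain P Q where wit: "similar_mat_wit A B P Q" using assms by (auto simp: similar_mat_def)
  note w = similar_mat_witD2[OF assms(2) wit]
  have "P * (B + c \<cdot>\<^sub>m 1\<^sub>m n) * Q = P * B * Q + c \<cdot>\<^sub>m (P * Q)"
    using w by (simp add: mult_add_distrib_mat[of P n n _ n] add_mult_distrib_mat[of _ n n _ Q n]
        mult_smult_distrib[of P n n _ n] mult_smult_assoc_mat[of P n n Q n])
  then show ?thesis using w by (intro similar_matI[of _ _ P Q n]) auto
qed

text \<open>Triangularizing the nilpotent \<open>s - 1\<close> yields a Jordan form of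
  \<open>s\<close> over the base field. An eigenvalue \<open>a\<close> of \<open>s\<close> makes
  \<open>a - 1\<close> an eigenvalue of a nilpotent matrix, so every block belongs to
  \<open>1\<close>.\<close>

lemma unipotent_similar_jordan:
  fixes s :: "'a :: field mat"
  assumes s: "s \<in> carrier_mat n n" and "unipotent_mat s"
  shows "\<exists>M. 0 \<notin># M \<and> sum_mset M = n \<and> similar_mat s (unipotent_jordan M)"
proof -
  define N where "N = s - 1\<^sub>m n"
  have N: "N \<in> carrier_mat n n" unfolding N_def by (rule minus_carrier_mat) simp
  obtain k where k: "N ^\<^sub>m k = 0\<^sub>m n n" using assms unipotent_mat_iff[OF s] by (auto simp: N_def)
  obtain B where B: "B \<in> carrier_mat n n" "upper_triangular B" "similar_mat N B"
    using nilpotent_triangular[OF N k] by blast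
  have "s = N + 1 \<cdot>\<^sub>m 1\<^sub>m n" using s by (intro eq_matI) (auto simp: N_def)
  then have sim: "similar_mat s (B + 1 \<cdot>\<^sub>m 1\<^sub>m n)" using similar_mat_shift[OF B(3) N] by metis
  have "upper_triangular (B + 1 \<cdot>\<^sub>m 1\<^sub>m n)" using B by (auto simp: upper_triangular_def)
  then obtain js where "jordan_nf (B + 1 \<cdot>\<^sub>m 1\<^sub>m n) js"
    using triangular_to_jnf_vector[of "B + 1 \<cdot>\<^sub>m 1\<^sub>m n" n] B by auto
  then have js: "jordan_nf s js" using sim similar_mat_trans unfolding jordan_nf_def by blast
  have one: "a = 1" if "(m, a) \<in> set js" for m a
  proof -
    have "m \<noteq> 0" using js that by (force simp: jordan_nf_def)
    then have "poly (char_poly s) a = 0"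
      using that unfolding jordan_nf_char_poly[OF js] by (auto simp: poly_prod_list prod_list_zero_iff intro!: image_eqI[of _ _ "(m, a)"])
    then obtain v where v: "eigenvector s v a"
      using eigenvalue_root_char_poly[OF s] by (auto simp: eigenvalue_def)
    then have vc: "v \<in> carrier_vec n" "v \<noteq> 0\<^sub>v n" "s *\<^sub>v v = a \<cdot>\<^sub>v v" using s by (auto simp: eigenvector_def)
    have "N *\<^sub>v v = (a - 1) \<cdot>\<^sub>v v"
      unfolding N_def using s vc by (subst minus_mult_distrib_mat_vec[of _ n n]) (auto intro!: eq_vecI simp: algebra_simps)
    then have "eigenvector N v (a - 1)" using vc N by (simp add: eigenvector_def)
    from eigenvector_pow[OF N this, of k] have "(a - 1) ^ k \<cdot>\<^sub>v v = 0\<^sub>m n n *\<^sub>v v" unfolding k by simp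
    moreover have "0\<^sub>m n n *\<^sub>v v = 0\<^sub>v n" using vc by (intro eq_vecI) auto
    ultimately have "(a - 1) ^ k \<cdot>\<^sub>v v = 0\<^sub>v n" by simp
    moreover obtain i where "i < n" "v $ i \<noteq> 0" using vc by (metis carrier_vecD eq_vecI index_zero_vec)
    ultimately have "(a - 1) ^ k * v $ i = 0" using vc by (metis carrier_vecD index_smult_vec(1) index_zero_vec(1))
    then show "a = 1" using \<open>v $ i \<noteq> 0\<close> by simp
  qed
  define M where "M = mset (map fst js)"
  have "js = map (\<lambda>k. (k, 1)) (map fst js)" using one by (induction js) auto
  then have "mset js = mset (map (\<lambda>k. (k, 1)) (sorted_list_of_multiset M))"
    unfolding M_def by (metis mset_map mset_sorted_list_of_multiset)
  then have "similar_mat (jordan_matrix js) (unipotent_jordan M)"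
    unfolding unipotent_jordan_def by (rule similar_jordan_matrix_mset)
  then have sim: "similar_mat s (unipotent_jordan M)"
    using js similar_mat_trans unfolding jordan_nf_def by blast
  have "0 \<notin># M" using js unfolding jordan_nf_def M_def by (auto simp: image_iff)
  moreover have "sum_mset M = n"
  proof -
    obtain m where "{s, unipotent_jordan M} \<subseteq> carrier_mat m m" using similar_matD[OF sim] by blast
    then show ?thesis using s unipotent_jordan_carrier[of M] by (metis carrier_matD(1) insert_subset)
  qed
  ultimately show ?thesis using sim by blast
qed

text \<open>The number of blocks of each positive size is a function of the dimensions of the
  generalized eigenspaces. Blocks of size \<open>0\<close> leave no trace in these dimensions,
  whence the conditions on \<open>M\<close> and \<open>M'\<close>.\<close>

lemma unipotent_jordan_eq_if_dims_eq:
  assumes M: "0 \<notin># M" and M': "0 \<notin># M'"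
    and s: "similar_mat s (unipotent_jordan M :: 'a :: field mat)"
    and t: "similar_mat t (unipotent_jordan M' :: 'a mat)"
    and eq: "\<And>k. dim_gen_eigenspace s 1 k = dim_gen_eigenspace t 1 k"
  shows "M = M'"
proof (rule multiset_eqI)
  fix k
  have count: "count N k = compute_nr_of_jordan_blocks r 1 k"
    if "0 \<notin># N" "similar_mat r (unipotent_jordan N :: 'a mat)" "k \<noteq> 0" for N r
  proof -
    let ?l = "sorted_list_of_multiset N"
    have "jordan_nf r (map (\<lambda>k. (k, 1)) ?l)"
      using that unfolding jordan_nf_def unipotent_jordan_def by auto
    from compute_nr_of_jordan_blocks[OF this \<open>k \<noteq> 0\<close>, of 1]
    have "compute_nr_of_jordan_blocks r 1 k = length (filter ((=) (k, 1)) (map (\<lambda>k. (k, 1 :: 'a)) ?l))" .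
    also have "filter ((=) (k, 1)) (map (\<lambda>k. (k, 1 :: 'a)) ?l) = map (\<lambda>k. (k, 1)) (filter ((=) k) ?l)"
      by (simp add: filter_map o_def)
    also have "length \<dots> = count (mset ?l) k" by (simp only: length_map count_mset count_list_eq_length_filter)
    finally show ?thesis by simp
  qed
  show "count M k = count M' k"
  proof (cases "k = 0")
    case True
    then show ?thesis using M M' by (simp add: not_in_iff)
  next
    case False
    then show ?thesis using count[OF M s False] count[OF M' t False] eq
      by (simp add: compute_nr_of_jordan_blocks_def)
  qed
qed

text \<open>If \<open>T\<close> commutes with the commutant of a nilpotent \<open>N\<close>, then modulo the kernel of a lower power of \<open>N\<close>
  it acts as a scalar. The elements \<open>\<Sum>j<d. N^j E N^(d-1-j)\<close> of the commutant of \<open>N\<close>, where \<open>N^d = 0\<close>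
  and \<open>E\<close> is arbitrary, suffice to see this.\<close>

primrec commutant_sum :: "nat \<Rightarrow> 'a :: comm_ring_1 mat \<Rightarrow> 'a mat \<Rightarrow> nat \<Rightarrow> 'a mat" where
  "commutant_sum n N E 0 = 0\<^sub>m n n"
| "commutant_sum n N E (Suc m) = N * commutant_sum n N E m + E * N ^\<^sub>m m"

text \<open>Both sides are the sum belonging to \<open>m + 1\<close>, once with a factor
  \<open>N\<close> split off on the left and once on the right. If \<open>N^m = 0\<close>, what
  remains says that the sum commutes with \<open>N\<close>.\<close>

lemma commutant_sum:
  assumes N: "N \<in> carrier_mat n n" and E: "E \<in> carrier_mat n n"
  shows "commutant_sum n N E m \<in> carrier_mat n n"
    and "N * commutant_sum n N E m + E * N ^\<^sub>m m = commutant_sum n N E m * N + N ^\<^sub>m m * E"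
proof -
  show c: "commutant_sum n N E m \<in> carrier_mat n n" for m
    using N E by (induction m) simp_all
  show "N * commutant_sum n N E m + E * N ^\<^sub>m m = commutant_sum n N E m * N + N ^\<^sub>m m * E"
  proof (induction m)
    case 0
    then show ?case using N E by simp
  next
    case (Suc m)
    let ?C = "commutant_sum n N E m"
    have "N * commutant_sum n N E (Suc m) + E * N ^\<^sub>m Suc m =
        N * (N * ?C + E * N ^\<^sub>m m) + E * N ^\<^sub>m Suc m" by simp
    also have "\<dots> = N * (?C * N + N ^\<^sub>m m * E) + E * N ^\<^sub>m Suc m" unfolding Suc ..
    also have "\<dots> = (N * ?C * N + E * N ^\<^sub>m m * N) + N * N ^\<^sub>m m * E"
      using N E c[of m] by (simp add: mult_add_distrib_mat[of N n n _ n] square_mult_assoc[where n = n])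
        (subst (1 2) comm_add_mat[of _ n n], auto simp: assoc_add_mat[of _ n n])
    also have "\<dots> = (N * ?C + E * N ^\<^sub>m m) * N + N ^\<^sub>m Suc m * E"
      using N E c[of m] pow_mat_commute[OF N N refl, of m]
      by (simp add: add_mult_distrib_mat[of _ n n _ N n])
    finally show ?case by simp
  qed
qed

section \<open>Kernel filtrations seen from the commutant\<close>

lemma zero_mult_vec: "v \<in> carrier_vec n \<Longrightarrow> 0\<^sub>m n n *\<^sub>v v = (0\<^sub>v n :: 'a :: comm_ring_1 vec)"
  by (intro eq_vecI) auto

lemma mult_zero_vec: "A \<in> carrier_mat n n \<Longrightarrow> A *\<^sub>v 0\<^sub>v n = (0\<^sub>v n :: 'a :: comm_ring_1 vec)"
  by (intro eq_vecI) auto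

text \<open>\<open>T\<close> lowers the kernel filtration of \<open>N\<close> by one step. For a
  vector \<open>v\<close> killed by \<open>N^(k+1)\<close>, the commutant element \<open>C d\<close>
  sends a basis vector \<open>e\<close> to \<open>N x + c v\<close>, where \<open>c\<close> is the
  nonzero entry of \<open>N^(d-1)\<close>. Moving \<open>T\<close> past \<open>C d\<close> and
  applying \<open>N^k\<close> shows that \<open>T\<close> multiplies \<open>N^k v\<close> by
  \<open>c' / c\<close>. As \<open>T\<close> is nilpotent, this scalar is zero unless the vector
  is.\<close>

lemma commutant_kernel_drop:
  fixes N T :: "'a :: field mat"
  assumes N: "N \<in> carrier_mat n n" and T: "T \<in> carrier_mat n n"
    and d: "N ^\<^sub>m d = 0\<^sub>m n n" and a: "a < n" and b: "b < n" and c0: "(N ^\<^sub>m (d - 1)) $$ (a, b) \<noteq> 0"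
    and T_nil: "T ^\<^sub>m m = 0\<^sub>m n n"
    and comm: "\<And>A. A \<in> carrier_mat n n \<Longrightarrow> A * N = N * A \<Longrightarrow> A * T = T * A"
  shows "v \<in> carrier_vec n \<Longrightarrow> N ^\<^sub>m i *\<^sub>v v = 0\<^sub>v n \<Longrightarrow> N ^\<^sub>m (i - 1) *\<^sub>v (T *\<^sub>v v) = 0\<^sub>v n"
proof (induction i arbitrary: v)
  case 0
  then have "v = 0\<^sub>v n" using N by simp
  then show ?case using N T by (simp add: mult_zero_vec)
next
  case (Suc k)
  note v = Suc.prems(1) and v_kernel = Suc.prems(2)
  have d_pos: "d > 0"
  proof (rule ccontr)
    assume "\<not> d > 0"
    then have "1\<^sub>m n $$ (a, a) = (0\<^sub>m n n :: 'a mat) $$ (a, a)" using d N by simp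
    then show False using a by simp
  qed
  then obtain d' where d': "d = Suc d'" by (cases d) auto
  \<comment> \<open>Of rank at most one: \<open>E\<close> reads coordinate \<open>a\<close> and
    returns that multiple of \<open>v\<close>. All values of the sums built from it therefore lie in
    the kernel of \<open>N^(k+1)\<close>.\<close>
  define E where "E = mat n n (\<lambda>(i, j). if j = a then v $ i else 0)"
  have E: "E \<in> carrier_mat n n" by (simp add: E_def)
  have E_mult: "E *\<^sub>v w = w $ a \<cdot>\<^sub>v v" if w: "w \<in> carrier_vec n" for w
  proof (rule eq_vecI)
    fix i assume "i < dim_vec (w $ a \<cdot>\<^sub>v v)"
    then have i: "i < n" using v by simp
    have "(E *\<^sub>v w) $ i = (\<Sum>j\<in>{0..<n}. (if j = a then v $ i else 0) * w $ j)"
      using i w by (simp add: E_def scalar_prod_def)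
    also have "\<dots> = (\<Sum>j\<in>{0..<n}. if j = a then v $ i * w $ j else 0)" by (intro sum.cong) auto
    also have "\<dots> = (w $ a \<cdot>\<^sub>v v) $ i" using a i v by simp
    finally show "(E *\<^sub>v w) $ i = (w $ a \<cdot>\<^sub>v v) $ i" .
  qed (use v E in simp)
  define C where "C = commutant_sum n N E"
  have C: "C j \<in> carrier_mat n n" for j unfolding C_def by (rule commutant_sum(1)[OF N E])
  have "N * C d = C d * N"
    using commutant_sum(2)[OF N E, of d] N E C[of d] by (simp add: d C_def[symmetric])
  then have CT: "C d * T = T * C d" using comm[OF C] by simp
  have Nj: "N ^\<^sub>m j \<in> carrier_mat n n" for j using N by simp
  have C_step: "C (Suc j) *\<^sub>v w = N *\<^sub>v (C j *\<^sub>v w) + (N ^\<^sub>m j *\<^sub>v w) $ a \<cdot>\<^sub>v v" if w: "w \<in> carrier_vec n" for j w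
  proof -
    have "C (Suc j) *\<^sub>v w = (N * C j) *\<^sub>v w + (E * N ^\<^sub>m j) *\<^sub>v w"
      using C[of j] N E Nj[of j] w by (simp add: C_def add_mult_distrib_mat_vec[of _ n n])
    also have "\<dots> = N *\<^sub>v (C j *\<^sub>v w) + E *\<^sub>v (N ^\<^sub>m j *\<^sub>v w)"
      using assoc_mult_mat_vec[OF N C[of j] w] assoc_mult_mat_vec[OF E Nj[of j] w] by simp
    also have "E *\<^sub>v (N ^\<^sub>m j *\<^sub>v w) = (N ^\<^sub>m j *\<^sub>v w) $ a \<cdot>\<^sub>v v"
      by (rule E_mult) (use Nj[of j] w in simp)
    finally show ?thesis .
  qed
  have smult: "A *\<^sub>v (r \<cdot>\<^sub>v w) = r \<cdot>\<^sub>v (A *\<^sub>v w)" if "A \<in> carrier_mat n n" "w \<in> carrier_vec n" for A r and w :: "'a vec"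
    using that by (rule mult_mat_vec)
  have kernel: "N ^\<^sub>m Suc k *\<^sub>v (C j *\<^sub>v w) = 0\<^sub>v n" if w: "w \<in> carrier_vec n" for j w
  proof (induction j)
    case 0
    then show ?case using w N by (simp add: C_def zero_mult_vec mult_zero_vec del: pow_mat.simps)
  next
    case (Suc j)
    have x: "C j *\<^sub>v w \<in> carrier_vec n" using C[of j] w by simp
    have "N ^\<^sub>m Suc k *\<^sub>v (C (Suc j) *\<^sub>v w) = N ^\<^sub>m Suc k *\<^sub>v (N *\<^sub>v (C j *\<^sub>v w)) +
        (N ^\<^sub>m j *\<^sub>v w) $ a \<cdot>\<^sub>v (N ^\<^sub>m Suc k *\<^sub>v v)"
      unfolding C_step[OF w] using N x v Nj[of "Suc k"]
      by (subst mult_add_distrib_mat_vec[of _ n n]) (auto simp: smult simp del: pow_mat.simps)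
    also have "N ^\<^sub>m Suc k *\<^sub>v (N *\<^sub>v (C j *\<^sub>v w)) = N *\<^sub>v (N ^\<^sub>m Suc k *\<^sub>v (C j *\<^sub>v w))"
      using assoc_mult_mat_vec[OF Nj[of "Suc k"] N x] assoc_mult_mat_vec[OF N Nj[of "Suc k"] x]
        pow_mat_commute[OF N N refl, of "Suc k"] by simp
    also have "\<dots> = 0\<^sub>v n" unfolding Suc by (rule mult_zero_vec[OF N])
    also have "N ^\<^sub>m Suc k *\<^sub>v v = 0\<^sub>v n" by (rule v_kernel)
    finally show ?case by (auto intro!: eq_vecI)
  qed
  define e where "e = (unit_vec n b :: 'a vec)"
  have e: "e \<in> carrier_vec n" by (simp add: e_def)
  define c where "c = (N ^\<^sub>m d' *\<^sub>v e) $ a"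
  have c: "c \<noteq> 0"
  proof -
    have "c = row (N ^\<^sub>m d') a \<bullet> e" using N a by (simp add: c_def)
    also have "\<dots> = (N ^\<^sub>m d') $$ (a, b)"
      using N a b Nj[of d'] unfolding e_def by (subst scalar_prod_right_unit) auto
    finally show ?thesis using c0 by (simp add: d')
  qed
  define c' where "c' = (N ^\<^sub>m d' *\<^sub>v (T *\<^sub>v e)) $ a"
  have Te: "T *\<^sub>v e \<in> carrier_vec n" using T e by simp
  define x where "x = C d' *\<^sub>v e"
  define y where "y = C d' *\<^sub>v (T *\<^sub>v e)"
  have x: "x \<in> carrier_vec n" and y: "y \<in> carrier_vec n" using C[of d'] e Te by (simp_all add: x_def y_def)
  have Tv: "T *\<^sub>v v \<in> carrier_vec n" using T v by simp
  have Nx: "N *\<^sub>v x \<in> carrier_vec n" and Ny: "N *\<^sub>v y \<in> carrier_vec n" using N x y by simp_all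
  have "T *\<^sub>v (C d *\<^sub>v e) = C d *\<^sub>v (T *\<^sub>v e)"
    using assoc_mult_mat_vec[OF T C[of d] e] assoc_mult_mat_vec[OF C[of d] T e] CT by simp
  then have "T *\<^sub>v (N *\<^sub>v x + c \<cdot>\<^sub>v v) = N *\<^sub>v y + c' \<cdot>\<^sub>v v"
    unfolding d' C_step[OF e] C_step[OF Te] x_def[symmetric] y_def[symmetric] c_def[symmetric] c'_def[symmetric] .
  then have main: "T *\<^sub>v (N *\<^sub>v x) + c \<cdot>\<^sub>v (T *\<^sub>v v) = N *\<^sub>v y + c' \<cdot>\<^sub>v v"
    using mult_add_distrib_mat_vec[OF T Nx, of "c \<cdot>\<^sub>v v"] smult[OF T v] v by simp
  have shift: "N ^\<^sub>m k *\<^sub>v (N *\<^sub>v u) = N ^\<^sub>m Suc k *\<^sub>v u" if "u \<in> carrier_vec n" for u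
    using assoc_mult_mat_vec[OF Nj[of k] N that] by simp
  have Nk: "N ^\<^sub>m k *\<^sub>v (N *\<^sub>v x) = 0\<^sub>v n" "N ^\<^sub>m k *\<^sub>v (N *\<^sub>v y) = 0\<^sub>v n"
    using shift[OF x] shift[OF y] kernel[OF e, of d'] kernel[OF Te, of d'] by (simp_all add: x_def y_def)
  \<comment> \<open>\<open>N x\<close> lies in the kernel of \<open>N^k\<close>, so the induction
    hypothesis disposes of the unwanted term \<open>T (N x)\<close>.\<close>
  have "N ^\<^sub>m (k - 1) *\<^sub>v (T *\<^sub>v (N *\<^sub>v x)) = 0\<^sub>v n" by (rule Suc.IH[OF Nx Nk(1)])
  then have NkT: "N ^\<^sub>m k *\<^sub>v (T *\<^sub>v (N *\<^sub>v x)) = 0\<^sub>v n"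
  proof (cases k)
    case 0
    then have "N *\<^sub>v x = 0\<^sub>v n" using Nk(1) Nx N by simp
    then show ?thesis using mult_zero_vec[OF T] mult_zero_vec[OF Nj[of k]] by simp
  next
    case (Suc j)
    have TNx: "T *\<^sub>v (N *\<^sub>v x) \<in> carrier_vec n" using T Nx by simp
    have "N ^\<^sub>m Suc j = N * N ^\<^sub>m j" using pow_mat_commute[OF N N refl, of j] by simp
    then have "N ^\<^sub>m k *\<^sub>v (T *\<^sub>v (N *\<^sub>v x)) = N *\<^sub>v (N ^\<^sub>m j *\<^sub>v (T *\<^sub>v (N *\<^sub>v x)))"
      using assoc_mult_mat_vec[OF N Nj[of j] TNx] by (simp add: Suc)
    then show ?thesis using \<open>N ^\<^sub>m (k - 1) *\<^sub>v (T *\<^sub>v (N *\<^sub>v x)) = 0\<^sub>v n\<close> mult_zero_vec[OF N] by (simp add: Suc)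
  qed
  define w where "w = N ^\<^sub>m k *\<^sub>v v"
  have w: "w \<in> carrier_vec n" using Nj[of k] v by (simp add: w_def)
  have TNx: "T *\<^sub>v (N *\<^sub>v x) \<in> carrier_vec n" using T Nx by simp
  have "N ^\<^sub>m k *\<^sub>v (T *\<^sub>v (N *\<^sub>v x) + c \<cdot>\<^sub>v (T *\<^sub>v v)) = N ^\<^sub>m k *\<^sub>v (N *\<^sub>v y + c' \<cdot>\<^sub>v v)"
    by (simp only: main)
  then have "c \<cdot>\<^sub>v (N ^\<^sub>m k *\<^sub>v (T *\<^sub>v v)) = c' \<cdot>\<^sub>v w"
    using mult_add_distrib_mat_vec[OF Nj[of k] TNx, of "c \<cdot>\<^sub>v (T *\<^sub>v v)"]
      mult_add_distrib_mat_vec[OF Nj[of k] Ny, of "c' \<cdot>\<^sub>v v"] smult[OF Nj[of k] Tv] smult[OF Nj[of k] v] Tv v w Nj[of k]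
    by (simp add: NkT Nk w_def)
  moreover have TN: "T * N ^\<^sub>m k = N ^\<^sub>m k * T"
    using comm[OF Nj[of k]] pow_mat_commute[OF N N refl, of k] by simp
  have Tw: "T *\<^sub>v w = N ^\<^sub>m k *\<^sub>v (T *\<^sub>v v)"
    using assoc_mult_mat_vec[OF T Nj[of k] v] assoc_mult_mat_vec[OF Nj[of k] T v] TN by (simp add: w_def)
  ultimately have cw: "c \<cdot>\<^sub>v (T *\<^sub>v w) = c' \<cdot>\<^sub>v w" by simp
  have Tw_scalar: "T *\<^sub>v w = (c' / c) \<cdot>\<^sub>v w"
  proof -
    have "(1 / c) \<cdot>\<^sub>v (c \<cdot>\<^sub>v (T *\<^sub>v w)) = (1 / c) \<cdot>\<^sub>v (c' \<cdot>\<^sub>v w)" by (simp only: cw)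
    then show ?thesis using c by (simp add: smult_smult_assoc)
  qed
  have "w = 0\<^sub>v n \<or> c' / c = 0"
  proof (rule ccontr)
    assume "\<not> (w = 0\<^sub>v n \<or> c' / c = 0)"
    then have nz: "w \<noteq> 0\<^sub>v n" "c' / c \<noteq> 0" by auto
    then have "eigenvector T w (c' / c)" using w T Tw_scalar by (simp add: eigenvector_def)
    from eigenvector_pow[OF T this, of m] have "(c' / c) ^ m \<cdot>\<^sub>v w = 0\<^sub>v n"
      unfolding T_nil by (simp add: zero_mult_vec[OF w])
    then have z: "((c' / c) ^ m \<cdot>\<^sub>v w) $ i = (0\<^sub>v n :: 'a vec) $ i" for i by (simp only:)
    have "w = 0\<^sub>v n"
    proof (rule eq_vecI)
      fix i assume "i < dim_vec (0\<^sub>v n :: 'a vec)"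
      then have i: "i < n" by simp
      then have "(c' / c) ^ m * w $ i = 0" using z[of i] w by simp
      then show "w $ i = 0\<^sub>v n $ i" using i nz(2) by simp
    qed (use w in simp)
    then show False using nz(1) by simp
  qed
  then have "T *\<^sub>v w = 0\<^sub>v n"
  proof
    assume "w = 0\<^sub>v n"
    then show ?thesis by (simp add: mult_zero_vec[OF T])
  next
    assume "c' / c = 0"
    then show ?thesis using w unfolding Tw_scalar by (auto intro!: eq_vecI)
  qed
  then show ?case using Tw by simp
qed

text \<open>Every application of \<open>T\<close> uses up one power of \<open>N\<close>, so
  \<open>T^i\<close> kills whatever \<open>N^i\<close> kills. Minimality of \<open>d\<close>
  supplies the nonzero entry of \<open>N^(d-1)\<close>; for \<open>n = 0\<close> no such entry
  exists, which makes that case separate.\<close>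

lemma nilpotent_commutant_kernels:
  fixes N T :: "'a :: field mat"
  assumes N: "N \<in> carrier_mat n n" and T: "T \<in> carrier_mat n n"
    and N_nil: "N ^\<^sub>m l = 0\<^sub>m n n" and T_nil: "T ^\<^sub>m m = 0\<^sub>m n n"
    and comm: "\<And>A. A \<in> carrier_mat n n \<Longrightarrow> A * N = N * A \<Longrightarrow> A * T = T * A"
  shows "mat_kernel (N ^\<^sub>m i) \<subseteq> mat_kernel (T ^\<^sub>m i)"
proof (cases "n = 0")
  case True
  show ?thesis
    unfolding mat_kernel[OF pow_carrier_mat[OF N]] mat_kernel[OF pow_carrier_mat[OF T]]
  proof
    fix v assume "v \<in> {v \<in> carrier_vec n. N ^\<^sub>m i *\<^sub>v v = 0\<^sub>v n}"
    then have v: "v \<in> carrier_vec n" by simp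
    have "T ^\<^sub>m i *\<^sub>v v = 0\<^sub>v n" by (rule eq_vecI) (use True T in simp_all)
    then show "v \<in> {v \<in> carrier_vec n. T ^\<^sub>m i *\<^sub>v v = 0\<^sub>v n}" using v by simp
  qed
next
  case False
  define d where "d = (LEAST d. N ^\<^sub>m d = 0\<^sub>m n n)"
  have d: "N ^\<^sub>m d = 0\<^sub>m n n" unfolding d_def by (rule LeastI[of "\<lambda>d. N ^\<^sub>m d = 0\<^sub>m n n"]) (rule N_nil)
  have "N ^\<^sub>m 0 \<noteq> 0\<^sub>m n n"
  proof
    assume "N ^\<^sub>m 0 = 0\<^sub>m n n"
    then have "(1\<^sub>m n :: 'a mat) $$ (0, 0) = 0\<^sub>m n n $$ (0, 0)" using N by simp
    then show False using False by simp
  qed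
  then have "d \<noteq> 0" using d by (cases "d = 0") (simp_all only:, simp)
  then have "d - 1 < (LEAST d. N ^\<^sub>m d = 0\<^sub>m n n)" unfolding d_def[symmetric] by linarith
  then have d_least: "N ^\<^sub>m (d - 1) \<noteq> 0\<^sub>m n n" by (rule not_less_Least)
  have entries: "N ^\<^sub>m (d - 1) = 0\<^sub>m n n" if "\<forall>a<n. \<forall>b<n. (N ^\<^sub>m (d - 1)) $$ (a, b) = 0"
    using that N by (intro eq_matI) auto
  obtain a b where ab: "a < n" "b < n" "(N ^\<^sub>m (d - 1)) $$ (a, b) \<noteq> 0"
    using d_least entries by blast
  have drop: "N ^\<^sub>m (i - 1) *\<^sub>v (T *\<^sub>v v) = 0\<^sub>v n"
    if "v \<in> carrier_vec n" "N ^\<^sub>m i *\<^sub>v v = 0\<^sub>v n" for i v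
    by (rule commutant_kernel_drop[OF N T d ab T_nil _ that]) (rule comm)
  have "T ^\<^sub>m i *\<^sub>v v = 0\<^sub>v n" if "v \<in> carrier_vec n" "N ^\<^sub>m i *\<^sub>v v = 0\<^sub>v n" for i v
    using that
  proof (induction i arbitrary: v)
    case 0
    then show ?case using N T by simp
  next
    case (Suc i)
    have Tv: "T *\<^sub>v v \<in> carrier_vec n" using T Suc.prems by simp
    have "N ^\<^sub>m i *\<^sub>v (T *\<^sub>v v) = 0\<^sub>v n" using drop[OF Suc.prems] by simp
    then have "T ^\<^sub>m i *\<^sub>v (T *\<^sub>v v) = 0\<^sub>v n" by (rule Suc.IH[OF Tv])
    then show ?case using assoc_mult_mat_vec[OF pow_carrier_mat[OF T] T Suc.prems(1), of i] by simp
  qed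
  then show ?thesis
    unfolding mat_kernel[OF pow_carrier_mat[OF N]] mat_kernel[OF pow_carrier_mat[OF T]] by blast
qed

lemma kernel_dim_cong:
  fixes A B :: "'a :: field mat"
  assumes "A \<in> carrier_mat n n" "B \<in> carrier_mat n n" "mat_kernel A = mat_kernel B"
  shows "kernel_dim A = kernel_dim B"
proof -
  have "dim_col A = n" "dim_col B = n" using assms by auto
  then show ?thesis using assms(3) by (simp only: kernel_dim_def)
qed

text \<open>Equality of commutants is symmetric, so the inclusion of kernels holds in both
  directions: for each exponent, the powers of \<open>s - 1\<close> and \<open>t - 1\<close> have
  the same kernel.\<close>

lemma unipotent_commutant_dims:
  fixes s t :: "'a :: field mat"
  assumes s: "s \<in> carrier_mat n n" "unipotent_mat s" and t: "t \<in> carrier_mat n n" "unipotent_mat t"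
    and comm: "\<And>A. A \<in> carrier_mat n n \<Longrightarrow> A * s = s * A \<longleftrightarrow> A * t = t * A"
  shows "dim_gen_eigenspace s 1 k = dim_gen_eigenspace t 1 k"
proof -
  have commute: "A * (r - 1\<^sub>m n) = (r - 1\<^sub>m n) * A \<longleftrightarrow> A * r = r * A"
    if "A \<in> carrier_mat n n" "r \<in> carrier_mat n n" for A r :: "'a mat"
  proof -
    have e: "A * (r - 1\<^sub>m n) = A * r - A" "(r - 1\<^sub>m n) * A = r * A - A"
      using that mult_minus_distrib_mat[of A n n r n "1\<^sub>m n"] minus_mult_distrib_mat[of r n n "1\<^sub>m n" A n] by simp_all
    have c: "B - A + A = B" if "B \<in> carrier_mat n n" for B
      using that \<open>A \<in> carrier_mat n n\<close> by (intro eq_matI) auto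
    have "A * r = r * A" if h: "A * r - A = r * A - A"
    proof -
      have "A * r = A * r - A + A" by (rule c[symmetric]) (simp add: \<open>A \<in> _\<close> \<open>r \<in> _\<close>)
      also have "\<dots> = r * A - A + A" unfolding h ..
      also have "\<dots> = r * A" by (rule c) (simp add: \<open>A \<in> _\<close> \<open>r \<in> _\<close>)
      finally show ?thesis .
    qed
    moreover have "A * r = r * A \<Longrightarrow> A * r - A = r * A - A" by (simp only:)
    ultimately show ?thesis unfolding e by blast
  qed
  obtain l where l: "(s - 1\<^sub>m n) ^\<^sub>m l = 0\<^sub>m n n" using s(2) unfolding unipotent_mat_iff[OF s(1)] by blast
  obtain m where m: "(t - 1\<^sub>m n) ^\<^sub>m m = 0\<^sub>m n n" using t(2) unfolding unipotent_mat_iff[OF t(1)] by blast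
  have c: "s - 1\<^sub>m n \<in> carrier_mat n n" "t - 1\<^sub>m n \<in> carrier_mat n n" by (rule minus_carrier_mat, simp)+
  have kernels: "mat_kernel ((s - 1\<^sub>m n) ^\<^sub>m k) = mat_kernel ((t - 1\<^sub>m n) ^\<^sub>m k)"
  proof (rule equalityI)
    show "mat_kernel ((s - 1\<^sub>m n) ^\<^sub>m k) \<subseteq> mat_kernel ((t - 1\<^sub>m n) ^\<^sub>m k)"
    proof (rule nilpotent_commutant_kernels[OF c l m])
      fix A :: "'a mat" assume A: "A \<in> carrier_mat n n" "A * (s - 1\<^sub>m n) = (s - 1\<^sub>m n) * A"
      then have "A * s = s * A" using commute[OF A(1) s(1)] by blast
      then have "A * t = t * A" using comm[OF A(1)] by blast
      then show "A * (t - 1\<^sub>m n) = (t - 1\<^sub>m n) * A" using commute[OF A(1) t(1)] by blast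
    qed
    show "mat_kernel ((t - 1\<^sub>m n) ^\<^sub>m k) \<subseteq> mat_kernel ((s - 1\<^sub>m n) ^\<^sub>m k)"
    proof (rule nilpotent_commutant_kernels[OF c(2,1) m l])
      fix A :: "'a mat" assume A: "A \<in> carrier_mat n n" "A * (t - 1\<^sub>m n) = (t - 1\<^sub>m n) * A"
      then have "A * t = t * A" using commute[OF A(1) t(1)] by blast
      then have "A * s = s * A" using comm[OF A(1)] by blast
      then show "A * (s - 1\<^sub>m n) = (s - 1\<^sub>m n) * A" using commute[OF A(1) s(1)] by blast
    qed
  qed
  have char: "char_matrix r 1 = r - 1\<^sub>m n" if "r \<in> carrier_mat n n" for r :: "'a mat"
    using that unfolding char_matrix_def by (intro eq_matI) auto
  show ?thesis
    unfolding dim_gen_eigenspace_def char[OF s(1)] char[OF t(1)]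
    by (rule kernel_dim_cong[OF pow_carrier_mat[OF c(1)] pow_carrier_mat[OF c(2)] kernels])
qed

lemma unipotent_similar:
  fixes s t :: "'a :: field mat"
  assumes t: "t \<in> carrier_mat n n" "unipotent_mat t" and sim: "similar_mat s t"
  shows "unipotent_mat s"
proof -
  obtain m where "{s, t} \<subseteq> carrier_mat m m" using similar_matD[OF sim] by blast
  then have s: "s \<in> carrier_mat n n" using t(1) by (metis carrier_matD(1) insert_subset)
  obtain k where k: "(t - 1\<^sub>m n) ^\<^sub>m k = 0\<^sub>m n n" using t(2) unfolding unipotent_mat_iff[OF t(1)] by blast
  have shift: "r + (- 1) \<cdot>\<^sub>m 1\<^sub>m n = r - 1\<^sub>m n" if "r \<in> carrier_mat n n" for r :: "'a mat"
    using that by (intro eq_matI) auto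
  have "similar_mat (s - 1\<^sub>m n) (t - 1\<^sub>m n)"
    using similar_mat_shift[OF sim s, of "- 1"] unfolding shift[OF s] shift[OF t(1)] .
  then obtain P Q where wit: "similar_mat_wit (s - 1\<^sub>m n) (t - 1\<^sub>m n) P Q" by (auto simp: similar_mat_def)
  have c: "s - 1\<^sub>m n \<in> carrier_mat n n" by (rule minus_carrier_mat) simp
  have "(s - 1\<^sub>m n) ^\<^sub>m k = 0\<^sub>m n n"
    using similar_mat_wit_pow_id[OF wit, of k] similar_mat_witD2[OF c wit] by (simp add: k)
  then show ?thesis using unipotent_mat_iff[OF s] by blast
qed

lemma square_distrib:
  fixes A B C :: "'a :: ring mat"
  assumes "A \<in> carrier_mat n n" "B \<in> carrier_mat n n" "C \<in> carrier_mat n n"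
  shows "A * (B + C) = A * B + A * C" "(A + B) * C = A * C + B * C"
    "A * (B - C) = A * B - A * C" "(A - B) * C = A * C - B * C"
  using assms by (auto intro: mult_add_distrib_mat add_mult_distrib_mat mult_minus_distrib_mat minus_mult_distrib_mat)

lemma smult_mat_cancel:
  fixes A B :: "'a :: field mat"
  assumes "c \<noteq> 0" "c \<cdot>\<^sub>m A = c \<cdot>\<^sub>m B"
  shows "A = B"
proof (rule eq_matI)
  have d: "dim_row (c \<cdot>\<^sub>m A) = dim_row (c \<cdot>\<^sub>m B)" "dim_col (c \<cdot>\<^sub>m A) = dim_col (c \<cdot>\<^sub>m B)" by (simp_all only: assms(2))
  then show "dim_row A = dim_row B" "dim_col A = dim_col B" by simp_all
  fix i j assume ij: "i < dim_row B" "j < dim_col B"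
  have "(c \<cdot>\<^sub>m A) $$ (i, j) = (c \<cdot>\<^sub>m B) $$ (i, j)" by (simp only: assms(2))
  then show "A $$ (i, j) = B $$ (i, j)" using ij d assms(1) by simp
qed

section \<open>Unipotent group elements of every Jordan type\<close>

definition nilpotent_jordan :: "nat list \<Rightarrow> 'a :: field mat" where
  "nilpotent_jordan ks = jordan_matrix (map (\<lambda>k. (k, 0)) ks)"

lemma nilpotent_jordan_carrier: "nilpotent_jordan ks \<in> carrier_mat (sum_list ks) (sum_list ks)"
  using jordan_matrix_carrier[of "map (\<lambda>k. (k, 0)) ks"] by (simp add: nilpotent_jordan_def o_def)

lemma nilpotent_jordan_Cons:
  "nilpotent_jordan (k # ks) = four_block_mat (jordan_block k 0) (0\<^sub>m k (sum_list ks)) (0\<^sub>m (sum_list ks) k) (nilpotent_jordan ks)"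
  by (simp add: nilpotent_jordan_def jordan_matrix_Cons o_def)

lemma nilpotent_jordan_pow:
  "r \<ge> sum_list ks \<Longrightarrow> nilpotent_jordan ks ^\<^sub>m r = (0\<^sub>m (sum_list ks) (sum_list ks) :: 'a :: field mat)"
proof (induction ks)
  case Nil
  have "nilpotent_jordan [] ^\<^sub>m r \<in> (carrier_mat 0 0 :: 'a mat set)"
    by (rule pow_carrier_mat) (use nilpotent_jordan_carrier[of "[]"] in simp)
  then show ?case by (intro eq_matI) auto
next
  case (Cons k ks)
  let ?m = "sum_list ks"
  have "nilpotent_jordan (k # ks) ^\<^sub>m r = four_block_mat (jordan_block k 0 ^\<^sub>m r) (0\<^sub>m k ?m) (0\<^sub>m ?m k) (nilpotent_jordan ks ^\<^sub>m r)"
    unfolding nilpotent_jordan_Cons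
    by (rule pow_four_block_mat[OF jordan_block_carrier nilpotent_jordan_carrier])
  also have "(jordan_block k 0 ^\<^sub>m r :: 'a mat) = 0\<^sub>m k k"
    using Cons.prems by (intro eq_matI) (auto simp: jordan_block_zero_pow)
  also have "nilpotent_jordan ks ^\<^sub>m r = (0\<^sub>m ?m ?m :: 'a mat)" using Cons by simp
  finally show ?case by simp
qed

lemma unipotent_jordan_eq_shift:
  assumes "sum_mset M = n"
  shows "unipotent_jordan M = nilpotent_jordan (sorted_list_of_multiset M) + 1 \<cdot>\<^sub>m (1\<^sub>m n :: 'a :: field mat)"
proof -
  have shift: "jordan_matrix (map (\<lambda>k. (k, 1)) ks) = jordan_matrix (map (\<lambda>k. (k, 0)) ks) + 1 \<cdot>\<^sub>m (1\<^sub>m (sum_list ks) :: 'a mat)" for ks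
  proof (induction ks)
    case Nil
    show ?case by (intro eq_matI) (auto simp: jordan_matrix_def)
  next
    case (Cons k ks)
    let ?m = "sum_list ks"
    have fst_id: "map fst (map (\<lambda>k. (k, a :: 'a)) ks) = ks" for a by (simp add: o_def)
    have c: "jordan_matrix (map (\<lambda>k. (k, 0 :: 'a)) ks) \<in> carrier_mat ?m ?m"
      using jordan_matrix_carrier[of "map (\<lambda>k. (k, 0 :: 'a)) ks"] unfolding fst_id .
    show ?case
      unfolding list.map jordan_matrix_Cons fst_id Cons using c
      by (intro eq_matI) (auto simp: jordan_block_def)
  qed
  have "sum_list (sorted_list_of_multiset M) = n" using assms by (metis mset_sorted_list_of_multiset sum_mset_sum_list)
  then show ?thesis unfolding unipotent_jordan_def nilpotent_jordan_def shift by simp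
qed

lemma unipotent_mat_jordan:
  assumes "sum_mset M = n"
  shows "unipotent_mat (unipotent_jordan M :: 'a :: field mat)"
proof -
  let ?l = "sorted_list_of_multiset M"
  have sum: "sum_list ?l = n" using assms by (metis mset_sorted_list_of_multiset sum_mset_sum_list)
  have c: "nilpotent_jordan ?l \<in> carrier_mat n n" using nilpotent_jordan_carrier[of ?l] by (simp add: sum)
  have "unipotent_jordan M - 1\<^sub>m n = (nilpotent_jordan ?l :: 'a mat)"
    unfolding unipotent_jordan_eq_shift[OF assms] using c by (intro eq_matI) auto
  then have "(unipotent_jordan M - 1\<^sub>m n) ^\<^sub>m n = (0\<^sub>m n n :: 'a mat)"
    using nilpotent_jordan_pow[of ?l n, where 'a = 'a] by (simp add: sum)
  then show ?thesis
    using unipotent_mat_iff[of "unipotent_jordan M :: 'a mat" n] unipotent_jordan_carrier[of M] assms by blast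
qed

lemma one_plus_nilpotent_GL:
  fixes N :: "'a :: field mat"
  assumes N: "N \<in> carrier_mat n n" and "N ^\<^sub>m k = 0\<^sub>m n n"
  shows "1\<^sub>m n + N \<in> GL n"
proof -
  have "det (1\<^sub>m n + N) \<noteq> 0"
  proof
    assume "det (1\<^sub>m n + N) = 0"
    then obtain v where v: "v \<in> carrier_vec n" "v \<noteq> 0\<^sub>v n" "(1\<^sub>m n + N) *\<^sub>v v = 0\<^sub>v n"
      using det_0_iff_vec_prod_zero_field[of "1\<^sub>m n + N" n] N by auto
    have e: "v + N *\<^sub>v v = 0\<^sub>v n" using v N add_mult_distrib_mat_vec[of "1\<^sub>m n" n n N v] by simp
    have "N *\<^sub>v v = (- 1) \<cdot>\<^sub>v v"
    proof (rule eq_vecI)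
      fix i assume "i < dim_vec ((- 1) \<cdot>\<^sub>v v)"
      then have i: "i < n" using v by simp
      have "(v + N *\<^sub>v v) $ i = 0" using e i by simp
      then show "(N *\<^sub>v v) $ i = ((- 1) \<cdot>\<^sub>v v) $ i"
        using i v N by (simp add: add_eq_0_iff)
    qed (use N v in simp)
    then have "eigenvector N v (- 1)" using v N by (simp add: eigenvector_def)
    from eigenvector_pow[OF N this, of k] have "(- 1) ^ k \<cdot>\<^sub>v v = 0\<^sub>m n n *\<^sub>v v" unfolding assms(2) by simp
    then have z: "((- 1) ^ k \<cdot>\<^sub>v v) $ i = (0\<^sub>m n n *\<^sub>v v) $ i" for i by (simp only:)
    have "v = 0\<^sub>v n"
    proof (rule eq_vecI)
      fix i assume "i < dim_vec (0\<^sub>v n :: 'a vec)"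
      then have i: "i < n" by simp
      then have "(- 1) ^ k * v $ i = 0" using z[of i] v by simp
      then show "v $ i = 0\<^sub>v n $ i" using i by simp
    qed (use v in simp)
    then show False using v by simp
  qed
  then show ?thesis using N by (simp add: GL_iff_det)
qed

context ample_matrix_group
begin

text \<open>Elements are matched with partitions through similarity to
  \<open>unipotent_jordan M\<close>. Equivalent elements have equal commutants after conjugation and
  hence equal Jordan types; conversely similarity implies equivalence. The realization
  \<open>ex\<close> of all types is left to the individual group.\<close>

theorem num_unipotent_z_classes:
  assumes ex: "\<And>M. 0 \<notin># M \<Longrightarrow> sum_mset M = n \<Longrightarrow> \<exists>s\<in>carrier G. similar_mat s (unipotent_jordan M)"
  shows "num_z_classes G unipotent_mat = num_partitions n"
  unfolding num_z_classes_def num_partitions_def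
proof (rule card_quotient_eq_card[OF equiv_z_rel[OF group_G], where T = "\<lambda>s M. similar_mat s (unipotent_jordan M)"])
  fix s assume "s \<in> {x \<in> carrier G. unipotent_mat x}"
  then show "\<exists>M\<in>{M. 0 \<notin># M \<and> sum_mset M = n}. similar_mat s (unipotent_jordan M)"
    using unipotent_similar_jordan[of s n] G_carrier[of s] by blast
next
  fix M :: "nat multiset" assume M: "M \<in> {M. 0 \<notin># M \<and> sum_mset M = n}"
  then obtain s where s: "s \<in> carrier G" "similar_mat s (unipotent_jordan M)" using ex by blast
  have n: "sum_mset M = n" using M by simp
  have "unipotent_mat s"
    using unipotent_similar[OF unipotent_jordan_carrier unipotent_mat_jordan[OF n] s(2)] .
  then show "\<exists>s\<in>{x \<in> carrier G. unipotent_mat x}. similar_mat s (unipotent_jordan M)" using s by blast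
next
  fix s M s' M'
  assume s: "s \<in> {x \<in> carrier G. unipotent_mat x}" and s': "s' \<in> {x \<in> carrier G. unipotent_mat x}"
    and M: "M \<in> {M. 0 \<notin># M \<and> sum_mset M = n}" and M': "M' \<in> {M. 0 \<notin># M \<and> sum_mset M = n}"
    and sM: "similar_mat s (unipotent_jordan M)" and sM': "similar_mat s' (unipotent_jordan M')"
  have G: "s \<in> carrier G" "s' \<in> carrier G" and u: "unipotent_mat s" "unipotent_mat s'" using s s' by auto
  show "(s, s') \<in> z_rel G \<longleftrightarrow> M = M'"
  proof
    assume "M = M'"
    then have "similar_mat s s'" using sM similar_mat_trans[OF _ similar_mat_sym[OF sM']] by simp
    then show "(s, s') \<in> z_rel G" by (rule z_rel_if_similar[OF G])
  next
    assume "(s, s') \<in> z_rel G"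
    then obtain r where r: "r \<in> carrier G" "similar_mat s r"
      "\<And>A. A \<in> carrier_mat n n \<Longrightarrow> A * r = r * A \<longleftrightarrow> A * s' = s' * A"
      unfolding z_rel_iff_similar by blast
    have rM: "similar_mat r (unipotent_jordan M)" using similar_mat_trans[OF similar_mat_sym[OF r(2)] sM] .
    have "unipotent_mat r" using unipotent_similar[OF G_carrier[OF G(1)] u(1) similar_mat_sym[OF r(2)]] .
    then have dims: "dim_gen_eigenspace r 1 k = dim_gen_eigenspace s' 1 k" for k
      using unipotent_commutant_dims[OF G_carrier[OF r(1)] _ G_carrier[OF G(2)] u(2) r(3)] by blast
    show "M = M'"
      by (rule unipotent_jordan_eq_if_dims_eq[OF _ _ rM sM' dims]) (use M M' in auto)
  qed
qed (auto simp: subset_iff)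

end

lemma num_unipotent_z_classes_GL:
  assumes "(2 :: 'a :: {finite, field}) \<noteq> 0"
  shows "num_z_classes (general_linear_group TYPE('a) n) unipotent_mat = num_partitions n"
proof -
  interpret ample_matrix_group n "general_linear_group TYPE('a) n"
    by (rule ample_general_linear_group[OF assms])
  show ?thesis
  proof (rule num_unipotent_z_classes)
    fix M :: "nat multiset" assume n: "sum_mset M = n"
    let ?N = "nilpotent_jordan (sorted_list_of_multiset M) :: 'a mat"
    have sum: "sum_list (sorted_list_of_multiset M) = n" using n by (metis mset_sorted_list_of_multiset sum_mset_sum_list)
    have N: "?N \<in> carrier_mat n n" using nilpotent_jordan_carrier[of "sorted_list_of_multiset M"] by (simp add: sum)
    have pow: "?N ^\<^sub>m n = 0\<^sub>m n n" using nilpotent_jordan_pow[of "sorted_list_of_multiset M" n] by (simp add: sum)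
    have "unipotent_jordan M = 1\<^sub>m n + ?N"
      unfolding unipotent_jordan_eq_shift[OF n] using N by (intro eq_matI) auto
    then have "unipotent_jordan M \<in> (GL n :: 'a mat set)" using one_plus_nilpotent_GL[OF N pow] by simp
    then have "unipotent_jordan M \<in> carrier (general_linear_group TYPE('a) n)"
      by (simp add: general_linear_group_def units_of_def)
    moreover have "similar_mat (unipotent_jordan M :: 'a mat) (unipotent_jordan M)"
      by (rule similar_mat_refl[OF unipotent_jordan_carrier])
    ultimately show "\<exists>s\<in>carrier (general_linear_group TYPE('a) n). similar_mat s (unipotent_jordan M)" by blast
  qed
qed

context hermitian_space
begin

text \<open>An isometry from \<open>H\<close> to \<open>J\<close> conjugates one unitary group into
  the other, so an element may be built for whichever form suits it.\<close>

lemma similar_unitary_exists: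
  assumes H: "H \<in> GL n" "H\<^sup>T = bar_mat q H" and u: "u \<in> carrier_mat n n" "u\<^sup>T * H * bar_mat q u = H"
  shows "\<exists>s\<in>carrier (unitary_group q n J). similar_mat s u"
proof -
  obtain P where P: "P \<in> GL n" "P\<^sup>T * J * bar_mat q P = H" using hermitian_forms_equivalent[OF H] by blast
  obtain R where R: "P \<in> carrier_mat n n" "R \<in> carrier_mat n n" "P * R = 1\<^sub>m n" "R * P = 1\<^sub>m n"
    using P(1) by (rule GL_E)
  note c = R(1,2) u(1)
  define s where "s = P * u * R"
  have s: "s \<in> carrier_mat n n" using c by (simp add: s_def)
  have sim: "similar_mat s u" using R u s by (intro similar_matI[of _ _ P R n]) (auto simp: s_def)
  have sT: "s\<^sup>T = R\<^sup>T * (u\<^sup>T * P\<^sup>T)"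
    using c by (simp add: s_def square_transpose_mult[where n = n])
  have sbar: "bar_mat q s = bar_mat q P * bar_mat q u * bar_mat q R" using c by (simp add: s_def bar_mult)
  have RP: "R\<^sup>T * P\<^sup>T = 1\<^sub>m n" using square_transpose_mult[OF R(1,2)] by (simp add: R(3))
  have bPR: "bar_mat q P * bar_mat q R = 1\<^sub>m n" using bar_mult[OF R(1,2)] by (simp add: R(3) bar_one)
  have "s\<^sup>T * J * bar_mat q s = R\<^sup>T * (u\<^sup>T * (P\<^sup>T * J * bar_mat q P) * bar_mat q u) * bar_mat q R"
    using c unfolding sT sbar by (simp add: square_mult_assoc[where n = n])
  also have "\<dots> = R\<^sup>T * (P\<^sup>T * J * bar_mat q P) * bar_mat q R" unfolding P(2) u(2) ..
  also have "\<dots> = (R\<^sup>T * P\<^sup>T) * J * (bar_mat q P * bar_mat q R)"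
    using c by (simp add: square_mult_assoc[where n = n])
  also have "\<dots> = J" unfolding RP bPR by (simp add: square_mult_one[OF J_closed])
  finally have "s \<in> carrier (unitary_group q n J)" using unitary_iff[OF s] unitaryI[OF s] by simp
  then show ?thesis using sim by blast
qed

text \<open>The form pairs basis vectors \<open>i\<close> and \<open>k - 1 - i\<close> with
  alternating signs. Shifting one argument changes the sign compared with shifting the other, which
  is skewness of the nilpotent block.\<close>

lemma skew_hermitian_form_block:
  "\<exists>H\<in>GL k. H\<^sup>T = bar_mat q H \<and> (jordan_block k 0)\<^sup>T * H = - (H * jordan_block k (0 :: 'b))"
proof -
  \<comment> \<open>Transposition multiplies the alternating antidiagonal by
    \<open>(-1)^(k-1)\<close>. For even \<open>k\<close> a skew scalar compensates this sign and
    makes the form hermitian.\<close>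
  define c where "c = (if odd k then 1 else skew_scalar)"
  have c: "c \<noteq> 0" "c ^ q = (if odd k then c else - c)" by (auto simp: c_def skew_scalar)
  have minus_one: "((- 1) ^ i) ^ q = (- 1 :: 'b) ^ i" for i
  proof -
    have "(- 1 :: 'b) ^ q = - 1" using frob_uminus[of 1] by simp
    moreover have "((- 1) ^ i) ^ q = ((- 1 :: 'b) ^ q) ^ i"
      by (simp only: power_mult[symmetric] mult.commute[of i q])
    ultimately show ?thesis by simp
  qed
  define H where "H = mat k k (\<lambda>(i, j). if Suc (i + j) = k then (- 1) ^ i * c else 0)"
  define H' where "H' = mat k k (\<lambda>(i, j). if Suc (i + j) = k then (- 1) ^ j / c else 0)"
  have Hc: "H \<in> carrier_mat k k" "H' \<in> carrier_mat k k" by (simp_all add: H_def H'_def)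
  have "H * H' = 1\<^sub>m k"
  proof (rule eq_matI)
    fix i j assume "i < dim_row (1\<^sub>m k :: 'b mat)" "j < dim_col (1\<^sub>m k :: 'b mat)"
    then have ij: "i < k" "j < k" by auto
    have "(H * H') $$ (i, j) = (\<Sum>l\<in>{0..<k}. H $$ (i, l) * H' $$ (l, j))"
      using ij Hc by (simp add: scalar_prod_def)
    also have "\<dots> = (\<Sum>l\<in>{0..<k}. if l = k - 1 - i then H $$ (i, k - 1 - i) * H' $$ (k - 1 - i, j) else 0)"
      using ij by (intro sum.cong) (auto simp: H_def)
    also have "\<dots> = H $$ (i, k - 1 - i) * H' $$ (k - 1 - i, j)" using ij by simp
    also have "\<dots> = 1\<^sub>m k $$ (i, j)" using ij c by (auto simp: H_def H'_def simp flip: power_add)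
    finally show "(H * H') $$ (i, j) = 1\<^sub>m k $$ (i, j)" .
  qed (use Hc in auto)
  then have "H \<in> GL k" using Hc GL_I by blast
  moreover have "H\<^sup>T = bar_mat q H"
  proof (rule eq_matI)
    fix i j assume "i < dim_row (bar_mat q H)" "j < dim_col (bar_mat q H)"
    then have ij: "i < k" "j < k" by (auto simp: H_def bar_mat_def)
    show "H\<^sup>T $$ (i, j) = bar_mat q H $$ (i, j)"
    proof (cases "Suc (i + j) = k")
      case False
      then show ?thesis using ij q_pos by (simp add: H_def bar_mat_def add.commute)
    next
      case True
      have "bar_mat q H $$ (i, j) = (- 1) ^ i * c ^ q"
        using ij True by (simp add: H_def bar_mat_def power_mult_distrib minus_one)
      also have "\<dots> = (- 1) ^ j * c" using c(2) True by (auto simp: uminus_power_if split: if_splits)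
      also have "\<dots> = H\<^sup>T $$ (i, j)" using ij True by (simp add: H_def add.commute)
      finally show ?thesis by simp
    qed
  qed (auto simp: H_def bar_mat_def)
  moreover have "(jordan_block k 0)\<^sup>T * H = - (H * jordan_block k 0)"
  proof (rule eq_matI)
    fix i j assume "i < dim_row (- (H * jordan_block k 0))" "j < dim_col (- (H * jordan_block k 0))"
    then have ij: "i < k" "j < k" by (auto simp: H_def jordan_block_def)
    let ?N = "jordan_block k 0 :: 'b mat"
    have "(?N\<^sup>T * H) $$ (i, j) = (\<Sum>l\<in>{0..<k}. ?N $$ (l, i) * H $$ (l, j))"
      using ij Hc by (simp add: scalar_prod_def)
    also have "\<dots> = (\<Sum>l\<in>{0..<k}. if l = i - 1 then (if i = 0 then 0 else H $$ (i - 1, j)) else 0)"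
      using ij by (intro sum.cong) (auto simp: jordan_block_def)
    also have "\<dots> = (if i = 0 then 0 else H $$ (i - 1, j))" using ij by auto
    also have "\<dots> = - (if j = 0 then 0 else H $$ (i, j - 1))"
      using ij by (cases i; cases j) (auto simp: H_def)
    also have "(if j = 0 then 0 else H $$ (i, j - 1)) =
        (\<Sum>l\<in>{0..<k}. if l = j - 1 then (if j = 0 then 0 else H $$ (i, j - 1)) else 0)" using ij by auto
    also have "\<dots> = (\<Sum>l\<in>{0..<k}. H $$ (i, l) * ?N $$ (l, j))"
      using ij by (intro sum.cong) (auto simp: jordan_block_def)
    also have "\<dots> = (H * ?N) $$ (i, j)" using ij Hc by (simp add: scalar_prod_def)
    finally show "(?N\<^sup>T * H) $$ (i, j) = (- (H * ?N)) $$ (i, j)" using ij Hc by simp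
  qed (auto simp: H_def jordan_block_def)
  ultimately show ?thesis by blast
qed

lemma skew_hermitian_form:
  "\<exists>H\<in>GL (sum_list ks). H\<^sup>T = bar_mat q H \<and>
    (nilpotent_jordan ks)\<^sup>T * H = - (H * (nilpotent_jordan ks :: 'b mat))"
proof (induction ks)
  case Nil
  show ?case by (rule bexI[of _ "1\<^sub>m 0"]) (auto simp: bar_mat_def nilpotent_jordan_def jordan_matrix_def GL_iff intro!: bexI[of _ "1\<^sub>m 0"])
next
  case (Cons k ks)
  let ?m = "sum_list ks"
  let ?N1 = "jordan_block k 0 :: 'b mat" and ?N2 = "nilpotent_jordan ks :: 'b mat"
  obtain H2 where H2: "H2 \<in> GL ?m" "H2\<^sup>T = bar_mat q H2" "?N2\<^sup>T * H2 = - (H2 * ?N2)" using Cons by blast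
  obtain H1 where H1: "H1 \<in> GL k" "H1\<^sup>T = bar_mat q H1" "?N1\<^sup>T * H1 = - (H1 * ?N1)"
    using skew_hermitian_form_block by blast
  obtain B1 where B1: "H1 \<in> carrier_mat k k" "B1 \<in> carrier_mat k k" "H1 * B1 = 1\<^sub>m k" using H1(1) by (rule GL_E)
  obtain B2 where B2: "H2 \<in> carrier_mat ?m ?m" "B2 \<in> carrier_mat ?m ?m" "H2 * B2 = 1\<^sub>m ?m" using H2(1) by (rule GL_E)
  let ?blk = "\<lambda>A B. four_block_mat A (0\<^sub>m k ?m) (0\<^sub>m ?m k) B"
  have blk_mult: "?blk A B * ?blk C D = ?blk (A * C) (B * D)"
    if "A \<in> carrier_mat k k" "B \<in> carrier_mat ?m ?m" "C \<in> carrier_mat k k" "D \<in> carrier_mat ?m ?m" for A B C D :: "'b mat"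
    using that by (subst mult_four_block_mat[of _ k k _ ?m _ ?m _ _ k _ ?m])
      (auto intro!: cong_four_block_mat simp: left_add_zero_mat[of _ ?m ?m] right_add_zero_mat[of _ k k])
  have c: "?N1 \<in> carrier_mat k k" "?N2 \<in> carrier_mat ?m ?m" using nilpotent_jordan_carrier by auto
  have T: "(?blk A B)\<^sup>T = ?blk A\<^sup>T B\<^sup>T" if "A \<in> carrier_mat k k" "B \<in> carrier_mat ?m ?m" for A B :: "'b mat"
    using that transpose_four_block_mat[of A k k "0\<^sub>m k ?m" ?m "0\<^sub>m ?m k" ?m B] by simp
  have "?blk H1 H2 * ?blk B1 B2 = 1\<^sub>m (k + ?m)" using blk_mult[OF B1(1) B2(1) B1(2) B2(2)] B1 B2 by simp
  then have "?blk H1 H2 \<in> GL (k + ?m)" using B1 B2 GL_I[of "?blk H1 H2" "k + ?m" "?blk B1 B2"] by simp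
  moreover have "(?blk H1 H2)\<^sup>T = bar_mat q (?blk H1 H2)"
  proof -
    have "bar_mat q (?blk H1 H2) = ?blk (bar_mat q H1) (bar_mat q H2)"
      using B1 B2 q_pos unfolding bar_mat_def by (intro eq_matI) auto
    then show ?thesis using T[OF B1(1) B2(1)] H1 H2 by simp
  qed
  moreover have "(?blk ?N1 ?N2)\<^sup>T * ?blk H1 H2 = - (?blk H1 H2 * ?blk ?N1 ?N2)"
  proof -
    have "(?blk ?N1 ?N2)\<^sup>T * ?blk H1 H2 = ?blk (- (H1 * ?N1)) (- (H2 * ?N2))"
      using T[OF c] blk_mult[of "?N1\<^sup>T" "?N2\<^sup>T" H1 H2] c B1 B2 H1 H2 by simp
    also have "\<dots> = - ?blk (H1 * ?N1) (H2 * ?N2)" using c B1 B2 by (intro eq_matI) auto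
    finally show ?thesis using blk_mult[of H1 H2 ?N1 ?N2] c B1 B2 by simp
  qed
  ultimately show ?case unfolding nilpotent_jordan_Cons by (auto simp del: four_block_one_mat)
qed

text \<open>The Cayley transform of a nilpotent skew-adjoint \<open>N\<close> is unipotent and has the commutant of \<open>N\<close>.\<close>

lemma unipotent_unitary_exists:
  assumes M: "0 \<notin># M" "sum_mset M = n"
  shows "\<exists>s\<in>carrier (unitary_group q n J). similar_mat s (unipotent_jordan M)"
proof -
  let ?l = "sorted_list_of_multiset M"
  define N where "N = (nilpotent_jordan ?l :: 'b mat)"
  have sum: "sum_list ?l = n" using M by (metis mset_sorted_list_of_multiset sum_mset_sum_list)
  have N: "N \<in> carrier_mat n n" using nilpotent_jordan_carrier[of ?l] by (simp add: sum N_def)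
  have N_nil: "N ^\<^sub>m n = 0\<^sub>m n n" using nilpotent_jordan_pow[of ?l n] by (simp add: sum N_def)
  obtain H where H: "H \<in> GL n" "H\<^sup>T = bar_mat q H" "N\<^sup>T * H = - (H * N)"
    using skew_hermitian_form[of ?l] by (auto simp: sum N_def)
  have Hc: "H \<in> carrier_mat n n" using H(1) by (rule GL_carrier)
  define t where "t = (1\<^sub>m n + N)"
  define r where "r = (1\<^sub>m n - N)"
  have t: "t \<in> carrier_mat n n" and r: "r \<in> carrier_mat n n" using N by (auto simp: t_def r_def)
  have t_eq: "t = unipotent_jordan M"
    unfolding unipotent_jordan_eq_shift[OF M(2)] t_def N_def[symmetric] using N by (intro eq_matI) auto
  obtain D where D: "D \<in> carrier_mat n n" "t * D = 1\<^sub>m n" "D * t = 1\<^sub>m n"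
    using one_plus_nilpotent_GL[OF N N_nil] unfolding t_def[symmetric] by (rule GL_E)
  \<comment> \<open>The entries of \<open>N\<close> are \<open>0\<close> and \<open>1\<close>, so
    the involution fixes \<open>N\<close>, \<open>t\<close>, \<open>r\<close> and \<open>D\<close>,
    and unitarity of \<open>u\<close> follows from skewness of \<open>N\<close> with respect to
    \<open>H\<close>.\<close>
  have bar01: "bar_mat q A = A" if "\<And>i j. i < dim_row A \<Longrightarrow> j < dim_col A \<Longrightarrow> A $$ (i, j) \<in> {0, 1}" for A :: "'b mat"
  proof (rule eq_matI)
    fix i j assume ij: "i < dim_row A" "j < dim_col A"
    have "A $$ (i, j) = 0 \<or> A $$ (i, j) = 1" using that[OF ij] by simp
    then show "bar_mat q A $$ (i, j) = A $$ (i, j)" using ij q_pos by (elim disjE) (simp_all add: bar_mat_def)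
  qed (simp_all add: bar_mat_def)
  have N01: "nilpotent_jordan ks $$ (i, j) \<in> {0, 1 :: 'b}" if "i < sum_list ks" "j < sum_list ks" for ks i j
    using that
  proof (induction ks arbitrary: i j)
    case (Cons k ks)
    then show ?case using nilpotent_jordan_carrier[of ks, where 'a = 'b]
      unfolding nilpotent_jordan_Cons by (subst index_mat_four_block) (auto simp: jordan_block_def)
  qed simp
  have bN: "bar_mat q N = N" by (rule bar01) (use N01[of _ ?l] N in \<open>auto simp: sum N_def\<close>)
  have bt: "bar_mat q t = t" using N bar_add[of "1\<^sub>m n" N] by (simp add: t_def bN bar_one)
  have br: "bar_mat q r = r"
  proof -
    have "bar_mat q r = bar_mat q (1\<^sub>m n) - bar_mat q N"
      using N unfolding r_def bar_mat_def by (intro eq_matI) (auto simp: frob_diff)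
    then show ?thesis by (simp add: bar_one bN r_def)
  qed
  have bD: "bar_mat q D = D"
  proof -
    have "bar_mat q D * t = 1\<^sub>m n" using bar_mult[OF D(1) t] by (simp add: D bt bar_one)
    then have "bar_mat q D * t * D = D" using D by simp
    then have "bar_mat q D * (t * D) = D" using D t by (simp add: square_mult_assoc[where n = n])
    then show ?thesis unfolding D(2) using D(1) by (simp add: square_mult_one(2)[where n = n])
  qed
  have tr: "t * r = r * t"
  proof -
    have "t * r = t - t * N" using t N by (simp add: r_def square_distrib[where n = n])
    also have "t * N = N * t" using N by (simp add: t_def square_distrib[where n = n])
    also have "t - N * t = r * t" using t N by (simp add: r_def square_distrib[where n = n])
    finally show ?thesis .
  qed
  have NH: "N\<^sup>T * H \<in> carrier_mat n n" using N Hc by simp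
  have tH: "t\<^sup>T * H = H * r"
  proof -
    have "t\<^sup>T * H = H + N\<^sup>T * H"
      using N Hc by (simp add: t_def transpose_add[of _ n n] square_distrib[where n = n])
    also have "\<dots> = H - H * N" unfolding H(3) using N Hc by (intro eq_matI) auto
    also have "\<dots> = H * r" using N Hc by (simp add: r_def square_distrib[where n = n])
    finally show ?thesis .
  qed
  have rH: "r\<^sup>T * H = H * t"
  proof -
    have "r\<^sup>T * H = H - N\<^sup>T * H"
      using N Hc by (simp add: r_def transpose_minus[of _ n n] square_distrib[where n = n])
    also have "\<dots> = H + H * N" unfolding H(3) using N Hc by (intro eq_matI) auto
    also have "\<dots> = H * t" using N Hc by (simp add: t_def square_distrib[where n = n])
    finally show ?thesis .
  qed
  define u where "u = r * D"
  have u: "u \<in> carrier_mat n n" using r D by (simp add: u_def)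
  have DH: "D\<^sup>T * H * r = H"
  proof -
    have "D\<^sup>T * H * r = D\<^sup>T * (t\<^sup>T * H)" unfolding tH using D Hc r by (simp add: square_mult_assoc[where n = n])
    also have "\<dots> = (t * D)\<^sup>T * H" using D(1) t Hc by (simp add: square_transpose_mult[where n = n] square_mult_assoc[where n = n])
    finally show ?thesis using D Hc by (simp add: square_mult_one[where n = n])
  qed
  have "u\<^sup>T * H * bar_mat q u = D\<^sup>T * (r\<^sup>T * H) * (r * D)"
    using r D Hc by (simp add: u_def bar_mult br bD square_transpose_mult[where n = n] square_mult_assoc[where n = n])
  also have "\<dots> = D\<^sup>T * H * (t * r) * D" unfolding rH using r D Hc t by (simp add: square_mult_assoc[where n = n])
  also have "\<dots> = (D\<^sup>T * H * r) * (t * D)" unfolding tr using r D Hc t by (simp add: square_mult_assoc[where n = n])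
  also have "\<dots> = H" unfolding DH D(2) using Hc by (simp add: square_mult_one[where n = n])
  finally obtain s where s: "s \<in> carrier (unitary_group q n J)" "similar_mat s u"
    using similar_unitary_exists[OF H(1,2) u] by blast
  have ut: "u * t = r" using r D t by (simp add: u_def square_mult_assoc[where n = n] square_mult_one(2)[where n = n])
  \<comment> \<open>This recovers \<open>D\<close>, and with it \<open>t\<close>, from
    \<open>u\<close> after division by \<open>2\<close>; equality of the commutants of
    \<open>u\<close> and \<open>t\<close> rests on it.\<close>
  have u1: "u + 1\<^sub>m n = 2 \<cdot>\<^sub>m D"
  proof -
    have "u + 1\<^sub>m n = r * D + t * D" by (simp add: u_def D)
    also have "\<dots> = (r + t) * D" using r t D by (simp add: square_distrib[where n = n])
    also have "r + t = 2 \<cdot>\<^sub>m 1\<^sub>m n" using N by (intro eq_matI) (auto simp: r_def t_def)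
    also have "\<dots> * D = 2 \<cdot>\<^sub>m D" using D by (simp add: smult_one_mult)
    finally show ?thesis .
  qed
  have u_minus: "u - 1\<^sub>m n = - 2 \<cdot>\<^sub>m (N * D)"
  proof -
    have "u - 1\<^sub>m n = r * D - t * D" by (simp add: u_def D)
    also have "\<dots> = (r - t) * D" using r t D by (simp add: square_distrib[where n = n])
    also have "r - t = - 2 \<cdot>\<^sub>m N" using N by (intro eq_matI) (auto simp: r_def t_def)
    also have "\<dots> * D = - 2 \<cdot>\<^sub>m (N * D)" using D N by (simp add: mult_smult_assoc_mat[of _ n n])
    finally show ?thesis .
  qed
  have ND: "N * D = D * N"
  proof -
    have tN: "t * N = N * t" using N by (simp add: t_def square_distrib[where n = n])
    have "N * D = D * (t * N) * D" using D t N by (simp add: square_mult_one[where n = n] flip: square_mult_assoc[where n = n])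
    also have "\<dots> = D * N * (t * D)" unfolding tN using D t N by (simp add: square_mult_assoc[where n = n])
    finally show ?thesis using D N by (simp add: square_mult_one(2)[where n = n])
  qed
  have "unipotent_mat u"
  proof -
    have pow: "(- 2 \<cdot>\<^sub>m (N * D)) ^\<^sub>m k = (- 2) ^ k \<cdot>\<^sub>m (N ^\<^sub>m k * D ^\<^sub>m k)" for k
    proof (induction k)
      case 0
      show ?case using N D by (intro eq_matI) auto
    next
      case (Suc k)
      have Nk: "N ^\<^sub>m k \<in> carrier_mat n n" and Dk: "D ^\<^sub>m k \<in> carrier_mat n n" using N D by simp_all
      have "(- 2 \<cdot>\<^sub>m (N * D)) ^\<^sub>m Suc k = (- 2) ^ k \<cdot>\<^sub>m (N ^\<^sub>m k * D ^\<^sub>m k) * (- 2 \<cdot>\<^sub>m (N * D))" using Suc by simp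
      also have "\<dots> = ((- 2) ^ k * (- 2)) \<cdot>\<^sub>m ((N ^\<^sub>m k * D ^\<^sub>m k) * (N * D))"
        using N D Nk Dk by (subst mult_smult_assoc_mat[of _ n n _ n], simp_all, subst mult_smult_distrib[of _ n n _ n])
          (auto intro!: eq_matI)
      also have "(N ^\<^sub>m k * D ^\<^sub>m k) * (N * D) = N ^\<^sub>m k * (D ^\<^sub>m k * N) * D"
        using N D Nk Dk by (simp add: square_mult_assoc[where n = n])
      also have "D ^\<^sub>m k * N = N * D ^\<^sub>m k" by (rule pow_mat_commute[OF D(1) N ND[symmetric]])
      also have "N ^\<^sub>m k * (N * D ^\<^sub>m k) * D = N ^\<^sub>m Suc k * D ^\<^sub>m Suc k"
        using N D Nk Dk by (simp add: square_mult_assoc[where n = n])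
      finally show ?case by (simp add: mult.commute)
    qed
    have "(u - 1\<^sub>m n) ^\<^sub>m n = 0\<^sub>m n n" unfolding u_minus pow N_nil using D by (intro eq_matI) auto
    then show ?thesis using unipotent_mat_iff[OF u] by blast
  qed
  moreover have "unipotent_mat t" unfolding t_eq by (rule unipotent_mat_jordan[OF M(2)])
  moreover have "A * u = u * A \<longleftrightarrow> A * t = t * A" if A: "A \<in> carrier_mat n n" for A
  proof
    assume Au: "A * u = u * A"
    have "A * (u + 1\<^sub>m n) = (u + 1\<^sub>m n) * A"
      using A u Au by (simp add: square_distrib[where n = n])
    then have "2 \<cdot>\<^sub>m (A * D) = 2 \<cdot>\<^sub>m (D * A)"
      unfolding u1 using A D by (simp add: mult_smult_distrib[of _ n n] mult_smult_assoc_mat[of _ n n])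
    then have AD: "A * D = D * A" by (rule smult_mat_cancel[OF two])
    have "t * (A * D) * t = t * (D * A) * t" by (simp only: AD)
    then have "t * A * (D * t) = (t * D) * A * t" using A D(1) t by (simp add: square_mult_assoc[where n = n])
    then show "A * t = t * A" unfolding D(2,3) using A t by (simp add: square_mult_one[where n = n])
  next
    assume At: "A * t = t * A"
    have "D * (A * t) * D = D * (t * A) * D" by (simp only: At)
    then have "D * A * (t * D) = (D * t) * A * D" using A D(1) t by (simp add: square_mult_assoc[where n = n])
    then have AD: "A * D = D * A" unfolding D(2,3) using A D by (simp add: square_mult_one[where n = n])
    have r2: "r = 2 \<cdot>\<^sub>m 1\<^sub>m n - t" using N by (intro eq_matI) (auto simp: r_def t_def)
    have Ar: "A * r = r * A"
      unfolding r2 using A t At smult_one_commute[OF A, of 2]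
      by (simp add: square_distrib[where n = n])
    have "A * u = (A * r) * D" using A r D by (simp add: u_def square_mult_assoc[where n = n])
    also have "\<dots> = r * (A * D)" unfolding Ar using A r D by (simp add: square_mult_assoc[where n = n])
    also have "\<dots> = u * A" unfolding AD using A r D by (simp add: u_def square_mult_assoc[where n = n])
    finally show "A * u = u * A" .
  qed
  \<comment> \<open>The Jordan form of \<open>u\<close> is not computed: a unipotent matrix with the
    same commutant as \<open>t\<close> has the Jordan type of \<open>t\<close>.\<close>
  ultimately have dims: "dim_gen_eigenspace u 1 k = dim_gen_eigenspace t 1 k" for k
    using unipotent_commutant_dims[OF u _ t] by blast
  obtain M' where M': "0 \<notin># M'" "similar_mat u (unipotent_jordan M')"
    using unipotent_similar_jordan[OF u \<open>unipotent_mat u\<close>] by blast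
  have "similar_mat t (unipotent_jordan M)" unfolding t_eq by (rule similar_mat_refl[OF unipotent_jordan_carrier])
  then have "M' = M" by (rule unipotent_jordan_eq_if_dims_eq[OF M'(1) M(1) M'(2) _ dims])
  then show ?thesis using s similar_mat_trans[OF s(2) M'(2)] by blast
qed

lemma num_unipotent_z_classes_unitary:
  "num_z_classes (unitary_group q n J) unipotent_mat = num_partitions n"
  by (rule unitary.num_unipotent_z_classes) (rule unipotent_unitary_exists)

end

section \<open>Descent from the algebraic closure\<close>

global_interpretation to_ac: inj_comm_ring_hom to_ac
  by unfold_locales simp_all

abbreviation ac_mat :: "'a :: field mat \<Rightarrow> 'a alg_closure mat" where
  "ac_mat \<equiv> map_mat to_ac"

lemma ac_mat_mult:
  "A \<in> carrier_mat n n \<Longrightarrow> B \<in> carrier_mat n n \<Longrightarrow> ac_mat (A * B) = ac_mat A * ac_mat B"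
  by (rule to_ac.mat_hom_mult)

lemma ac_mat_eq_iff: "ac_mat A = ac_mat B \<longleftrightarrow> A = B"
  by (auto simp: mat_eq_iff)

lemma ac_mat_GL_iff: "ac_mat A \<in> GL n \<longleftrightarrow> A \<in> GL n"
  by (auto simp: GL_iff_det)

text \<open>\<open>X^Q - X\<close> has at most \<open>Q\<close> roots in the closure, and the
  \<open>Q\<close> elements of the base field are already that many.\<close>

lemma range_to_ac_iff:
  "x \<in> range (to_ac :: 'a :: {finite, field} \<Rightarrow> _) \<longleftrightarrow> x ^ card (UNIV :: 'a set) = x"
proof -
  let ?Q = "card (UNIV :: 'a set)"
  have Q: "?Q \<ge> 2"
  proof -
    have "card {0, 1 :: 'a} \<le> ?Q" by (rule card_mono) auto
    then show ?thesis by simp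
  qed
  define f :: "'a alg_closure poly" where "f = monom 1 ?Q - monom 1 1"
  have deg: "degree f = ?Q"
    using Q degree_add_eq_left[of "- monom 1 1 :: 'a alg_closure poly" "monom 1 ?Q"]
    by (simp add: f_def degree_monom_eq)
  then have f0: "f \<noteq> 0" using Q by auto
  have roots: "{x. poly f x = 0} = {x. x ^ ?Q = x}" by (simp add: f_def poly_monom)
  have "range (to_ac :: 'a \<Rightarrow> _) = {x. poly f x = 0}"
  proof (rule card_subset_eq)
    show "finite {x. poly f x = 0}" by (rule poly_roots_finite[OF f0])
    show sub: "range (to_ac :: 'a \<Rightarrow> _) \<subseteq> {x. poly f x = 0}"
      unfolding roots by (auto simp: power_card_UNIV simp del: to_ac_power to_ac.hom_power simp flip: to_ac_power)
    have "card (range (to_ac :: 'a \<Rightarrow> _)) = ?Q" by (simp add: card_image inj_to_ac)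
    moreover have "card {x. poly f x = 0} \<le> ?Q" using card_poly_roots_bound[OF f0] by (simp add: deg)
    ultimately show "card (range (to_ac :: 'a \<Rightarrow> _)) = card {x. poly f x = 0}"
      using card_mono[OF poly_roots_finite[OF f0] sub] by simp
  qed
  then show ?thesis unfolding roots by blast
qed

lemma ac_mat_lift:
  fixes A :: "'a :: {finite, field} alg_closure mat"
  assumes "A \<in> carrier_mat n n" "map_mat (\<lambda>x. x ^ card (UNIV :: 'a set)) A = A"
  obtains B :: "'a mat" where "B \<in> carrier_mat n n" "A = ac_mat B"
proof
  have "A $$ (i, j) \<in> range (to_ac :: 'a \<Rightarrow> _)" if "i < n" "j < n" for i j
    unfolding range_to_ac_iff using arg_cong[OF assms(2), of "\<lambda>M. M $$ (i, j)"] assms(1) that by simp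
  then show "A = ac_mat (map_mat of_ac A)"
    using assms(1) by (intro eq_matI) (auto simp: to_ac_of_ac)
  show "map_mat of_ac A \<in> carrier_mat n n" using assms(1) by simp
qed

section \<open>Intertwiners over the closure and over the base field\<close>

lemma square_mult_eq_iff:
  fixes A :: "'a :: semiring_0 mat"
  assumes "A \<in> carrier_mat n n" "B \<in> carrier_mat n n" "C \<in> carrier_mat n n" "D \<in> carrier_mat n n"
  shows "A * B = C * D \<longleftrightarrow> (\<forall>i<n. \<forall>j<n. (\<Sum>k<n. A $$ (i, k) * B $$ (k, j)) = (\<Sum>k<n. C $$ (i, k) * D $$ (k, j)))"
  using assms by (auto simp: mat_eq_iff scalar_prod_def atLeast0LessThan)

text \<open>
  Coordinates with respect to a basis of the closure over the base field turn an intertwiner over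
  the closure into finitely many intertwiners over the base field.
\<close>

lemma intertwiner_coordinates:
  fixes W :: "'a :: field alg_closure mat"
  assumes W: "W \<in> carrier_mat n n"
  obtains T and c :: "'a alg_closure \<Rightarrow> 'a mat" where "finite T" "\<And>b. c b \<in> carrier_mat n n"
    "W = mat n n (\<lambda>(i, j). \<Sum>b\<in>T. b * to_ac (c b $$ (i, j)))"
    "\<And>s t b. s \<in> carrier_mat n n \<Longrightarrow> t \<in> carrier_mat n n \<Longrightarrow> W * ac_mat s = ac_mat t * W \<Longrightarrow>
      c b * s = t * c b"
proof -
  interpret V: vector_space "\<lambda>(a :: 'a) x. to_ac a * x"
    by unfold_locales (auto simp: algebra_simps)
  define B where "B = V.extend_basis {}"
  have B: "V.independent B" "V.span B = UNIV"
    unfolding B_def using V.independent_extend_basis[of "{}"] V.span_extend_basis[of "{}"]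
    by (simp_all add: V.independent_empty)
  let ?r = "V.representation B"
  note rep = V.representation_sum[OF B(1)] V.representation_scale[OF B(1)]
  define T where "T = (\<Union>i\<in>{..<n}. \<Union>j\<in>{..<n}. {b. ?r (W $$ (i, j)) b \<noteq> 0})"
  define c where "c b = mat n n (\<lambda>(i, j). ?r (W $$ (i, j)) b)" for b
  show thesis
  proof
    show T: "finite T" unfolding T_def by (simp add: V.finite_representation)
    show c_carrier: "c b \<in> carrier_mat n n" for b by (simp add: c_def)
    show "W = mat n n (\<lambda>(i, j). \<Sum>b\<in>T. b * to_ac (c b $$ (i, j)))"
    proof (rule eq_matI; (use W in simp)?)
      fix i j assume ij: "i < n" "j < n"
      have "W $$ (i, j) = (\<Sum>b | ?r (W $$ (i, j)) b \<noteq> 0. to_ac (?r (W $$ (i, j)) b) * b)"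
        by (rule V.sum_nonzero_representation_eq[symmetric]) (simp_all add: B)
      also have "\<dots> = (\<Sum>b\<in>T. to_ac (?r (W $$ (i, j)) b) * b)"
        using ij T by (intro sum.mono_neutral_left) (auto simp: T_def)
      finally show "W $$ (i, j) = (\<Sum>b\<in>T. b * to_ac (c b $$ (i, j)))"
        using ij by (simp add: c_def mult.commute)
    qed
    fix s t b assume s: "s \<in> carrier_mat n n" and t: "t \<in> carrier_mat n n" and e: "W * ac_mat s = ac_mat t * W"
    show "c b * s = t * c b"
    proof (subst square_mult_eq_iff[OF c_carrier s t c_carrier], intro allI impI)
      fix i j assume ij: "i < n" "j < n"
      have "(\<Sum>k<n. to_ac (s $$ (k, j)) * W $$ (i, k)) = (\<Sum>k<n. to_ac (t $$ (i, k)) * W $$ (k, j))"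
        using square_mult_eq_iff[of W n "ac_mat s" "ac_mat t" W] e ij s t W by (simp add: mult.commute)
      then have "?r (\<Sum>k<n. to_ac (s $$ (k, j)) * W $$ (i, k)) b = ?r (\<Sum>k<n. to_ac (t $$ (i, k)) * W $$ (k, j)) b"
        by simp
      then have eq: "(\<Sum>k<n. s $$ (k, j) * ?r (W $$ (i, k)) b) = (\<Sum>k<n. t $$ (i, k) * ?r (W $$ (k, j)) b)"
        by (simp add: rep B)
      have "(\<Sum>k<n. c b $$ (i, k) * s $$ (k, j)) = (\<Sum>k<n. s $$ (k, j) * ?r (W $$ (i, k)) b)"
        using ij by (simp add: c_def mult.commute)
      also note eq
      also have "(\<Sum>k<n. t $$ (i, k) * ?r (W $$ (k, j)) b) = (\<Sum>k<n. t $$ (i, k) * c b $$ (k, j))"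
        using ij by (simp add: c_def)
      finally show "(\<Sum>k<n. c b $$ (i, k) * s $$ (k, j)) = (\<Sum>k<n. t $$ (i, k) * c b $$ (k, j))" .
    qed
  qed
qed

text \<open>Each coordinate matrix of \<open>A\<close> over the base field commutes with
  \<open>s\<close>, hence with \<open>t\<close>; and \<open>A\<close> is a linear combination of
  these matrices over the closure.\<close>

lemma commutant_closure:
  fixes s t :: "'a :: field mat"
  assumes s: "s \<in> carrier_mat n n" and t: "t \<in> carrier_mat n n"
    and comm: "\<And>A. A \<in> carrier_mat n n \<Longrightarrow> A * s = s * A \<Longrightarrow> A * t = t * A"
    and A: "A \<in> carrier_mat n n" "A * ac_mat s = ac_mat s * A"
  shows "A * ac_mat t = ac_mat t * A"
proof -
  obtain T and c :: "'a alg_closure \<Rightarrow> 'a mat" where c: "finite T" "\<And>b. c b \<in> carrier_mat n n"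
    "A = mat n n (\<lambda>(i, j). \<Sum>b\<in>T. b * to_ac (c b $$ (i, j)))"
    "\<And>s t b. s \<in> carrier_mat n n \<Longrightarrow> t \<in> carrier_mat n n \<Longrightarrow> A * ac_mat s = ac_mat t * A \<Longrightarrow> c b * s = t * c b"
    by (rule intertwiner_coordinates[OF A(1)]) (rule that)
  have ac_t: "ac_mat t \<in> carrier_mat n n" using t by simp
  have ct: "c b * t = t * c b" for b by (rule comm[OF c(2) c(4)[OF s s A(2)]])
  have "(\<Sum>k<n. c b $$ (i, k) * t $$ (k, j)) = (\<Sum>k<n. t $$ (i, k) * c b $$ (k, j))" if "i < n" "j < n" for i j b
    using square_mult_eq_iff[OF c(2)[of b] t t c(2)[of b]] ct[of b] that by simp
  then have ct': "(\<Sum>k<n. to_ac (c b $$ (i, k)) * to_ac (t $$ (k, j))) = (\<Sum>k<n. to_ac (t $$ (i, k)) * to_ac (c b $$ (k, j)))"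
    if "i < n" "j < n" for i j b
    using that by (simp only: to_ac_mult[symmetric] to_ac_sum[symmetric])
  have e: "A $$ (i, j) = (\<Sum>b\<in>T. b * to_ac (c b $$ (i, j)))" if "i < n" "j < n" for i j
    using arg_cong[OF c(3), of "\<lambda>M. M $$ (i, j)"] that by simp
  show ?thesis
  proof (subst square_mult_eq_iff[OF A(1) ac_t ac_t A(1)], intro allI impI)
    fix i j assume ij: "i < n" "j < n"
    have "(\<Sum>k<n. A $$ (i, k) * ac_mat t $$ (k, j)) = (\<Sum>k<n. (\<Sum>b\<in>T. b * to_ac (c b $$ (i, k))) * to_ac (t $$ (k, j)))"
      using ij A t by (simp add: e)
    also have "\<dots> = (\<Sum>b\<in>T. b * (\<Sum>k<n. to_ac (c b $$ (i, k)) * to_ac (t $$ (k, j))))"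
      unfolding sum_distrib_right sum_distrib_left by (subst sum.swap) (simp add: mult_ac)
    also have "\<dots> = (\<Sum>b\<in>T. b * (\<Sum>k<n. to_ac (t $$ (i, k)) * to_ac (c b $$ (k, j))))"
      by (simp add: ct'[OF ij])
    also have "\<dots> = (\<Sum>k<n. to_ac (t $$ (i, k)) * (\<Sum>b\<in>T. b * to_ac (c b $$ (k, j))))"
      unfolding sum_distrib_right sum_distrib_left by (subst sum.swap) (simp add: mult_ac)
    also have "\<dots> = (\<Sum>k<n. ac_mat t $$ (i, k) * A $$ (k, j))"
      using ij A t by (simp add: e)
    finally show "(\<Sum>k<n. A $$ (i, k) * ac_mat t $$ (k, j)) = (\<Sum>k<n. ac_mat t $$ (i, k) * A $$ (k, j))" .
  qed
qed

text \<open>The determinant is a polynomial in \<open>x\<close> of degree at most \<open>n\<close>,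
  nonzero because of its value at \<open>y\<close>, so its zeros cannot exhaust
  \<open>U\<close>.\<close>

lemma det_pencil_nonzero:
  fixes C D :: "'a :: idom mat"
  assumes CD: "C \<in> carrier_mat n n" "D \<in> carrier_mat n n" and det: "det (C + y \<cdot>\<^sub>m D) \<noteq> 0" and U: "n < card U"
  obtains x where "x \<in> U" "det (C + x \<cdot>\<^sub>m D) \<noteq> 0"
proof -
  define M where "M = mat n n (\<lambda>(i, j). [: C $$ (i, j), D $$ (i, j) :])"
  have eval: "poly (det M) x = det (C + x \<cdot>\<^sub>m D)" for x
    using CD by (intro poly_det_cong[of _ n]) (auto simp: M_def)
  have M0: "det M \<noteq> 0" using det eval[of y] by auto
  have "degree (det M) \<le> 1 * n"
    by (rule degree_det_le) (auto simp: M_def)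
  then have "card {x. poly (det M) x = 0} < card U"
    using card_poly_roots_bound[OF M0] U by linarith
  then have "\<not> U \<subseteq> {x. poly (det M) x = 0}"
    using card_mono[OF poly_roots_finite[OF M0], of U] by linarith
  then obtain x where "x \<in> U" "poly (det M) x \<noteq> 0" by blast
  then show thesis using that[of x] by (simp add: eval)
qed

text \<open>
  Noether--Deuring: the coordinates of an invertible intertwiner are recombined with weights from the
  base field, chosen one at a time so that the determinant stays nonzero.
\<close>

theorem similar_mat_descend:
  fixes s t :: "'a :: {finite, field} mat"
  assumes s: "s \<in> carrier_mat n n" and t: "t \<in> carrier_mat n n" and n: "n < card (UNIV :: 'a set)"
    and sim: "similar_mat (ac_mat s) (ac_mat t)"
  shows "similar_mat s t"
proof -
  have ac: "ac_mat s \<in> carrier_mat n n" "ac_mat t \<in> carrier_mat n n" using s t by simp_all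
  obtain W where W: "W \<in> GL n" "W * ac_mat t = ac_mat s * W"
    using similar_mat_iff_GL[OF ac, THEN iffD1, OF sim] by (elim bexE)
  obtain T and c :: "'a alg_closure \<Rightarrow> 'a mat" where c: "finite T" "\<And>b. c b \<in> carrier_mat n n"
    "W = mat n n (\<lambda>(i, j). \<Sum>b\<in>T. b * to_ac (c b $$ (i, j)))"
    "\<And>s t b. s \<in> carrier_mat n n \<Longrightarrow> t \<in> carrier_mat n n \<Longrightarrow> W * ac_mat s = ac_mat t * W \<Longrightarrow> c b * s = t * c b"
    by (rule intertwiner_coordinates[OF GL_carrier[OF W(1)]]) (rule that)
  define M where "M w = mat n n (\<lambda>(i, j). \<Sum>b\<in>T. w b * to_ac (c b $$ (i, j)))" for w
  have M: "M w \<in> carrier_mat n n" for w by (simp add: M_def)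
  \<comment> \<open>The weights \<open>w\<close> start as the basis elements themselves, which
    reproduces \<open>W\<close>; those indexed by \<open>T'\<close> have already been moved into the
    base field.\<close>
  have "\<exists>w. (\<forall>b\<in>T'. w b \<in> range to_ac) \<and> det (M w) \<noteq> 0" if "T' \<subseteq> T" for T'
    using finite_subset[OF that c(1)] that
  proof (induction T' rule: finite_induct)
    case empty
    have "W = M (\<lambda>b. b)" unfolding M_def by (rule c(3))
    then show ?case using W(1) by (auto simp: GL_iff_det)
  next
    case (insert b T')
    then obtain w where w: "\<forall>b\<in>T'. w b \<in> range to_ac" "det (M w) \<noteq> 0" by auto
    have update: "M (w(b := x)) = M (w(b := 0)) + x \<cdot>\<^sub>m ac_mat (c b)" for x
    proof (rule eq_matI; (use c(2)[of b] in \<open>simp add: M_def\<close>)?)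
      fix i j assume "i < n" "j < n"
      have "(\<Sum>a\<in>T. (if a = b then x else w a) * to_ac (c a $$ (i, j))) =
        (\<Sum>a\<in>T. (if a = b then 0 else w a) * to_ac (c a $$ (i, j)) + (if a = b then x * to_ac (c b $$ (i, j)) else 0))"
        by (intro sum.cong) auto
      also have "\<dots> = (\<Sum>a\<in>T. (if a = b then 0 else w a) * to_ac (c a $$ (i, j))) + x * to_ac (c b $$ (i, j))"
        using insert.prems c(1) by (simp add: sum.distrib sum.delta')
      finally show "(\<Sum>a\<in>T. (if a = b then x else w a) * to_ac (c a $$ (i, j))) =
        (\<Sum>a\<in>T. (if a = b then 0 else w a) * to_ac (c a $$ (i, j))) + x * to_ac (c b $$ (i, j))" .
    qed
    have "det (M (w(b := 0)) + w b \<cdot>\<^sub>m ac_mat (c b)) \<noteq> 0" unfolding update[symmetric] using w(2) by simp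
    moreover have "n < card (range (to_ac :: 'a \<Rightarrow> _))" using n by (simp add: card_image inj_to_ac)
    moreover have "ac_mat (c b) \<in> carrier_mat n n" using c(2) by simp
    ultimately obtain x where x: "x \<in> range (to_ac :: 'a \<Rightarrow> _)"
      "det (M (w(b := 0)) + x \<cdot>\<^sub>m ac_mat (c b)) \<noteq> 0"
      using det_pencil_nonzero[OF M, of "ac_mat (c b)" "w(b := 0)" "w b" "range to_ac"] by blast
    have "det (M (w(b := x))) \<noteq> 0" by (subst update) (rule x(2))
    moreover have "\<forall>a\<in>insert b T'. (w(b := x)) a \<in> range to_ac" using w(1) x(1) by auto
    ultimately show ?case by (intro exI[of _ "w(b := x)"] conjI)
  qed
  from this[OF order_refl] obtain w where w: "\<forall>b\<in>T. w b \<in> range to_ac" "det (M w) \<noteq> 0" by blast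
  define Y where "Y = mat n n (\<lambda>(i, j). \<Sum>b\<in>T. of_ac (w b) * c b $$ (i, j))"
  have Y: "Y \<in> carrier_mat n n" by (simp add: Y_def)
  have "ac_mat Y = M w"
    using w(1) by (intro eq_matI) (auto simp: Y_def M_def to_ac_sum to_ac_of_ac intro!: sum.cong)
  then have "Y \<in> GL n" using w(2) Y to_ac.hom_det[of Y] by (auto simp: GL_iff_det)
  moreover have "Y * t = s * Y"
  proof (subst square_mult_eq_iff[OF Y t s Y]; intro allI impI)
    fix i j assume ij: "i < n" "j < n"
    have e: "(\<Sum>k<n. c b $$ (i, k) * t $$ (k, j)) = (\<Sum>k<n. s $$ (i, k) * c b $$ (k, j))" for b
      using square_mult_eq_iff[OF c(2)[of b] t s c(2)[of b]] c(4)[OF t s W(2), of b] ij by simp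
    have "(\<Sum>k<n. Y $$ (i, k) * t $$ (k, j)) = (\<Sum>k<n. (\<Sum>b\<in>T. of_ac (w b) * c b $$ (i, k)) * t $$ (k, j))"
      using ij t by (simp add: Y_def)
    also have "\<dots> = (\<Sum>b\<in>T. of_ac (w b) * (\<Sum>k<n. c b $$ (i, k) * t $$ (k, j)))"
      unfolding sum_distrib_right sum_distrib_left by (subst sum.swap) (simp add: mult_ac)
    also have "\<dots> = (\<Sum>b\<in>T. of_ac (w b) * (\<Sum>k<n. s $$ (i, k) * c b $$ (k, j)))"
      by (simp add: e)
    also have "\<dots> = (\<Sum>k<n. s $$ (i, k) * (\<Sum>b\<in>T. of_ac (w b) * c b $$ (k, j)))"
      unfolding sum_distrib_right sum_distrib_left by (subst sum.swap) (simp add: mult_ac)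
    also have "\<dots> = (\<Sum>k<n. s $$ (i, k) * Y $$ (k, j))"
      using ij s by (simp add: Y_def)
    finally show "(\<Sum>k<n. Y $$ (i, k) * t $$ (k, j)) = (\<Sum>k<n. s $$ (i, k) * Y $$ (k, j))" .
  qed
  ultimately show ?thesis unfolding similar_mat_iff_GL[OF s t] by blast
qed

section \<open>Spectra of semisimple elements\<close>

definition spec :: "'a :: field mat \<Rightarrow> 'a alg_closure multiset" where
  "spec s = proots (char_poly (ac_mat s))"

text \<open>The matrix \<open>P\<close> is kept as an argument because \<open>z\<close>-equivalence
  is decided by comparing elements diagonalized by one and the same \<open>P\<close>.\<close>

definition diagonalizes :: "nat \<Rightarrow> 'a :: field alg_closure mat \<Rightarrow> 'a mat \<Rightarrow> (nat \<Rightarrow> 'a alg_closure) \<Rightarrow> bool" where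
  "diagonalizes n P s D \<longleftrightarrow> s \<in> carrier_mat n n \<and> P \<in> GL n \<and> ac_mat s * P = P * mat_diag n D"

lemma proots_char_poly_mat_diag: "proots (char_poly (mat_diag n D)) = image_mset D (mset_set {0..<n})"
  for D :: "nat \<Rightarrow> 'a :: field"
proof -
  have "upper_triangular (mat_diag n D)" by (simp add: upper_triangular_def mat_diag_def)
  then have "char_poly (mat_diag n D) = (\<Prod>a\<leftarrow>diag_mat (mat_diag n D). [:- a, 1:])"
    by (rule char_poly_upper_triangular[OF mat_diag_dim])
  also have "diag_mat (mat_diag n D) = map D [0..<n]" by (simp add: diag_mat_def mat_diag_def)
  also have "(\<Prod>a\<leftarrow>map D [0..<n]. [:- a, 1:]) = (\<Prod>i\<in>{0..<n}. [:- D i, 1:])"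
    by (induction n) (simp_all add: mult.commute)
  finally have "proots (char_poly (mat_diag n D)) = (\<Sum>i\<in>{0..<n}. {#D i#})"
    by (simp add: proots_prod)
  also have "\<dots> = image_mset D (mset_set {0..<n})"
    by (induction n) (simp_all add: atLeast0_lessThan_Suc)
  finally show ?thesis .
qed

lemma det_mat_diag: "det (mat_diag n D) = (\<Prod>i\<in>{0..<n}. D i)" for D :: "nat \<Rightarrow> 'a :: field"
proof -
  have "upper_triangular (mat_diag n D)" by (simp add: upper_triangular_def mat_diag_def)
  then have "det (mat_diag n D) = prod_list (diag_mat (mat_diag n D))"
    by (rule det_upper_triangular[OF _ mat_diag_dim])
  also have "\<dots> = (\<Prod>i\<in>{0..<n}. D i)" unfolding prod_list_diag_prod by (simp add: mat_diag_def)
  finally show ?thesis .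
qed

lemma commute_mat_diag_iff:
  fixes D :: "nat \<Rightarrow> 'a :: field"
  assumes "M \<in> carrier_mat n n"
  shows "M * mat_diag n D = mat_diag n D * M \<longleftrightarrow> (\<forall>i<n. \<forall>j<n. M $$ (i, j) = 0 \<or> D i = D j)"
  using assms unfolding mat_diag_mult_left[OF assms] mat_diag_mult_right[OF assms]
  by (auto simp: mat_eq_iff mult.commute[of "D _"]) metis+

lemma similar_ac_iff_diagonalizes:
  assumes "s \<in> carrier_mat n n"
  shows "similar_mat (ac_mat s) (mat_diag n D) \<longleftrightarrow> (\<exists>P. diagonalizes n P s D)"
proof -
  have "ac_mat s \<in> carrier_mat n n" using assms by simp
  then have "similar_mat (ac_mat s) (mat_diag n D) \<longleftrightarrow> (\<exists>P\<in>GL n. P * mat_diag n D = ac_mat s * P)"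
    by (rule similar_mat_iff_GL[OF _ mat_diag_dim])
  then show ?thesis unfolding diagonalizes_def using assms by metis
qed

lemma semisimple_iff_diagonalizes:
  assumes s: "s \<in> carrier_mat n n"
  shows "semisimple_mat s \<longleftrightarrow> (\<exists>P D. diagonalizes n P s D)"
proof
  assume "semisimple_mat s"
  then obtain D where D: "diagonal_mat D" "similar_mat (ac_mat s) D" by (auto simp: semisimple_mat_def)
  have "D \<in> carrier_mat n n" using similar_matD[OF D(2)] s by (elim exE) auto
  then have "D = mat_diag n (\<lambda>i. D $$ (i, i))"
    using D(1) by (intro eq_matI) (auto simp: mat_diag_def diagonal_mat_def)
  then have "similar_mat (ac_mat s) (mat_diag n (\<lambda>i. D $$ (i, i)))" using D(2) by metis
  then obtain P where "diagonalizes n P s (\<lambda>i. D $$ (i, i))"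
    unfolding similar_ac_iff_diagonalizes[OF s] by (elim exE)
  then show "\<exists>P D. diagonalizes n P s D" by (intro exI)
next
  assume "\<exists>P D. diagonalizes n P s D"
  then obtain D where "similar_mat (ac_mat s) (mat_diag n D)"
    using similar_ac_iff_diagonalizes[OF s] by blast
  moreover have "diagonal_mat (mat_diag n D)" by (simp add: mat_diag_def diagonal_mat_def)
  ultimately show "semisimple_mat s" unfolding semisimple_mat_def by blast
qed

lemma spec_diagonalizes:
  assumes "diagonalizes n P s D"
  shows "spec s = image_mset D (mset_set {0..<n})"
proof -
  have "s \<in> carrier_mat n n" using assms by (simp add: diagonalizes_def)
  from similar_ac_iff_diagonalizes[OF this] have "similar_mat (ac_mat s) (mat_diag n D)" using assms by blast
  then show ?thesis unfolding spec_def char_poly_similar[OF \<open>similar_mat (ac_mat s) (mat_diag n D)\<close>]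
    by (simp add: proots_char_poly_mat_diag)
qed

lemma similar_ac_mat:
  assumes "similar_mat s t"
  shows "similar_mat (ac_mat s) (ac_mat t)"
proof -
  obtain n P Q where c: "{s, t, P, Q} \<subseteq> carrier_mat n n" and e: "P * Q = 1\<^sub>m n" "Q * P = 1\<^sub>m n" "s = P * t * Q"
    using similar_matD[OF assms] by metis
  show ?thesis
  proof (rule similar_matI[of _ _ "ac_mat P" "ac_mat Q" n])
    show "ac_mat P * ac_mat Q = 1\<^sub>m n" "ac_mat Q * ac_mat P = 1\<^sub>m n"
      using c e(1,2) by (simp_all add: to_ac.mat_hom_one flip: ac_mat_mult[where n = n])
    show "ac_mat s = ac_mat P * ac_mat t * ac_mat Q"
      unfolding e(3) using c by (simp add: ac_mat_mult[where n = n])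
  qed (use c in simp)
qed

lemma spec_similar: "similar_mat s t \<Longrightarrow> spec s = spec t"
  unfolding spec_def by (simp add: char_poly_similar[OF similar_ac_mat])

lemma semisimple_similar:
  "semisimple_mat s \<Longrightarrow> similar_mat s t \<Longrightarrow> semisimple_mat t"
  unfolding semisimple_mat_def using similar_mat_trans[OF similar_mat_sym[OF similar_ac_mat]] by blast

text \<open>Over the closure both matrices are diagonal up to similarity, with entries differing by
  a permutation; the bound on \<open>n\<close> lets this similarity descend to the base
  field.\<close>

lemma similar_if_spec_eq:
  fixes s t :: "'a :: {finite, field} mat"
  assumes s: "diagonalizes n P s D" and t: "diagonalizes n P' t D'" and eq: "spec s = spec t"
    and n: "n < card (UNIV :: 'a set)"
  shows "similar_mat s t"
proof -
  have st: "s \<in> carrier_mat n n" "t \<in> carrier_mat n n" using s t by (simp_all add: diagonalizes_def)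
  have "image_mset D (mset_set {0..<n}) = image_mset D' (mset_set {0..<n})"
    using eq by (simp only: spec_diagonalizes[OF s] spec_diagonalizes[OF t])
  then obtain p where p: "p permutes {0..<n}" "\<forall>i\<in>{0..<n}. D i = D' (p i)"
    by (rule image_mset_eq_implies_permutes[OF finite_atLeastLessThan])
  have bij: "bij_betw p {0..<n} {0..<n}" by (rule permutes_imp_bij[OF p(1)])
  have pn: "p i < n" if "i < n" for i using permutes_in_image[OF p(1), of i] that by simp
  have inj: "p i = p j \<longleftrightarrow> i = j" for i j using permutes_inj[OF p(1)] by (auto simp: inj_def)
  have "mat n n (\<lambda>(i, j). mat_diag n D' $$ (p i, p j)) = mat_diag n D"
    using p(2) pn inj by (intro eq_matI) (auto simp: mat_diag_def)
  then have "similar_mat (mat_diag n D) (mat_diag n D')"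
    using similar_mat_permute[OF mat_diag_dim bij, of D'] by simp
  moreover have "similar_mat (ac_mat s) (mat_diag n D)" "similar_mat (ac_mat t) (mat_diag n D')"
    using similar_ac_iff_diagonalizes[OF st(1)] similar_ac_iff_diagonalizes[OF st(2)] s t by blast+
  ultimately have "similar_mat (ac_mat s) (ac_mat t)"
    using similar_mat_trans similar_mat_sym by metis
  then show ?thesis by (rule similar_mat_descend[OF st n])
qed

lemma diagonalizes_nonzero:
  assumes "diagonalizes n P s D" "s \<in> GL n" "i < n"
  shows "D i \<noteq> 0"
proof -
  have s: "ac_mat s \<in> carrier_mat n n" "det (ac_mat s) \<noteq> 0"
    using assms(2) by (auto simp: GL_iff_det)
  have P: "P \<in> carrier_mat n n" "det P \<noteq> 0" "ac_mat s * P = P * mat_diag n D"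
    using assms(1) by (auto simp: GL_iff_det diagonalizes_def)
  have "det (ac_mat s) * det P = det P * det (mat_diag n D)"
    using arg_cong[OF P(3), of det] by (simp only: det_mult[OF s(1) P(1)] det_mult[OF P(1) mat_diag_dim])
  then have "det (mat_diag n D) \<noteq> 0" using s(2) P(2) by auto
  then show ?thesis using assms(3) by (auto simp: det_mat_diag)
qed

lemma conj_commute_iff:
  fixes M :: "'a :: field mat"
  assumes c: "P \<in> carrier_mat n n" "R \<in> carrier_mat n n" "M \<in> carrier_mat n n" "E \<in> carrier_mat n n" "C \<in> carrier_mat n n"
    and PR: "P * R = 1\<^sub>m n" "R * P = 1\<^sub>m n" and CP: "C * P = P * E"
  shows "M * E = E * M \<longleftrightarrow> (P * M * R) * C = C * (P * M * R)"
proof -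
  have C: "C = P * E * R"
  proof -
    have "C = C * (P * R)" using c by (simp add: PR)
    also have "\<dots> = C * P * R" using c by (simp add: square_mult_assoc[where n = n])
    finally show ?thesis by (simp add: CP)
  qed
  have prod: "(P * A * R) * (P * B * R) = P * (A * B) * R" if "A \<in> carrier_mat n n" "B \<in> carrier_mat n n" for A B
    using c that PR by (simp add: square_mult_assoc[where n = n] square_inv_cancel[where n = n])
  have cancel: "R * (P * A * R) * P = A" if "A \<in> carrier_mat n n" for A
    using c that PR by (simp add: square_mult_assoc[where n = n] square_inv_cancel[where n = n])
  have inj: "P * A * R = P * B * R \<longleftrightarrow> A = B" if "A \<in> carrier_mat n n" "B \<in> carrier_mat n n" for A B
    using cancel[OF that(1)] cancel[OF that(2)] by metis
  have "(P * M * R) * C = C * (P * M * R) \<longleftrightarrow> P * (M * E) * R = P * (E * M) * R"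
    unfolding C by (simp only: prod[OF c(3,4)] prod[OF c(4,3)])
  also have "\<dots> \<longleftrightarrow> M * E = E * M" by (rule inj) (use c in simp_all)
  finally show ?thesis by simp
qed

lemma diagonalizes_commute_iff:
  assumes d: "diagonalizes n P s D" and R: "R \<in> carrier_mat n n" "P * R = 1\<^sub>m n" "R * P = 1\<^sub>m n"
    and M: "M \<in> carrier_mat n n"
  shows "(P * M * R) * ac_mat s = ac_mat s * (P * M * R) \<longleftrightarrow> (\<forall>i<n. \<forall>j<n. M $$ (i, j) = 0 \<or> D i = D j)"
proof -
  have s: "ac_mat s \<in> carrier_mat n n" and P: "P \<in> carrier_mat n n" and eq: "ac_mat s * P = P * mat_diag n D"
    using d GL_carrier[of P n] by (auto simp: diagonalizes_def)
  show ?thesis unfolding commute_mat_diag_iff[OF M, symmetric]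
    by (rule conj_commute_iff[OF P R(1) M mat_diag_dim s R(2,3) eq, symmetric])
qed

text \<open>A nonzero determinant has a nonzero term in its Leibniz expansion.\<close>

lemma GL_nonzero_permutation:
  assumes "Q \<in> GL n"
  obtains p where "p permutes {0..<n}" "\<And>i. i < n \<Longrightarrow> Q $$ (i, p i) \<noteq> 0"
proof -
  have Q: "Q \<in> carrier_mat n n" "det Q \<noteq> 0" using assms by (auto simp: GL_iff_det)
  have "\<exists>p. p permutes {0..<n} \<and> (\<Prod>i = 0..<n. Q $$ (i, p i)) \<noteq> 0"
  proof (rule ccontr)
    assume "\<nexists>p. p permutes {0..<n} \<and> (\<Prod>i = 0..<n. Q $$ (i, p i)) \<noteq> 0"
    then have "(\<Sum>p | p permutes {0..<n}. signof p * (\<Prod>i = 0..<n. Q $$ (i, p i))) = 0"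
      by (intro sum.neutral) auto
    then show False using Q by (simp add: det_def')
  qed
  then obtain p where "p permutes {0..<n}" "(\<Prod>i = 0..<n. Q $$ (i, p i)) \<noteq> 0" by blast
  then show thesis using that[of p] by auto
qed

text \<open>Isomorphism of multisets equipped with a self-map. Two maps are allowed so that spectra
  occurring in the two groups can be compared; taking the image as a multiset enforces equal
  multiplicities.\<close>

definition spec_iso :: "('x \<Rightarrow> 'x) \<Rightarrow> ('y \<Rightarrow> 'y) \<Rightarrow> 'x multiset \<Rightarrow> 'y multiset \<Rightarrow> bool" where
  "spec_iso f g S S' \<longleftrightarrow> (\<exists>\<theta>. inj_on \<theta> (set_mset S) \<and> (\<forall>x\<in>set_mset S. \<theta> (f x) = g (\<theta> x)) \<and> image_mset \<theta> S = S')"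

text \<open>Closedness of \<open>S\<close> under \<open>f\<close> enters because the inverse
  bijection has to be evaluated at the image of \<open>f x\<close>, which must come from a point of
  \<open>S\<close>.\<close>

lemma spec_iso_sym:
  assumes iso: "spec_iso f g S S'" and closed: "image_mset f S = S"
  shows "spec_iso g f S' S"
proof -
  obtain \<theta> where \<theta>: "inj_on \<theta> (set_mset S)" "\<And>x. x \<in># S \<Longrightarrow> \<theta> (f x) = g (\<theta> x)" "S' = image_mset \<theta> S"
    using iso by (auto simp: spec_iso_def)
  have f_closed: "f x \<in># S" if "x \<in># S" for x
  proof -
    have "f x \<in># image_mset f S" using that by simp
    then show ?thesis unfolding closed .
  qed
  let ?i = "the_inv_into (set_mset S) \<theta>"
  have inv: "?i (\<theta> x) = x" if "x \<in># S" for x using the_inv_into_f_f[OF \<theta>(1) that] .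
  show ?thesis unfolding spec_iso_def
  proof (intro exI[of _ ?i] conjI ballI)
    show "inj_on ?i (set_mset S')" using inj_on_the_inv_into[OF \<theta>(1)] by (simp add: \<theta>(3))
    fix y assume "y \<in># S'"
    then obtain x where x: "x \<in># S" "y = \<theta> x" by (auto simp: \<theta>(3))
    have "?i (g y) = ?i (\<theta> (f x))" unfolding x(2) \<theta>(2)[OF x(1)] ..
    also have "\<dots> = f x" by (rule inv[OF f_closed[OF x(1)]])
    finally show "?i (g y) = f (?i y)" unfolding x(2) inv[OF x(1)] .
  next
    have "image_mset ?i S' = image_mset (\<lambda>x. x) S"
      unfolding \<theta>(3) multiset.map_comp by (rule image_mset_cong) (simp add: inv)
    then show "image_mset ?i S' = S" by simp
  qed
qed

lemma spec_iso_trans: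
  assumes "spec_iso f g S S'" "spec_iso g h S' S''"
  shows "spec_iso f h S S''"
proof -
  obtain \<theta> where \<theta>: "inj_on \<theta> (set_mset S)" "\<And>x. x \<in># S \<Longrightarrow> \<theta> (f x) = g (\<theta> x)" "S' = image_mset \<theta> S"
    using assms(1) by (auto simp: spec_iso_def)
  obtain \<eta> where \<eta>: "inj_on \<eta> (set_mset S')" "\<And>x. x \<in># S' \<Longrightarrow> \<eta> (g x) = h (\<eta> x)" "S'' = image_mset \<eta> S'"
    using assms(2) by (auto simp: spec_iso_def)
  have "inj_on (\<eta> \<circ> \<theta>) (set_mset S)" using \<theta>(1) \<eta>(1) by (intro comp_inj_on) (simp_all add: \<theta>(3))
  moreover have "(\<eta> \<circ> \<theta>) (f x) = h ((\<eta> \<circ> \<theta>) x)" if "x \<in># S" for x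
    using \<theta>(2)[OF that] \<eta>(2)[of "\<theta> x"] that by (simp add: \<theta>(3))
  moreover have "image_mset (\<eta> \<circ> \<theta>) S = S''" unfolding \<eta>(3) \<theta>(3) multiset.map_comp ..
  ultimately show ?thesis unfolding spec_iso_def by blast
qed

text \<open>
  The map \<open>\<psi>\<close> encodes which diagonal matrices become elements of the group after conjugation with
  a given \<open>P\<close>: it is \<open>x \<mapsto> x\<^sup>q\<close> for the general linear group and \<open>x \<mapsto> x\<^sup>-\<^sup>q\<close> for the unitary group.
\<close>

locale semisimple_frame = ample_matrix_group n G for n and G :: "'a :: {finite, field} mat monoid" +
  fixes \<psi> :: "'a alg_closure \<Rightarrow> 'a alg_closure"
  assumes n_small: "n < card (UNIV :: 'a set)"
    and inj_psi: "inj \<psi>"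
    and twist: "P \<in> GL n \<Longrightarrow> \<exists>Q\<in>(GL n :: 'a alg_closure mat set). \<forall>D. (\<forall>i<n. D i \<noteq> 0) \<longrightarrow>
      (\<exists>s\<in>carrier G. diagonalizes n P s D) \<longleftrightarrow> (\<forall>i<n. \<forall>j<n. Q $$ (i, j) \<noteq> 0 \<longrightarrow> D i = \<psi> (D j))"
    and realize: "size S = n \<Longrightarrow> 0 \<notin># S \<Longrightarrow> image_mset \<psi> S = S \<Longrightarrow> \<exists>t\<in>carrier G. semisimple_mat t \<and> spec t = S"
begin

lemma semisimple_carrier_E:
  assumes "s \<in> carrier G" "semisimple_mat s"
  obtains P D R and Q :: "'a alg_closure mat" where "diagonalizes n P s D" "\<forall>i<n. D i \<noteq> 0"
    "R \<in> carrier_mat n n" "P * R = 1\<^sub>m n" "R * P = 1\<^sub>m n" "P \<in> carrier_mat n n"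
    "Q \<in> GL n" "\<forall>D. (\<forall>i<n. D i \<noteq> 0) \<longrightarrow>
      (\<exists>s\<in>carrier G. diagonalizes n P s D) \<longleftrightarrow> (\<forall>i<n. \<forall>j<n. Q $$ (i, j) \<noteq> 0 \<longrightarrow> D i = \<psi> (D j))"
proof -
  obtain P D where d: "diagonalizes n P s D"
    using semisimple_iff_diagonalizes[OF G_carrier[OF assms(1)]] assms(2) by blast
  have P: "P \<in> GL n" using d by (simp add: diagonalizes_def)
  have nz: "\<forall>i<n. D i \<noteq> 0"
    using diagonalizes_nonzero[OF d] assms(1) G_GL by blast
  obtain R where R: "P \<in> carrier_mat n n" "R \<in> carrier_mat n n" "P * R = 1\<^sub>m n" "R * P = 1\<^sub>m n"
    using GL_E[OF P] by metis
  obtain Q :: "'a alg_closure mat" where "Q \<in> GL n" and Q: "\<forall>D. (\<forall>i<n. D i \<noteq> 0) \<longrightarrow>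
      (\<exists>s\<in>carrier G. diagonalizes n P s D) \<longleftrightarrow> (\<forall>i<n. \<forall>j<n. Q $$ (i, j) \<noteq> 0 \<longrightarrow> D i = \<psi> (D j))"
    using twist[OF P] by (elim bexE)
  show thesis by (rule that[OF d nz R(2,3,4,1) \<open>Q \<in> GL n\<close> Q])
qed

text \<open>A permutation \<open>p\<close> along nonzero entries of \<open>Q\<close> yields
  \<open>D i = \<psi> (D (p i))\<close> for every \<open>i\<close>, so \<open>\<psi>\<close> only
  rearranges the eigenvalues.\<close>

lemma spec_closed:
  assumes "s \<in> carrier G" "semisimple_mat s"
  shows "image_mset \<psi> (spec s) = spec s" "0 \<notin># spec s" "size (spec s) = n"
proof -
  obtain P D R and Q :: "'a alg_closure mat" where d: "diagonalizes n P s D" "\<forall>i<n. D i \<noteq> 0"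
    and Q: "Q \<in> GL n" "\<forall>D. (\<forall>i<n. D i \<noteq> 0) \<longrightarrow>
      (\<exists>s\<in>carrier G. diagonalizes n P s D) \<longleftrightarrow> (\<forall>i<n. \<forall>j<n. Q $$ (i, j) \<noteq> 0 \<longrightarrow> D i = \<psi> (D j))"
    by (rule semisimple_carrier_E[OF assms]) (rule that)
  note S = spec_diagonalizes[OF d(1)]
  obtain p where p: "p permutes {0..<n}" "\<And>i. i < n \<Longrightarrow> Q $$ (i, p i) \<noteq> 0"
    using GL_nonzero_permutation[OF Q(1)] by metis
  have pn: "p i < n" if "i < n" for i using permutes_in_image[OF p(1), of i] that by simp
  have "\<forall>i<n. \<forall>j<n. Q $$ (i, j) \<noteq> 0 \<longrightarrow> D i = \<psi> (D j)"
    using iffD1[OF Q(2)[THEN spec, THEN mp, OF d(2)]] assms(1) d(1) by blast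
  then have D: "D i = \<psi> (D (p i))" if "i < n" for i using that pn p(2) by blast
  have "spec s = image_mset (\<lambda>i. \<psi> (D (p i))) (mset_set {0..<n})"
    unfolding S by (rule image_mset_cong) (simp add: D[symmetric])
  also have "\<dots> = image_mset \<psi> (image_mset D (image_mset p (mset_set {0..<n})))"
    by (simp add: multiset.map_comp comp_def)
  also have "image_mset p (mset_set {0..<n}) = mset_set {0..<n}"
    using image_mset_mset_set[OF permutes_inj_on[OF p(1)], of "{0..<n}"] permutes_image[OF p(1)] by simp
  finally show "image_mset \<psi> (spec s) = spec s" unfolding S by (rule sym)
  show "0 \<notin># spec s" unfolding S using d(2) by auto
  show "size (spec s) = n" unfolding S by simp
qed

text \<open>After conjugation the two elements share their commutant, also over the closure. Tested
  on matrix units in an eigenbasis of one element, this makes the other diagonal in the same basis,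
  with the same coincidences among its eigenvalues. So \<open>D i\<close> can be sent to
  \<open>D' i\<close> injectively, and this is equivariant since both diagonals satisfy the
  conditions encoded by the same \<open>Q\<close>.\<close>

lemma spec_iso_if_z_rel:
  assumes s: "s \<in> carrier G" "semisimple_mat s" and t: "t \<in> carrier G" and z: "(s, t) \<in> z_rel G"
  shows "spec_iso \<psi> \<psi> (spec s) (spec t)"
proof -
  obtain s' where s': "s' \<in> carrier G" "similar_mat s s'"
    and comm: "\<And>A. A \<in> carrier_mat n n \<Longrightarrow> A * s' = s' * A \<longleftrightarrow> A * t = t * A"
    using z unfolding z_rel_iff_similar by blast
  have "semisimple_mat s'" by (rule semisimple_similar[OF s(2) s'(2)])
  then obtain P D R and Q :: "'a alg_closure mat" where d: "diagonalizes n P s' D" "\<forall>i<n. D i \<noteq> 0"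
    and R: "R \<in> carrier_mat n n" "P * R = 1\<^sub>m n" "R * P = 1\<^sub>m n" "P \<in> carrier_mat n n"
    and Q: "Q \<in> GL n" "\<forall>D. (\<forall>i<n. D i \<noteq> 0) \<longrightarrow>
      (\<exists>s\<in>carrier G. diagonalizes n P s D) \<longleftrightarrow> (\<forall>i<n. \<forall>j<n. Q $$ (i, j) \<noteq> 0 \<longrightarrow> D i = \<psi> (D j))"
    by (rule semisimple_carrier_E[OF s'(1)]) (rule that)
  have tc: "t \<in> carrier_mat n n" and sc: "s' \<in> carrier_mat n n" using t s'(1) G_carrier by simp_all
  have comm_ac: "A * ac_mat s' = ac_mat s' * A \<longleftrightarrow> A * ac_mat t = ac_mat t * A" if "A \<in> carrier_mat n n" for A
    using commutant_closure[OF sc tc comm[THEN iffD1] that] commutant_closure[OF tc sc comm[THEN iffD2] that]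
    by (rule iffI)
  define E :: "nat \<Rightarrow> nat \<Rightarrow> 'a alg_closure mat" where "E i j = mat n n (\<lambda>(k, l). if k = i \<and> l = j then 1 else 0)" for i j
  have E: "E i j \<in> carrier_mat n n" for i j by (simp add: E_def)
  define T where "T = R * ac_mat t * P"
  have T: "T \<in> carrier_mat n n" using R tc by (simp add: T_def)
  have PT: "ac_mat t * P = P * T"
    using R tc by (simp add: T_def square_mult_assoc[where n = n] square_inv_cancel[where n = n])
  have E_comm: "E i j * T = T * E i j \<longleftrightarrow> D i = D j" if "i < n" "j < n" for i j
  proof -
    have c: "P * E i j * R \<in> carrier_mat n n" using R E by simp
    have "E i j * T = T * E i j \<longleftrightarrow> (P * E i j * R) * ac_mat t = ac_mat t * (P * E i j * R)"
      by (rule conj_commute_iff[OF R(4,1) E T _ R(2,3) PT]) (use tc in simp)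
    also have "\<dots> \<longleftrightarrow> (P * E i j * R) * ac_mat s' = ac_mat s' * (P * E i j * R)"
      by (rule comm_ac[OF c, symmetric])
    also have "\<dots> \<longleftrightarrow> (\<forall>k<n. \<forall>l<n. E i j $$ (k, l) = 0 \<or> D k = D l)"
      by (rule diagonalizes_commute_iff[OF d(1) R(1-3) E])
    also have "\<dots> \<longleftrightarrow> D i = D j" using that by (auto simp: E_def)
    finally show ?thesis .
  qed
  define D' where "D' i = T $$ (i, i)" for i
  have T_diag: "T = mat_diag n D'"
  proof (rule eq_matI)
    fix k i assume "k < dim_row (mat_diag n D')" "i < dim_col (mat_diag n D')"
    then have ki: "k < n" "i < n" by (simp_all add: mat_diag_def)
    have "T $$ (k, i) = 0" if "k \<noteq> i"
    proof -
      \<comment> \<open>Commutation with the diagonal idempotent \<open>E i i\<close> forces the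
        entries of column \<open>i\<close> of \<open>T\<close> off the diagonal to vanish.\<close>
      have "E i i * T = T * E i i" using E_comm[OF ki(2,2)] by simp
      then have "(\<Sum>l<n. E i i $$ (k, l) * T $$ (l, i)) = (\<Sum>l<n. T $$ (k, l) * E i i $$ (l, i))"
        using square_mult_eq_iff[OF E T T E] ki by blast
      moreover have "(\<Sum>l<n. E i i $$ (k, l) * T $$ (l, i)) = 0"
        using ki \<open>k \<noteq> i\<close> by (simp add: E_def)
      moreover have "(\<Sum>l<n. T $$ (k, l) * E i i $$ (l, i)) = (\<Sum>l<n. if l = i then T $$ (k, i) else 0)"
        using ki by (intro sum.cong) (auto simp: E_def)
      ultimately show ?thesis using ki by simp
    qed
    then show "T $$ (k, i) = mat_diag n D' $$ (k, i)" using ki by (auto simp: mat_diag_def D'_def)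
  qed (use T in \<open>auto simp: mat_diag_def\<close>)
  have d': "diagonalizes n P t D'"
    using tc d(1) PT unfolding diagonalizes_def T_diag by blast
  have nz': "\<forall>i<n. D' i \<noteq> 0"
    using diagonalizes_nonzero[OF d'] t G_GL by blast
  have same: "D i = D j \<longleftrightarrow> D' i = D' j" if "i < n" "j < n" for i j
  proof -
    have "E i j * T = T * E i j \<longleftrightarrow> (\<forall>k<n. \<forall>l<n. E i j $$ (k, l) = 0 \<or> D' k = D' l)"
      unfolding T_diag by (rule commute_mat_diag_iff[OF E])
    also have "\<dots> \<longleftrightarrow> D' i = D' j" using that by (auto simp: E_def)
    finally show ?thesis using E_comm[OF that] by simp
  qed
  have tw: "\<forall>i<n. \<forall>j<n. Q $$ (i, j) \<noteq> 0 \<longrightarrow> D i = \<psi> (D j)"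
    using iffD1[OF Q(2)[THEN spec, THEN mp, OF d(2)]] s'(1) d(1) by blast
  have tw': "\<forall>i<n. \<forall>j<n. Q $$ (i, j) \<noteq> 0 \<longrightarrow> D' i = \<psi> (D' j)"
    using iffD1[OF Q(2)[THEN spec, THEN mp, OF nz']] t d' by blast
  define \<theta> where "\<theta> x = D' (SOME i. i < n \<and> D i = x)" for x
  have \<theta>: "\<theta> (D i) = D' i" if "i < n" for i
  proof -
    have "(SOME k. k < n \<and> D k = D i) < n \<and> D (SOME k. k < n \<and> D k = D i) = D i"
      by (rule someI[of _ i]) (simp add: that)
    then show ?thesis unfolding \<theta>_def using same[OF _ that] by blast
  qed
  obtain p where p: "p permutes {0..<n}" "\<And>i. i < n \<Longrightarrow> Q $$ (i, p i) \<noteq> 0"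
    using GL_nonzero_permutation[OF Q(1)] by metis
  have spec_s: "spec s = image_mset D (mset_set {0..<n})"
    unfolding spec_similar[OF s'(2)] by (rule spec_diagonalizes[OF d(1)])
  have set_s: "set_mset (spec s) = D ` {0..<n}" by (simp add: spec_s)
  show ?thesis unfolding spec_iso_def
  proof (intro exI[of _ \<theta>] conjI ballI)
    show "inj_on \<theta> (set_mset (spec s))"
      unfolding set_s by (rule inj_onI) (auto simp: \<theta> same)
    show "\<theta> (\<psi> x) = \<psi> (\<theta> x)" if x: "x \<in># spec s" for x
    proof -
      have "x \<in> D ` {0..<n}" using x unfolding set_s .
      then obtain j where j: "j < n" "x = D j" by auto
      have "j \<in> p ` {0..<n}" using j(1) permutes_image[OF p(1)] by simp
      then obtain i where i: "i < n" "j = p i" by auto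
      have Qij: "Q $$ (i, j) \<noteq> 0" using p(2)[OF i(1)] i(2) by simp
      have "D i = \<psi> (D j)" "D' i = \<psi> (D' j)" using tw tw' i(1) j(1) Qij by blast+
      then have "\<theta> (\<psi> (D j)) = \<psi> (D' j)" using \<theta>[OF i(1)] by metis
      then show ?thesis unfolding j(2) \<theta>[OF j(1)] .
    qed
    have "image_mset \<theta> (spec s) = image_mset D' (mset_set {0..<n})"
      unfolding spec_s multiset.map_comp by (rule image_mset_cong) (simp add: \<theta>)
    then show "image_mset \<theta> (spec s) = spec t" unfolding spec_diagonalizes[OF d'] .
  qed
qed

text \<open>By equivariance the transported eigenvalues satisfy the conditions encoded by
  \<open>Q\<close> as well, so together with the eigenbasis of \<open>s\<close> they define a group
  element \<open>t'\<close>. Injectivity of \<open>\<theta>\<close> gives it the commutant of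
  \<open>s\<close>, and its spectrum makes it similar to \<open>t\<close>.\<close>

lemma z_rel_if_spec_iso:
  assumes s: "s \<in> carrier G" "semisimple_mat s" and t: "t \<in> carrier G" "semisimple_mat t"
    and iso: "spec_iso \<psi> \<psi> (spec s) (spec t)"
  shows "(s, t) \<in> z_rel G"
proof -
  obtain P D R and Q :: "'a alg_closure mat" where d: "diagonalizes n P s D" "\<forall>i<n. D i \<noteq> 0"
    and R: "R \<in> carrier_mat n n" "P * R = 1\<^sub>m n" "R * P = 1\<^sub>m n" "P \<in> carrier_mat n n"
    and Q: "Q \<in> GL n" "\<forall>D. (\<forall>i<n. D i \<noteq> 0) \<longrightarrow>
      (\<exists>s\<in>carrier G. diagonalizes n P s D) \<longleftrightarrow> (\<forall>i<n. \<forall>j<n. Q $$ (i, j) \<noteq> 0 \<longrightarrow> D i = \<psi> (D j))"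
    by (rule semisimple_carrier_E[OF s]) (rule that)
  obtain P2 D2 where d2: "diagonalizes n P2 t D2"
    using semisimple_iff_diagonalizes[OF G_carrier[OF t(1)]] t(2) by blast
  have set_s: "set_mset (spec s) = D ` {0..<n}" by (simp add: spec_diagonalizes[OF d(1)])
  obtain \<theta> where inj: "inj_on \<theta> (D ` {0..<n})" and equi: "\<And>x. x \<in> D ` {0..<n} \<Longrightarrow> \<theta> (\<psi> x) = \<psi> (\<theta> x)"
    and img: "image_mset \<theta> (spec s) = spec t"
    using iso unfolding spec_iso_def set_s by blast
  define D' where "D' = \<theta> \<circ> D"
  have spec_t: "spec t = image_mset D' (mset_set {0..<n})"
    unfolding img[symmetric] D'_def spec_diagonalizes[OF d(1)] multiset.map_comp ..
  have nz': "\<forall>i<n. D' i \<noteq> 0"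
  proof (intro allI impI)
    fix i assume "i < n"
    then have "D' i \<in># spec t" unfolding spec_t by simp
    then show "D' i \<noteq> 0" using spec_closed(2)[OF t] by metis
  qed
  have tw: "\<forall>i<n. \<forall>j<n. Q $$ (i, j) \<noteq> 0 \<longrightarrow> D i = \<psi> (D j)"
    using iffD1[OF Q(2)[THEN spec, THEN mp, OF d(2)]] s(1) d(1) by blast
  have "D' i = \<psi> (D' j)" if ij: "i < n" "j < n" "Q $$ (i, j) \<noteq> 0" for i j
  proof -
    have "D i = \<psi> (D j)" using tw ij by blast
    then show ?thesis using equi[of "D j"] ij by (simp add: D'_def)
  qed
  then obtain t' where t': "t' \<in> carrier G" "diagonalizes n P t' D'"
    using iffD2[OF Q(2)[THEN spec, THEN mp, OF nz']] by blast
  have same: "D i = D j \<longleftrightarrow> D' i = D' j" if "i < n" "j < n" for i j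
    using inj_on_eq_iff[OF inj, of "D i" "D j"] that by (auto simp: D'_def)
  have "A * s = s * A \<longleftrightarrow> A * t' = t' * A" if A: "A \<in> carrier_mat n n" for A
  proof -
    have sc: "s \<in> carrier_mat n n" and tc: "t' \<in> carrier_mat n n" using s t' G_carrier by simp_all
    have lift: "A * u = u * A \<longleftrightarrow> ac_mat A * ac_mat u = ac_mat u * ac_mat A" if "u \<in> carrier_mat n n" for u
      unfolding ac_mat_mult[OF A that, symmetric] ac_mat_mult[OF that A, symmetric] ac_mat_eq_iff ..
    define M where "M = R * ac_mat A * P"
    have M: "M \<in> carrier_mat n n" using R A by (simp add: M_def)
    have PMR: "P * M * R = ac_mat A"
      using R A by (simp add: M_def square_mult_assoc[where n = n] square_inv_cancel[where n = n])
    have "A * s = s * A \<longleftrightarrow> (\<forall>i<n. \<forall>j<n. M $$ (i, j) = 0 \<or> D i = D j)"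
      unfolding lift[OF sc] PMR[symmetric] by (rule diagonalizes_commute_iff[OF d(1) R(1-3) M])
    also have "\<dots> \<longleftrightarrow> (\<forall>i<n. \<forall>j<n. M $$ (i, j) = 0 \<or> D' i = D' j)"
      using same by blast
    also have "\<dots> \<longleftrightarrow> A * t' = t' * A"
      unfolding lift[OF tc] PMR[symmetric] by (rule diagonalizes_commute_iff[OF t'(2) R(1-3) M, symmetric])
    finally show ?thesis .
  qed
  then have st': "(s, t') \<in> z_rel G"
    unfolding z_rel_iff_similar using s(1) t'(1) similar_mat_refl[OF G_carrier[OF s(1)]] by blast
  have "spec t' = spec t" unfolding spec_t by (rule spec_diagonalizes[OF t'(2)])
  then have "similar_mat t' t" by (rule similar_if_spec_eq[OF t'(2) d2 _ n_small])
  then have "(t', t) \<in> z_rel G" by (rule z_rel_if_similar[OF t'(1) t(1)])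
  moreover have "trans (z_rel G)" using equiv_z_rel[OF group_G] by (rule equivE)
  ultimately show ?thesis using st' by (blast dest: transD)
qed

theorem z_rel_iff_spec_iso:
  assumes "s \<in> carrier G" "semisimple_mat s" "t \<in> carrier G" "semisimple_mat t"
  shows "(s, t) \<in> z_rel G \<longleftrightarrow> spec_iso \<psi> \<psi> (spec s) (spec t)"
  using spec_iso_if_z_rel[OF assms(1-3)] z_rel_if_spec_iso[OF assms] by (rule iffI)

end

section \<open>Comparison of two groups through their spectra\<close>

lemma semisimple_transfer:
  fixes G :: "'a :: {finite, field} mat monoid" and G' :: "'b :: {finite, field} mat monoid"
  assumes "semisimple_frame n G \<psi>" "semisimple_frame n G' \<psi>'"
    and embed: "\<forall>A \<pi>. finite (A :: 'a alg_closure set) \<longrightarrow> card A \<le> n \<longrightarrow> inj \<pi> \<longrightarrow> \<pi> ` A \<subseteq> A \<longrightarrow>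
      (\<exists>\<theta>. inj_on \<theta> A \<and> (\<forall>x\<in>A. \<theta> x \<noteq> 0 \<and> \<theta> (\<pi> x) = \<psi>' (\<theta> x)))"
    and s: "s \<in> carrier G" "semisimple_mat s"
  shows "\<exists>t\<in>carrier G'. semisimple_mat t \<and> spec_iso \<psi> \<psi>' (spec s) (spec t)"
proof -
  interpret A: semisimple_frame n G \<psi> by fact
  interpret B: semisimple_frame n G' \<psi>' by fact
  note S = A.spec_closed[OF s]
  let ?A = "set_mset (spec s)"
  have "\<psi> ` ?A = ?A" using arg_cong[OF S(1), of set_mset] by simp
  then have sub: "\<psi> ` ?A \<subseteq> ?A" by (rule equalityD1)
  have "card (set_mset M) \<le> size M" for M :: "'a alg_closure multiset"
    by (induction M) (auto simp: card_insert_if)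
  then have "card ?A \<le> n" using S(3) by metis
  from embed[rule_format, OF finite_set_mset this A.inj_psi sub]
  obtain \<theta> where \<theta>: "inj_on \<theta> ?A" "\<forall>x\<in>?A. \<theta> x \<noteq> 0 \<and> \<theta> (\<psi> x) = \<psi>' (\<theta> x)" by (elim exE conjE)
  let ?S = "image_mset \<theta> (spec s)"
  have "image_mset \<psi>' ?S = image_mset \<theta> (image_mset \<psi> (spec s))"
    unfolding multiset.map_comp by (rule image_mset_cong) (simp add: \<theta>(2))
  then have closed: "image_mset \<psi>' ?S = ?S" unfolding S(1) .
  have "size ?S = n" "0 \<notin># ?S" using S(3) \<theta>(2) by auto
  from B.realize[OF this closed]
  obtain t where t: "t \<in> carrier G'" "semisimple_mat t" "spec t = ?S" by (elim bexE conjE)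
  have "spec_iso \<psi> \<psi>' (spec s) (spec t)"
    unfolding spec_iso_def t(3) using \<theta> by (intro exI[of _ \<theta>]) simp
  then show ?thesis using t(1,2) by (intro bexI[of _ t] conjI)
qed

text \<open>Elements of the two groups are matched when their spectra are isomorphic across
  \<open>\<psi>\<close> and \<open>\<psi>'\<close>; composition of such isomorphisms carries one
  equivalence into the other. The embeddings of finite sets provide a partner for every
  element.\<close>

theorem num_semisimple_z_classes_eq:
  fixes G :: "'a :: {finite, field} mat monoid" and G' :: "'b :: {finite, field} mat monoid"
  assumes f: "semisimple_frame n G \<psi>" and f': "semisimple_frame n G' \<psi>'"
    and embed: "\<forall>A \<pi>. finite (A :: 'b alg_closure set) \<longrightarrow> card A \<le> n \<longrightarrow> inj \<pi> \<longrightarrow> \<pi> ` A \<subseteq> A \<longrightarrow>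
      (\<exists>\<theta>. inj_on \<theta> A \<and> (\<forall>x\<in>A. \<theta> x \<noteq> 0 \<and> \<theta> (\<pi> x) = \<psi> (\<theta> x)))"
    and embed': "\<forall>A \<pi>. finite (A :: 'a alg_closure set) \<longrightarrow> card A \<le> n \<longrightarrow> inj \<pi> \<longrightarrow> \<pi> ` A \<subseteq> A \<longrightarrow>
      (\<exists>\<theta>. inj_on \<theta> A \<and> (\<forall>x\<in>A. \<theta> x \<noteq> 0 \<and> \<theta> (\<pi> x) = \<psi>' (\<theta> x)))"
  shows "num_z_classes G semisimple_mat = num_z_classes G' semisimple_mat"
proof -
  interpret A: semisimple_frame n G \<psi> by fact
  interpret B: semisimple_frame n G' \<psi>' by fact
  let ?T = "\<lambda>s t. spec_iso \<psi> \<psi>' (spec s) (spec t)"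
  have symB: "spec_iso \<psi>' \<psi> (spec t) (spec s)" if "s \<in> carrier G" "semisimple_mat s" "?T s t" for s t
    by (rule spec_iso_sym[OF that(3) A.spec_closed(1)[OF that(1,2)]])
  have symA: "?T s t" if "t \<in> carrier G'" "semisimple_mat t" "spec_iso \<psi>' \<psi> (spec t) (spec s)" for s t
    by (rule spec_iso_sym[OF that(3) B.spec_closed(1)[OF that(1,2)]])
  have left: "\<exists>t\<in>{x \<in> carrier G'. semisimple_mat x}. ?T s t" if "s \<in> {x \<in> carrier G. semisimple_mat x}" for s
  proof -
    note s = CollectD[OF that, THEN conjunct1] CollectD[OF that, THEN conjunct2]
    from semisimple_transfer[OF f f' embed' s] show ?thesis
      by (elim bexE conjE) (intro bexI CollectI conjI)
  qed
  have right: "\<exists>s\<in>{x \<in> carrier G. semisimple_mat x}. ?T s t" if "t \<in> {x \<in> carrier G'. semisimple_mat x}" for t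
  proof -
    note t = CollectD[OF that, THEN conjunct1] CollectD[OF that, THEN conjunct2]
    from semisimple_transfer[OF f' f embed t] show ?thesis
      by (elim bexE conjE) (intro bexI CollectI conjI symA[OF t])
  qed
  have compat: "(s, s') \<in> z_rel G \<longleftrightarrow> (t, t') \<in> z_rel G'"
    if "s \<in> {x \<in> carrier G. semisimple_mat x}" "s' \<in> {x \<in> carrier G. semisimple_mat x}"
      "t \<in> {x \<in> carrier G'. semisimple_mat x}" "t' \<in> {x \<in> carrier G'. semisimple_mat x}"
      and T: "?T s t" and T': "?T s' t'" for s t s' t'
  proof -
    note s = CollectD[OF that(1), THEN conjunct1] CollectD[OF that(1), THEN conjunct2]
    note s' = CollectD[OF that(2), THEN conjunct1] CollectD[OF that(2), THEN conjunct2]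
    note t = CollectD[OF that(3), THEN conjunct1] CollectD[OF that(3), THEN conjunct2]
    note t' = CollectD[OF that(4), THEN conjunct1] CollectD[OF that(4), THEN conjunct2]
    have "spec_iso \<psi> \<psi> (spec s) (spec s') \<longleftrightarrow> spec_iso \<psi>' \<psi>' (spec t) (spec t')"
    proof
      assume "spec_iso \<psi> \<psi> (spec s) (spec s')"
      then show "spec_iso \<psi>' \<psi>' (spec t) (spec t')"
        by (rule spec_iso_trans[OF symB[OF s T] spec_iso_trans[OF _ T']])
    next
      assume "spec_iso \<psi>' \<psi>' (spec t) (spec t')"
      then show "spec_iso \<psi> \<psi> (spec s) (spec s')"
        by (rule spec_iso_trans[OF T spec_iso_trans[OF _ symB[OF s' T']]])
    qed
    then show ?thesis by (simp only: A.z_rel_iff_spec_iso[OF s s'] B.z_rel_iff_spec_iso[OF t t'])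
  qed
  show ?thesis unfolding num_z_classes_def
    by (rule card_quotient_eq[OF equiv_z_rel[OF A.group_G] equiv_z_rel[OF B.group_G] _ _ left right compat])
      (simp_all add: Collect_restrict)
qed

section \<open>Periodic points of Frobenius maps\<close>

text \<open>For \<open>d = 0\<close> this is true of every point, so the condition
  \<open>d > 0\<close> accompanies it wherever a period is meant.\<close>

definition exact_period :: "('x \<Rightarrow> 'x) \<Rightarrow> nat \<Rightarrow> 'x \<Rightarrow> bool" where
  "exact_period f d x \<longleftrightarrow> (f ^^ d) x = x \<and> (\<forall>e. 0 < e \<and> e < d \<longrightarrow> (f ^^ e) x \<noteq> x)"

lemma inj_funpow_eq_iff: "inj f \<Longrightarrow> (f ^^ k) x = (f ^^ k) y \<longleftrightarrow> x = y" for f :: "'x \<Rightarrow> 'x"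
  using inj_fn[of f k] by (simp add: inj_eq)

lemma exact_period_funpow_eq_iff:
  assumes f: "inj f" and d: "d > 0" "exact_period f d x"
  shows "(f ^^ j) x = (f ^^ k) x \<longleftrightarrow> j mod d = k mod d"
proof -
  have fd: "(f ^^ d) x = x" using d(2) by (simp add: exact_period_def)
  have less: "(f ^^ j) x \<noteq> (f ^^ k) x" if "j < k" "k < d" for j k
  proof
    assume e: "(f ^^ j) x = (f ^^ k) x"
    have "k = j + (k - j)" using that by simp
    then have "(f ^^ k) x = (f ^^ j) ((f ^^ (k - j)) x)" by (metis funpow_add comp_apply)
    then have "(f ^^ (k - j)) x = x" using e inj_funpow_eq_iff[OF f] by metis
    then show False using d(2) that by (simp add: exact_period_def)
  qed
  have "(f ^^ (j mod d)) x = (f ^^ (k mod d)) x \<longleftrightarrow> j mod d = k mod d"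
    using less[of "j mod d" "k mod d"] less[of "k mod d" "j mod d"] d(1)
    by (metis linorder_neqE_nat mod_less_divisor)
  then show ?thesis by (simp add: funpow_mod_eq[OF fd])
qed

lemma exact_period_exists:
  assumes "finite A" "inj f" "f ` A \<subseteq> A" "x \<in> A"
  obtains d where "d > 0" "exact_period f d x"
proof -
  have in_A: "(f ^^ k) x \<in> A" for k using assms(3,4) by (induction k) auto
  have "\<not> inj (\<lambda>k :: nat. (f ^^ k) x)"
  proof
    assume i: "inj (\<lambda>k :: nat. (f ^^ k) x)"
    have "finite (range (\<lambda>k :: nat. (f ^^ k) x))" by (rule finite_subset[OF _ assms(1)]) (auto simp: in_A)
    then show False using finite_imageD[OF _ i] infinite_UNIV_nat by blast
  qed
  then obtain j k where jk: "j < k" "(f ^^ j) x = (f ^^ k) x"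
    unfolding inj_def by (metis linorder_neqE_nat)
  have "k = j + (k - j)" using jk by simp
  then have "(f ^^ k) x = (f ^^ j) ((f ^^ (k - j)) x)" by (metis funpow_add comp_apply)
  then have "(f ^^ (k - j)) x = x" using jk(2) inj_funpow_eq_iff[OF assms(2)] by metis
  then have ex: "\<exists>d. 0 < d \<and> (f ^^ d) x = x" using jk(1) by (intro exI[of _ "k - j"]) simp
  define d where "d = (LEAST d. 0 < d \<and> (f ^^ d) x = x)"
  have "0 < d \<and> (f ^^ d) x = x" unfolding d_def by (rule LeastI_ex[OF ex])
  moreover have "(f ^^ e) x \<noteq> x" if "0 < e" "e < d" for e
    using not_less_Least[of e "\<lambda>d. 0 < d \<and> (f ^^ d) x = x"] that unfolding d_def by simp
  ultimately show thesis using that[of d] by (simp add: exact_period_def)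
qed

text \<open>
  One orbit at a time: an orbit of length \<open>d\<close> is sent to the orbit of a fresh point of exact period
  \<open>d\<close>, which exists because fewer than \<open>n\<close> points are already in use.
\<close>

lemma equivariant_embedding:
  fixes g :: "'y :: zero \<Rightarrow> 'y"
  assumes "finite A" "card A \<le> n" and f: "inj f" "f ` A \<subseteq> A" and g: "inj g" "g 0 = 0"
    and plenty: "\<And>d. d > 0 \<Longrightarrow> n \<le> card {x. x \<noteq> 0 \<and> exact_period g d x}"
  shows "\<exists>\<theta>. inj_on \<theta> A \<and> (\<forall>x\<in>A. \<theta> x \<noteq> 0 \<and> \<theta> (f x) = g (\<theta> x))"
  using assms(1,2) f(2)
proof (induction A rule: finite_psubset_induct)
  case (psubset A)
  show ?case
  proof (cases "A = {}")
    case False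
    then obtain a where a: "a \<in> A" by blast
    obtain d where d: "d > 0" "exact_period f d a"
      using exact_period_exists[OF psubset.hyps(1) f(1) psubset.prems(2) a] by metis
    define B where "B = range (\<lambda>k. (f ^^ k) a)"
    have aB: "a \<in> B" unfolding B_def by (rule range_eqI[of _ _ 0]) simp
    have B_A: "B \<subseteq> A"
    proof -
      have "(f ^^ k) a \<in> A" for k using a psubset.prems(2) by (induction k) auto
      then show ?thesis by (auto simp: B_def)
    qed
    have fB: "f y \<in> B" if y: "y \<in> B" for y
    proof -
      obtain k where "y = (f ^^ k) a" using y by (auto simp: B_def)
      then show ?thesis unfolding B_def by (intro range_eqI[of _ _ "Suc k"]) simp
    qed
    \<comment> \<open>The complement of the orbit must be invariant as well. A preimage of an orbit
      point lies in the orbit because one can go once around before stepping back.\<close>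
    have B_back: "y \<in> B" if y: "f y \<in> B" for y
    proof -
      obtain k where k: "f y = (f ^^ k) a" using y by (auto simp: B_def)
      have "(f ^^ k) a = (f ^^ (k + d)) a"
        unfolding exact_period_funpow_eq_iff[OF f(1) d] by simp
      also have "k + d = Suc (k + d - 1)" using d(1) by simp
      finally have "f y = f ((f ^^ (k + d - 1)) a)" using k by (metis funpow.simps(2) comp_apply)
      then have "y = (f ^^ (k + d - 1)) a" using f(1) by (simp add: inj_eq)
      then show ?thesis unfolding B_def by (rule range_eqI)
    qed
    have ps: "A - B \<subset> A" using a aB by blast
    have card_less: "card (A - B) < n"
      using psubset_card_mono[OF psubset.hyps(1) ps] psubset.prems(1) by linarith
    have closed: "f ` (A - B) \<subseteq> A - B"
    proof (rule image_subsetI)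
      fix y assume "y \<in> A - B"
      then show "f y \<in> A - B" using psubset.prems(2) B_back[of y] by blast
    qed
    obtain \<eta> where \<eta>: "inj_on \<eta> (A - B)" "\<forall>x\<in>A - B. \<eta> x \<noteq> 0 \<and> \<eta> (f x) = g (\<eta> x)"
      using psubset.IH[OF ps less_imp_le[OF card_less] closed] by (elim exE conjE)
    let ?E = "{x. x \<noteq> 0 \<and> exact_period g d x}"
    have fin: "finite (A - B)" using psubset.hyps(1) by simp
    have "card (\<eta> ` (A - B)) < card ?E"
      using card_image_le[OF fin, of \<eta>] card_less plenty[OF d(1)] by linarith
    then have "\<not> ?E \<subseteq> \<eta> ` (A - B)" using card_mono[OF finite_imageI[OF fin], of ?E \<eta>] by linarith
    then obtain x where x: "x \<noteq> 0" "exact_period g d x" "x \<notin> \<eta> ` (A - B)" by blast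
    have \<eta>_closed: "(g ^^ k) (\<eta> y) \<in> \<eta> ` (A - B)" if "y \<in> A - B" for k y
    proof -
      have "(f ^^ k) y \<in> A - B \<and> (g ^^ k) (\<eta> y) = \<eta> ((f ^^ k) y)"
      proof (induction k)
        case (Suc k)
        then have "f ((f ^^ k) y) \<in> A - B" using closed by blast
        then show ?case using Suc \<eta>(2) by simp
      qed (use that in simp)
      then show ?thesis by blast
    qed
    have fresh: "(g ^^ k) x \<notin> \<eta> ` (A - B)" for k
    proof
      assume "(g ^^ k) x \<in> \<eta> ` (A - B)"
      then obtain y where y: "y \<in> A - B" "(g ^^ k) x = \<eta> y" by blast
      \<comment> \<open>From the \<open>k\<close>-th iterate, \<open>m\<close> more steps complete a
        multiple of the period and return to \<open>x\<close>. The multiple \<open>d * Suc k\<close>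
        is large enough for the subtraction not to be cut off at \<open>0\<close>.\<close>
      define m where "m = d * Suc k - k"
      have "(g ^^ m) (\<eta> y) = (g ^^ (m + k)) x" using y(2) by (simp add: funpow_add)
      also have "m + k = d * Suc k"
      proof -
        have "1 * k \<le> d * Suc k" using d(1) by (intro mult_le_mono) simp_all
        then show ?thesis by (simp add: m_def)
      qed
      also have "(g ^^ (d * Suc k)) x = (g ^^ 0) x"
        unfolding exact_period_funpow_eq_iff[OF g(1) d(1) x(2)] by simp
      finally have "x \<in> \<eta> ` (A - B)" using \<eta>_closed[OF y(1), of m] by simp
      then show False using x(3) by blast
    qed
    have nz: "(g ^^ k) x \<noteq> 0" for k
    proof -
      have "(g ^^ k) 0 = 0" using g(2) by (induction k) simp_all
      then show ?thesis using inj_funpow_eq_iff[OF g(1), of k x 0] x(1) by simp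
    qed
    \<comment> \<open>Both orbits have length \<open>d\<close>, so the value of
      \<open>\<theta>\<close> at a point of the orbit is independent of the exponent chosen for
      it.\<close>
    have same: "(f ^^ j) a = (f ^^ k) a \<longleftrightarrow> (g ^^ j) x = (g ^^ k) x" for j k
      unfolding exact_period_funpow_eq_iff[OF f(1) d] exact_period_funpow_eq_iff[OF g(1) d(1) x(2)] ..
    define \<theta> where "\<theta> y = (if y \<in> B then (g ^^ (SOME k. (f ^^ k) a = y)) x else \<eta> y)" for y
    have \<theta>_B: "\<theta> ((f ^^ k) a) = (g ^^ k) x" for k
    proof -
      have "(f ^^ (SOME j. (f ^^ j) a = (f ^^ k) a)) a = (f ^^ k) a" by (rule someI) (rule refl)
      then have "(g ^^ (SOME j. (f ^^ j) a = (f ^^ k) a)) x = (g ^^ k) x" by (simp only: same)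
      then show ?thesis by (simp add: \<theta>_def B_def)
    qed
    have B_E: "\<exists>k. y = (f ^^ k) a" if "y \<in> B" for y using that by (auto simp: B_def)
    have \<theta>_rest: "\<theta> y = \<eta> y" if "y \<in> A - B" for y using that by (simp add: \<theta>_def)
    have "inj_on \<theta> A"
    proof (rule inj_onI)
      fix y z assume yz: "y \<in> A" "z \<in> A" "\<theta> y = \<theta> z"
      consider "y \<in> B" "z \<in> B" | "y \<in> B" "z \<in> A - B" | "y \<in> A - B" "z \<in> B" | "y \<in> A - B" "z \<in> A - B"
        using yz by blast
      then show "y = z"
      proof cases
        case 1
        then show ?thesis using yz(3) B_E same \<theta>_B by metis
      next
        case 2
        then have False using yz(3) B_E \<theta>_B fresh \<theta>_rest by (metis imageI)
        then show ?thesis ..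
      next
        case 3
        then have False using yz(3) B_E \<theta>_B fresh \<theta>_rest by (metis imageI)
        then show ?thesis ..
      next
        case 4
        then show ?thesis using yz(3) \<theta>_rest \<eta>(1) by (simp add: inj_on_eq_iff)
      qed
    qed
    moreover have "\<theta> y \<noteq> 0 \<and> \<theta> (f y) = g (\<theta> y)" if "y \<in> A" for y
    proof (cases "y \<in> B")
      case True
      then obtain k where k: "y = (f ^^ k) a" using B_E by blast
      have "f y = (f ^^ Suc k) a" by (simp add: k)
      then have "\<theta> (f y) = (g ^^ Suc k) x" by (simp only: \<theta>_B)
      then show ?thesis unfolding k \<theta>_B using nz[of k] by simp
    next
      case False
      then have y: "y \<in> A - B" "f y \<in> A - B" using that closed by blast+
      show ?thesis unfolding \<theta>_rest[OF y(1)] \<theta>_rest[OF y(2)] using \<eta>(2) y(1) by blast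
    qed
    ultimately show ?thesis by blast
  qed simp
qed

text \<open>From the fixed points of the \<open>d\<close>-th iterate those of all smaller iterates
  are removed, not only those for divisors of \<open>d\<close>: for \<open>q \<ge> 3\<close> the
  crude sum of \<open>q^e + 1\<close> over \<open>1 \<le> e < d\<close> is still at most
  \<open>q^d - q\<close>. For \<open>d = 1\<close> nothing is removed and \<open>q - 1\<close>
  points are guaranteed.\<close>

lemma exact_period_count:
  fixes g :: "'y :: zero \<Rightarrow> 'y"
  assumes q: "q \<ge> 3" and d: "d > 0"
    and F: "\<And>d. d > 0 \<Longrightarrow> finite {x. x \<noteq> 0 \<and> (g ^^ d) x = x}"
      "\<And>d. d > 0 \<Longrightarrow> q ^ d - 1 \<le> card {x. x \<noteq> 0 \<and> (g ^^ d) x = x}"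
      "\<And>d. d > 0 \<Longrightarrow> card {x. x \<noteq> 0 \<and> (g ^^ d) x = x} \<le> q ^ d + 1"
  shows "q - 1 \<le> card {x. x \<noteq> 0 \<and> exact_period g d x}"
proof -
  define F' where "F' d = {x. x \<noteq> 0 \<and> (g ^^ d) x = x}" for d
  have E: "{x. x \<noteq> 0 \<and> exact_period g d x} = F' d - (\<Union>e\<in>{1..<d}. F' e)"
    by (auto simp: F'_def exact_period_def Suc_le_eq)
  have arith: "q + (\<Sum>e\<in>{1..<Suc m}. q ^ e + 1) \<le> q ^ Suc m" for m
  proof (induction m)
    case (Suc m)
    have "(\<Sum>e\<in>{1..<Suc (Suc m)}. q ^ e + 1) = (\<Sum>e\<in>{1..<Suc m}. q ^ e + 1) + (q ^ Suc m + 1)"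
      by (rule sum.atLeastLessThan_Suc) simp
    then have "q + (\<Sum>e\<in>{1..<Suc (Suc m)}. q ^ e + 1) \<le> q ^ Suc m + (q ^ Suc m + 1)"
      using Suc.IH by linarith
    also have "\<dots> \<le> 3 * q ^ Suc m" using one_le_power[of q "Suc m"] q by linarith
    also have "\<dots> \<le> q ^ Suc (Suc m)" using q by simp
    finally show ?case .
  qed simp
  have "card (\<Union>e\<in>{1..<d}. F' e) \<le> (\<Sum>e\<in>{1..<d}. card (F' e))"
    by (rule card_UN_le) simp
  also have "\<dots> \<le> (\<Sum>e\<in>{1..<d}. q ^ e + 1)"
    by (rule sum_mono) (use F(3) in \<open>auto simp: F'_def\<close>)
  finally have "card (\<Union>e\<in>{1..<d}. F' e) \<le> q ^ d - q"
    using arith[of "d - 1"] d by simp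
  moreover have "card (F' d) - card (\<Union>e\<in>{1..<d}. F' e) \<le> card (F' d - (\<Union>e\<in>{1..<d}. F' e))"
    by (rule diff_card_le_card_Diff) (use F(1) in \<open>auto simp: F'_def\<close>)
  moreover have "q ^ d - 1 \<le> card (F' d)" using F(2)[OF d] by (simp add: F'_def)
  moreover have "q \<le> q ^ d" using self_le_power[of q d] q d by simp
  ultimately show ?thesis unfolding E using q by linarith
qed

section \<open>Fixed points of iterated Frobenius maps\<close>

lemma card_roots_of_unity:
  assumes N: "of_nat N \<noteq> (0 :: 'k :: alg_closed_field)"
  shows "finite {x :: 'k. x ^ N = 1}" "card {x :: 'k. x ^ N = 1} = N"
proof -
  have N0: "N > 0" using N by (cases N) auto
  define f :: "'k poly" where "f = monom 1 N - 1"
  have ev: "poly f x = x ^ N - 1" for x by (simp add: f_def poly_monom)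
  have f0: "f \<noteq> 0" using ev[of 0] N0 by (auto simp: zero_power)
  have deg: "degree f = N"
    using N0 degree_add_eq_left[of "- 1 :: 'k poly" "monom 1 N"] by (simp add: f_def degree_monom_eq)
  \<comment> \<open>The derivative \<open>N X^(N-1)\<close> of \<open>X^N - 1\<close> vanishes only
    at \<open>0\<close>, since \<open>N\<close> is nonzero in the field; so all roots are
    simple.\<close>
  have pd: "poly (pderiv f) x \<noteq> 0" if "poly f x = 0" for x
  proof -
    have "x \<noteq> 0" using that N0 by (auto simp: ev zero_power)
    then show ?thesis using N by (simp add: f_def pderiv_diff pderiv_monom poly_monom)
  qed
  have simple: "order x f \<le> 1" for x
  proof (rule ccontr)
    assume "\<not> order x f \<le> 1"
    then have "[:- x, 1:] ^ 2 dvd f"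
      using order_1[of x f] by (intro dvd_trans[OF le_imp_power_dvd[of 2 "order x f"]]) simp_all
    then obtain g where g: "f = [:- x, 1:] ^ 2 * g" by (rule dvdE)
    have "poly f x = 0" unfolding g by simp
    moreover have "poly (pderiv f) x = 0"
      unfolding g power2_eq_square pderiv_mult poly_add poly_mult by simp
    ultimately show False using pd by blast
  qed
  obtain M where M: "size M = degree f" "f = smult (lead_coeff f) (\<Prod>x\<in>#M. [:- x, 1:])"
    using alg_closed_imp_factorization[OF f0] by blast
  have "proots f = proots (\<Prod>x\<in>#M. [:- x, 1:])"
    by (subst M(2)) (simp add: f0)
  also have "\<dots> = M"
  proof -
    have "0 \<notin># image_mset (\<lambda>x. [:- x, 1:]) M" by auto
    from proots_prod_mset[OF this] show ?thesis by (simp add: multiset.map_comp comp_def)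
  qed
  finally have size: "size (proots f) = N" using M(1) deg by simp
  have roots: "{x. x ^ N = 1} = set_mset (proots f)" using f0 by (auto simp: ev)
  show "finite {x :: 'k. x ^ N = 1}" unfolding roots by simp
  have "count (proots f) x = 1" if "x \<in># proots f" for x
    using simple[of x] order_root[of f x] that f0 by simp
  then have "size (proots f) = card (set_mset (proots f))"
    unfolding size_multiset_overloaded_eq by simp
  then show "card {x :: 'k. x ^ N = 1} = N" unfolding roots using size by simp
qed

lemma power_minus_one_eq_1_iff: "x \<noteq> (0 :: 'k :: field) \<Longrightarrow> m > 0 \<Longrightarrow> x ^ (m - 1) = 1 \<longleftrightarrow> x ^ m = x"
  by (cases m) auto

lemma card_power_fixed:
  assumes q: "of_nat q = (0 :: 'k :: alg_closed_field)" "q > 0" and d: "d > 0"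
  shows "finite {x :: 'k. x \<noteq> 0 \<and> x ^ q ^ d = x}" "card {x :: 'k. x \<noteq> 0 \<and> x ^ q ^ d = x} = q ^ d - 1"
proof -
  have q1: "q ^ d > 1"
  proof -
    have "q \<noteq> 1" using q(1) by auto
    then have "q > 1" using q(2) by simp
    then show ?thesis using d by (rule one_less_power)
  qed
  have "of_nat (q ^ d - 1) = (of_nat q ^ d - 1 :: 'k)" using q1 by (simp add: of_nat_diff)
  also have "\<dots> = - 1" using q(1) d by (simp add: zero_power)
  finally have "of_nat (q ^ d - 1) \<noteq> (0 :: 'k)" by simp
  note c = card_roots_of_unity[OF this]
  have "x \<noteq> 0 \<and> x ^ q ^ d = x \<longleftrightarrow> x ^ (q ^ d - 1) = 1" for x :: 'k
  proof (cases "x = 0")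
    case False
    have "q ^ d > 0" using q1 by linarith
    from power_minus_one_eq_1_iff[OF False this] show ?thesis using False by blast
  qed (use q1 in \<open>simp add: zero_power\<close>)
  then have "{x :: 'k. x \<noteq> 0 \<and> x ^ q ^ d = x} = {x. x ^ (q ^ d - 1) = 1}" by blast
  then show "finite {x :: 'k. x \<noteq> 0 \<and> x ^ q ^ d = x}" "card {x :: 'k. x \<noteq> 0 \<and> x ^ q ^ d = x} = q ^ d - 1"
    using c by simp_all
qed

lemma card_inverse_power_fixed:
  assumes q: "of_nat q = (0 :: 'k :: alg_closed_field)" and d: "d > 0"
  shows "finite {x :: 'k. x \<noteq> 0 \<and> inverse (x ^ q ^ d) = x}" "card {x :: 'k. x \<noteq> 0 \<and> inverse (x ^ q ^ d) = x} = q ^ d + 1"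
proof -
  have e: "of_nat (q ^ d + 1) = (1 :: 'k)" using q d by (simp add: zero_power)
  have "of_nat (q ^ d + 1) \<noteq> (0 :: 'k)" unfolding e by simp
  note c = card_roots_of_unity[OF this]
  have "x \<noteq> 0 \<and> inverse (x ^ q ^ d) = x \<longleftrightarrow> x ^ (q ^ d + 1) = 1" for x :: 'k
    by (cases "x = 0") (auto simp: field_simps)
  then have "{x :: 'k. x \<noteq> 0 \<and> inverse (x ^ q ^ d) = x} = {x. x ^ (q ^ d + 1) = 1}" by blast
  then show "finite {x :: 'k. x \<noteq> 0 \<and> inverse (x ^ q ^ d) = x}"
    "card {x :: 'k. x \<noteq> 0 \<and> inverse (x ^ q ^ d) = x} = q ^ d + 1"
    using c by simp_all
qed

lemma funpow_power: "((\<lambda>x :: 'k :: monoid_mult. x ^ q) ^^ d) x = x ^ q ^ d"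
  by (induction d) (simp_all add: power_mult[symmetric] mult.commute)

lemma funpow_inverse_power:
  "((\<lambda>x :: 'k :: field. inverse (x ^ q)) ^^ d) x = (if even d then x ^ q ^ d else inverse (x ^ q ^ d))"
  by (induction d) (simp_all add: power_mult[symmetric] power_inverse mult.commute)

lemma frobenius_plenty:
  assumes q: "of_nat q = (0 :: 'k :: alg_closed_field)" "q \<ge> 3" and d: "d > 0" and n: "n < q"
  shows "n \<le> card {x :: 'k. x \<noteq> 0 \<and> exact_period (\<lambda>x. x ^ q) d x}"
proof -
  have "q - 1 \<le> card {x :: 'k. x \<noteq> 0 \<and> exact_period (\<lambda>x. x ^ q) d x}"
    by (rule exact_period_count[OF q(2) d]) (use card_power_fixed[OF q(1)] q(2) in \<open>simp_all add: funpow_power\<close>)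
  then show ?thesis using n by linarith
qed

text \<open>The iterates alternate between the power \<open>q^d\<close> for even \<open>d\<close>,
  with \<open>q^d - 1\<close> nonzero fixed points, and its inverse for odd \<open>d\<close>, with
  \<open>q^d + 1\<close> of them. The two-sided bounds in \<open>exact_period_count\<close> cover
  both parities.\<close>

lemma inverse_frobenius_plenty:
  assumes q: "of_nat q = (0 :: 'k :: alg_closed_field)" "q \<ge> 3" and d: "d > 0" and n: "n < q"
  shows "n \<le> card {x :: 'k. x \<noteq> 0 \<and> exact_period (\<lambda>x. inverse (x ^ q)) d x}"
proof -
  have q0: "q > 0" using q(2) by simp
  have "q - 1 \<le> card {x :: 'k. x \<noteq> 0 \<and> exact_period (\<lambda>x. inverse (x ^ q)) d x}"
  proof (rule exact_period_count[OF q(2) d])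
    fix d :: nat assume "d > 0"
    note c = card_power_fixed[OF q(1) q0 this] card_inverse_power_fixed[OF q(1) this]
    show "finite {x :: 'k. x \<noteq> 0 \<and> ((\<lambda>x. inverse (x ^ q)) ^^ d) x = x}"
      "q ^ d - 1 \<le> card {x :: 'k. x \<noteq> 0 \<and> ((\<lambda>x. inverse (x ^ q)) ^^ d) x = x}"
      "card {x :: 'k. x \<noteq> 0 \<and> ((\<lambda>x. inverse (x ^ q)) ^^ d) x = x} \<le> q ^ d + 1"
      using c by (cases "even d"; simp add: funpow_inverse_power)+
  qed
  then show ?thesis using n by linarith
qed

section \<open>Semisimple elements of the two groups\<close>

lemma GL_cancel_left:
  assumes "A \<in> GL n" "B \<in> carrier_mat n n" "C \<in> carrier_mat n n"
  shows "A * B = A * C \<longleftrightarrow> B = C"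
proof
  obtain A' where A': "A \<in> carrier_mat n n" "A' \<in> carrier_mat n n" "A' * A = 1\<^sub>m n"
    using GL_E[OF assms(1)] by metis
  assume "A * B = A * C"
  then have "A' * (A * B) = A' * (A * C)" by (rule arg_cong)
  then show "B = C" by (simp only: square_inv_cancel[OF A'(2,1) assms(2) A'(3)] square_inv_cancel[OF A'(2,1) assms(3) A'(3)])
qed simp

lemma GL_cancel_right:
  assumes "A \<in> GL n" "B \<in> carrier_mat n n" "C \<in> carrier_mat n n"
  shows "B * A = C * A \<longleftrightarrow> B = C"
proof
  obtain A' where A': "A \<in> carrier_mat n n" "A' \<in> carrier_mat n n" "A * A' = 1\<^sub>m n"
    using GL_E[OF assms(1)] by metis
  have e: "B * A * A' = B" if "B \<in> carrier_mat n n" for B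
    using that A' by (simp add: square_mult_assoc[where n = n])
  assume "B * A = C * A"
  then have "B * A * A' = C * A * A'" by (rule arg_cong)
  then show "B = C" by (simp only: e[OF assms(2)] e[OF assms(3)])
qed simp

lemma mat_diag_GL: "(\<forall>i<n. D i \<noteq> 0) \<Longrightarrow> mat_diag n D \<in> GL n" for D :: "nat \<Rightarrow> 'a :: field"
  by (simp add: GL_iff_det det_mat_diag)

lemma mat_diag_intertwine_iff:
  fixes Q :: "'a :: field mat"
  assumes "Q \<in> carrier_mat n n"
  shows "Q * mat_diag n E = mat_diag n D * Q \<longleftrightarrow> (\<forall>i<n. \<forall>j<n. Q $$ (i, j) \<noteq> 0 \<longrightarrow> D i = E j)"
  using assms unfolding mat_diag_mult_left[OF assms] mat_diag_mult_right[OF assms]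
  by (auto simp: mat_eq_iff mult.commute[of _ "E _"]) metis+

lemma mat_diag_invariant_iff:
  fixes Q :: "'a :: field mat"
  assumes Q: "Q \<in> carrier_mat n n" and nz: "\<forall>i<n. E i \<noteq> 0"
  shows "mat_diag n D * Q * mat_diag n E = Q \<longleftrightarrow> (\<forall>i<n. \<forall>j<n. Q $$ (i, j) \<noteq> 0 \<longrightarrow> D i = inverse (E j))"
proof -
  have E': "mat_diag n E * mat_diag n (\<lambda>j. inverse (E j)) = 1\<^sub>m n"
    unfolding mat_diag_diag using nz by (intro eq_matI) (auto simp: mat_diag_def)
  have c: "mat_diag n D * Q \<in> carrier_mat n n" using Q by simp
  have "mat_diag n D * Q * mat_diag n E = Q \<longleftrightarrow>
      mat_diag n D * Q * mat_diag n E * mat_diag n (\<lambda>j. inverse (E j)) = Q * mat_diag n (\<lambda>j. inverse (E j))"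
    by (rule GL_cancel_right[symmetric]) (use Q nz in \<open>simp_all add: mat_diag_GL\<close>)
  also have "mat_diag n D * Q * mat_diag n E * mat_diag n (\<lambda>j. inverse (E j)) = mat_diag n D * Q"
    unfolding square_mult_assoc[OF c mat_diag_dim mat_diag_dim] E' using c by (rule square_mult_one(2))
  finally show ?thesis unfolding mat_diag_intertwine_iff[OF Q, symmetric] by metis
qed

text \<open>The parameter \<open>\<phi>\<close> is redundant; it makes the locale predicate mention the field.\<close>

locale frobenius_field =
  fixes q :: nat and \<phi> :: "'k :: field \<Rightarrow> 'k"
  assumes phi: "\<phi> = (\<lambda>x. x ^ q)" and phi_add: "\<phi> (x + y) = \<phi> x + \<phi> y" and q_pos: "q > 0"
begin

lemma frob_add: "(x + y :: 'k) ^ q = x ^ q + y ^ q"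
  using phi_add unfolding phi .

sublocale frob: semiring_hom "\<lambda>x :: 'k. x ^ q"
  by unfold_locales (auto simp: frob_add power_mult_distrib q_pos)

lemma bar_closed: "A \<in> carrier_mat n n \<Longrightarrow> bar_mat q (A :: 'k mat) \<in> carrier_mat n n"
  by (simp add: bar_mat_def)

lemma bar_mult: "A \<in> carrier_mat n n \<Longrightarrow> B \<in> carrier_mat n n \<Longrightarrow> bar_mat q (A * B :: 'k mat) = bar_mat q A * bar_mat q B"
  unfolding bar_mat_def by (rule frob.mat_hom_mult)

lemma bar_GL:
  assumes "(A :: 'k mat) \<in> GL n"
  shows "bar_mat q A \<in> GL n"
proof -
  obtain B where B: "A \<in> carrier_mat n n" "B \<in> carrier_mat n n" "A * B = 1\<^sub>m n"
    using GL_E[OF assms] by metis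
  have "bar_mat q A * bar_mat q B = 1\<^sub>m n"
    unfolding bar_mult[OF B(1,2), symmetric] B(3) by (simp add: bar_mat_def frob.mat_hom_one)
  then show ?thesis by (rule GL_I[OF bar_closed[OF B(1)] bar_closed[OF B(2)]])
qed

lemma bar_mat_diag: "bar_mat q (mat_diag n D) = mat_diag n (\<lambda>i. (D i :: 'k) ^ q)"
  using q_pos by (intro eq_matI) (auto simp: bar_mat_def mat_diag_def)

lemma inj_frob: "inj (\<lambda>x :: 'k. x ^ q)"
proof (rule injI)
  fix x y :: 'k assume "x ^ q = y ^ q"
  moreover have "x ^ q = (x - y) ^ q + y ^ q" using frob_add[of "x - y" y] by simp
  ultimately show "x = y" by simp
qed

lemma inj_inverse_frob: "inj (\<lambda>x :: 'k. inverse (x ^ q))"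
  using inj_frob by (auto simp: inj_def)

end

lemma bar_ac_mat: "bar_mat q (ac_mat s) = ac_mat (bar_mat q s)"
  by (auto simp: bar_mat_def mat_eq_iff)

lemma bar_mat_transpose: "bar_mat q (A\<^sup>T) = (bar_mat q A)\<^sup>T"
  unfolding bar_mat_def by (simp add: map_mat_transpose)

lemma ac_mat_transpose: "(ac_mat A)\<^sup>T = ac_mat (A\<^sup>T)"
  by (simp add: map_mat_transpose)

lemma diagonal_conjugate:
  assumes P: "P \<in> GL n" "R \<in> carrier_mat n n" "P * R = 1\<^sub>m n" "R * P = 1\<^sub>m n"
    and nz: "\<forall>i<n. (D i :: 'a :: field) \<noteq> 0"
  shows "P * mat_diag n D * R \<in> GL n" "(P * mat_diag n D * R) * P = P * mat_diag n D"
proof -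
  have c: "P \<in> carrier_mat n n" using P(1) by (rule GL_carrier)
  have "R \<in> GL n" using GL_I[OF P(2) c P(4)] .
  then show "P * mat_diag n D * R \<in> GL n" using P(1) mat_diag_GL[OF nz] by (intro GL_mult)
  have PD: "P * mat_diag n D \<in> carrier_mat n n" using c by simp
  show "(P * mat_diag n D * R) * P = P * mat_diag n D"
    unfolding square_mult_assoc[OF PD P(2) c] P(4) using PD by (rule square_mult_one(2))
qed

text \<open>The conjugate of \<open>mat_diag n D\<close> by \<open>P\<close> is defined over the
  base field iff the entrywise \<open>q\<close>-power fixes it. Moved to the basis given by
  \<open>P\<close>, this says that \<open>R * bar_mat q P\<close> intertwines the diagonal matrix
  with its \<open>q\<close>-th power, a condition on each nonzero entry separately.\<close>

lemma GL_twist: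
  fixes P :: "'a :: {finite, field} alg_closure mat"
  assumes frob: "frobenius_field q (\<lambda>x :: 'a alg_closure. x ^ q)" and q: "q = card (UNIV :: 'a set)"
    and P: "P \<in> GL n" "R \<in> carrier_mat n n" "P * R = 1\<^sub>m n" "R * P = 1\<^sub>m n" and nz: "\<forall>i<n. D i \<noteq> 0"
  shows "(\<exists>s\<in>GL n. diagonalizes n P s D) \<longleftrightarrow>
    (\<forall>i<n. \<forall>j<n. (R * bar_mat q P) $$ (i, j) \<noteq> 0 \<longrightarrow> D i = D j ^ q)"
proof -
  interpret frobenius_field q "\<lambda>x :: 'a alg_closure. x ^ q" by fact
  have c: "P \<in> carrier_mat n n" "bar_mat q P \<in> carrier_mat n n" using P(1) GL_carrier bar_closed by blast+
  let ?Q = "R * bar_mat q P" and ?D = "mat_diag n D" and ?E = "mat_diag n (\<lambda>i. D i ^ q)"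
  have Q: "?Q \<in> carrier_mat n n" using c P(2) by simp
  have bar_fixed: "bar_mat q (ac_mat s) = ac_mat s" for s :: "'a mat"
    unfolding bar_ac_mat unfolding bar_mat_def q by (auto simp: mat_eq_iff power_card_UNIV)
  have eqn: "bar_mat q M = M \<longleftrightarrow> ?Q * ?E = ?D * ?Q" if M: "M \<in> carrier_mat n n" "M * P = P * ?D" for M
  proof -
    have bM: "bar_mat q M \<in> carrier_mat n n" by (rule bar_closed[OF M(1)])
    have "bar_mat q M * bar_mat q P = bar_mat q P * ?E"
      unfolding bar_mult[OF M(1) c(1), symmetric] M(2) bar_mult[OF c(1) mat_diag_dim] bar_mat_diag ..
    then have e1: "R * (bar_mat q M * bar_mat q P) = ?Q * ?E"
      using square_mult_assoc[OF P(2) c(2) mat_diag_dim] by simp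
    have "M * bar_mat q P = M * (P * R) * bar_mat q P" using M c by (simp add: P(3))
    also have "\<dots> = (M * P) * ?Q" using M(1) c P(2) by (simp add: square_mult_assoc[where n = n])
    also have "\<dots> = P * (?D * ?Q)" unfolding M(2) by (rule square_mult_assoc[OF c(1) mat_diag_dim Q])
    finally have e2: "R * (M * bar_mat q P) = ?D * ?Q"
      using square_inv_cancel[OF P(2) c(1) _ P(4), of "?D * ?Q"] Q by simp
    have "bar_mat q M = M \<longleftrightarrow> bar_mat q M * bar_mat q P = M * bar_mat q P"
      by (rule GL_cancel_right[OF bar_GL[OF P(1)] bM M(1), symmetric])
    also have "\<dots> \<longleftrightarrow> R * (bar_mat q M * bar_mat q P) = R * (M * bar_mat q P)"
      by (rule GL_cancel_left[OF GL_I[OF P(2) c(1) P(4)], symmetric]) (use M bM c in simp_all)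
    finally show ?thesis unfolding e1 e2 .
  qed
  have "(\<exists>s\<in>GL n. diagonalizes n P s D) \<longleftrightarrow> ?Q * ?E = ?D * ?Q"
  proof
    assume "\<exists>s\<in>GL n. diagonalizes n P s D"
    then obtain s where s: "ac_mat s \<in> carrier_mat n n" "ac_mat s * P = P * ?D"
      unfolding diagonalizes_def by auto
    show "?Q * ?E = ?D * ?Q" using eqn[OF s] bar_fixed by blast
  next
    assume e: "?Q * ?E = ?D * ?Q"
    let ?M = "P * ?D * R"
    note M = diagonal_conjugate[OF P nz]
    have "bar_mat q ?M = ?M" using eqn[OF GL_carrier[OF M(1)] M(2)] e by blast
    then obtain s :: "'a mat" where s: "s \<in> carrier_mat n n" "?M = ac_mat s"
      using ac_mat_lift[OF GL_carrier[OF M(1)]] unfolding bar_mat_def q by metis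
    have "s \<in> GL n" using M(1) unfolding s(2) ac_mat_GL_iff .
    moreover have "diagonalizes n P s D" unfolding diagonalizes_def using s P(1) M(2) by simp
    ultimately show "\<exists>s\<in>GL n. diagonalizes n P s D" by blast
  qed
  then show ?thesis unfolding mat_diag_intertwine_iff[OF Q] .
qed

text \<open>In the basis given by \<open>P\<close> the form has Gram matrix
  \<open>P^T * H * bar P\<close>, and invariance under a diagonal matrix constrains exactly the
  pairs of basis vectors whose product is nonzero. Definedness over the field with
  \<open>q^2\<close> elements is a consequence of unitarity.\<close>

lemma unitary_twist:
  fixes P :: "'b :: {finite, field} alg_closure mat"
  assumes frob: "frobenius_field q (\<lambda>x :: 'b alg_closure. x ^ q)" and q: "q ^ 2 = card (UNIV :: 'b set)"
    and H: "H \<in> GL n" "H\<^sup>T = bar_mat q H"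
    and P: "P \<in> GL n" and nz: "\<forall>i<n. D i \<noteq> 0"
  shows "(\<exists>s\<in>carrier_mat n n. s\<^sup>T * H * bar_mat q s = H \<and> diagonalizes n P s D) \<longleftrightarrow>
    (\<forall>i<n. \<forall>j<n. (P\<^sup>T * ac_mat H * bar_mat q P) $$ (i, j) \<noteq> 0 \<longrightarrow> D i = inverse (D j ^ q))"
proof -
  interpret frobenius_field q "\<lambda>x :: 'b alg_closure. x ^ q" by fact
  let ?H = "ac_mat H" and ?D = "mat_diag n D" and ?E = "mat_diag n (\<lambda>i. D i ^ q)"
  let ?Q = "P\<^sup>T * ?H * bar_mat q P"
  have HK: "?H \<in> GL n" using H(1) unfolding ac_mat_GL_iff .
  have HT: "?H\<^sup>T = bar_mat q ?H" unfolding ac_mat_transpose bar_ac_mat H(2) ..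
  obtain R where R: "R \<in> carrier_mat n n" "P * R = 1\<^sub>m n" "R * P = 1\<^sub>m n" using GL_E[OF P] by metis
  have c: "P \<in> carrier_mat n n" "bar_mat q P \<in> carrier_mat n n" "?H \<in> carrier_mat n n" "P\<^sup>T \<in> carrier_mat n n"
    using GL_carrier[OF P] bar_closed GL_carrier[OF HK] by simp_all
  have Q: "?Q \<in> carrier_mat n n" using c by simp
  have E_nz: "\<forall>i<n. D i ^ q \<noteq> 0" using nz by simp
  have eqn: "M\<^sup>T * ?H * bar_mat q M = ?H \<longleftrightarrow> ?D * ?Q * ?E = ?Q" if M: "M \<in> carrier_mat n n" "M * P = P * ?D" for M
  proof -
    have bM: "bar_mat q M \<in> carrier_mat n n" "M\<^sup>T \<in> carrier_mat n n" using bar_closed[OF M(1)] M(1) by simp_all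
    have DT: "?D\<^sup>T = ?D" by (intro eq_matI) (auto simp: mat_diag_def)
    have t: "P\<^sup>T * M\<^sup>T = ?D * P\<^sup>T"
      unfolding square_transpose_mult[OF M(1) c(1), symmetric] M(2)
      by (simp add: square_transpose_mult[OF c(1) mat_diag_dim] DT)
    have b: "bar_mat q M * bar_mat q P = bar_mat q P * ?E"
      unfolding bar_mult[OF M(1) c(1), symmetric] M(2) bar_mult[OF c(1) mat_diag_dim] bar_mat_diag ..
    have "P\<^sup>T * (M\<^sup>T * ?H * bar_mat q M) * bar_mat q P = (P\<^sup>T * M\<^sup>T) * ?H * (bar_mat q M * bar_mat q P)"
      using c bM by (simp add: square_mult_assoc[where n = n])
    also have "\<dots> = ?D * ?Q * ?E"
      unfolding t b using c by (simp add: square_mult_assoc[where n = n])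
    finally have e: "P\<^sup>T * (M\<^sup>T * ?H * bar_mat q M) * bar_mat q P = ?D * ?Q * ?E" .
    have "M\<^sup>T * ?H * bar_mat q M = ?H \<longleftrightarrow> P\<^sup>T * (M\<^sup>T * ?H * bar_mat q M) = P\<^sup>T * ?H"
      by (rule GL_cancel_left[OF GL_transpose[OF P], symmetric]) (use c bM in simp_all)
    also have "\<dots> \<longleftrightarrow> P\<^sup>T * (M\<^sup>T * ?H * bar_mat q M) * bar_mat q P = ?Q"
      by (rule GL_cancel_right[OF bar_GL[OF P], symmetric]) (use c bM in simp_all)
    finally show ?thesis unfolding e .
  qed
  have lift: "s\<^sup>T * H * bar_mat q s = H \<longleftrightarrow> (ac_mat s)\<^sup>T * ?H * bar_mat q (ac_mat s) = ?H" if "s \<in> carrier_mat n n" for s :: "'b mat"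
  proof -
    have "s\<^sup>T \<in> carrier_mat n n" "bar_mat q s \<in> carrier_mat n n" "H \<in> carrier_mat n n"
      using that GL_carrier[OF H(1)] by (simp_all add: bar_mat_def)
    then have "(ac_mat s)\<^sup>T * ?H * bar_mat q (ac_mat s) = ac_mat (s\<^sup>T * H * bar_mat q s)"
      by (simp add: ac_mat_transpose bar_ac_mat ac_mat_mult[where n = n])
    then show ?thesis by (simp only: ac_mat_eq_iff)
  qed
  have "(\<exists>s\<in>carrier_mat n n. s\<^sup>T * H * bar_mat q s = H \<and> diagonalizes n P s D) \<longleftrightarrow> ?D * ?Q * ?E = ?Q"
  proof
    assume "\<exists>s\<in>carrier_mat n n. s\<^sup>T * H * bar_mat q s = H \<and> diagonalizes n P s D"
    then obtain s where s: "s \<in> carrier_mat n n" "s\<^sup>T * H * bar_mat q s = H" "ac_mat s \<in> carrier_mat n n" "ac_mat s * P = P * ?D"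
      unfolding diagonalizes_def by auto
    show "?D * ?Q * ?E = ?Q" using eqn[OF s(3,4)] s(2) lift[OF s(1)] by blast
  next
    assume e: "?D * ?Q * ?E = ?Q"
    define M where "M = P * ?D * R"
    note M' = diagonal_conjugate[OF P R nz, folded M_def]
    have M: "M \<in> carrier_mat n n" "bar_mat q M \<in> carrier_mat n n" "M\<^sup>T \<in> carrier_mat n n"
      using GL_carrier[OF M'(1)] bar_closed by simp_all
    have inv: "M\<^sup>T * ?H * bar_mat q M = ?H" using eqn[OF M(1) M'(2)] e by blast
    have bc: "(bar_mat q M)\<^sup>T \<in> carrier_mat n n" "bar_mat q ?H \<in> carrier_mat n n" "bar_mat q (bar_mat q M) \<in> carrier_mat n n"
      using M c bar_closed by simp_all
    \<comment> \<open>The unitarity equation is transposed on one side and raised entrywise to the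
      \<open>q\<close>-th power on the other. Cancelling the common left factor shows that
      \<open>M\<close> is fixed by the \<open>q^2\<close>-power.\<close>
    have "(bar_mat q M)\<^sup>T * bar_mat q ?H * M = (M\<^sup>T * ?H * bar_mat q M)\<^sup>T"
      using M c bc by (simp add: square_transpose_mult[where n = n] square_mult_assoc[where n = n] HT)
    also have "\<dots> = bar_mat q (M\<^sup>T * ?H * bar_mat q M)" unfolding inv by (rule HT)
    also have "\<dots> = (bar_mat q M)\<^sup>T * bar_mat q ?H * bar_mat q (bar_mat q M)"
      using M c bc by (simp add: bar_mult[where n = n] bar_mat_transpose)
    finally have "M = bar_mat q (bar_mat q M)"
      using GL_cancel_left[OF GL_mult[OF GL_transpose[OF bar_GL[OF M'(1)]] bar_GL[OF HK]] M(1) bc(3)] by blast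
    moreover have "bar_mat q (bar_mat q M) = map_mat (\<lambda>x. x ^ card (UNIV :: 'b set)) M"
      by (auto simp: bar_mat_def mat_eq_iff power_mult[symmetric] power2_eq_square q[symmetric])
    ultimately obtain s :: "'b mat" where s: "s \<in> carrier_mat n n" "M = ac_mat s"
      using ac_mat_lift[OF M(1)] by metis
    have "s\<^sup>T * H * bar_mat q s = H" using inv lift[OF s(1)] unfolding s(2) by blast
    moreover have "diagonalizes n P s D" unfolding diagonalizes_def using s P M'(2) by simp
    ultimately show "\<exists>s\<in>carrier_mat n n. s\<^sup>T * H * bar_mat q s = H \<and> diagonalizes n P s D" using s(1) by blast
  qed
  then show ?thesis unfolding mat_diag_invariant_iff[OF Q E_nz] .
qed

section \<open>Group elements with a prescribed spectrum\<close>

lemma vandermonde_GL: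
  fixes \<gamma> :: "nat \<Rightarrow> 'a :: field"
  assumes inj: "inj_on \<gamma> {0..<n}"
  shows "mat n n (\<lambda>(i, j). \<gamma> j ^ i) \<in> GL n"
proof -
  let ?V = "mat n n (\<lambda>(i, j). \<gamma> j ^ i)"
  have V: "?V\<^sup>T \<in> carrier_mat n n" by simp
  have "det (?V\<^sup>T) \<noteq> 0"
  proof
    assume "det (?V\<^sup>T) = 0"
    then obtain v where v: "v \<in> carrier_vec n" "v \<noteq> 0\<^sub>v n" "?V\<^sup>T *\<^sub>v v = 0\<^sub>v n"
      using det_0_iff_vec_prod_zero_field[OF V] by blast
    \<comment> \<open>A kernel vector of the transpose is the coefficient vector of a polynomial of
      degree below \<open>n\<close> vanishing at the \<open>n\<close> distinct nodes.\<close>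
    define f where "f = (\<Sum>i<n. monom (v $ i) i)"
    have coeff: "coeff f i = (if i < n then v $ i else 0)" for i
      by (simp add: f_def coeff_sum sum.delta)
    have "poly f (\<gamma> j) = 0" if "j < n" for j
    proof -
      have "poly f (\<gamma> j) = (?V\<^sup>T *\<^sub>v v) $ j"
        using that v(1) by (simp add: f_def poly_sum poly_monom scalar_prod_def mult.commute atLeast0LessThan)
      then show ?thesis using v(3) that by simp
    qed
    then have roots: "\<gamma> ` {0..<n} \<subseteq> {x. poly f x = 0}" by auto
    have "f = 0"
    proof (rule ccontr)
      assume f0: "f \<noteq> 0"
      have "n \<le> card {x. poly f x = 0}"
        using card_mono[OF poly_roots_finite[OF f0] roots] by (simp add: card_image[OF inj])
      also have "\<dots> \<le> degree f" by (rule card_poly_roots_bound[OF f0])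
      finally have "coeff f (degree f) = 0" by (simp add: coeff)
      then show False using f0 by simp
    qed
    then have "v $ i = 0" if "i < n" for i using coeff[of i] that by simp
    then show False using v(1,2) by (auto simp: vec_eq_iff)
  qed
  then have "?V\<^sup>T \<in> GL n" by (simp add: GL_iff_det)
  then show ?thesis using GL_transpose[of "?V\<^sup>T" n] by simp
qed

text \<open>
  The elements \<open>\<gamma>\<close> serve as nodes of a Vandermonde matrix that diagonalizes an element with spectrum \<open>S\<close>.
\<close>

lemma spectrum_enumeration:
  fixes S :: "'k :: zero multiset"
  assumes "size S = n" "0 \<notin># S" "image_mset g S = S" and g: "inj g" "g 0 = 0"
    and plenty: "\<And>d. d > 0 \<Longrightarrow> n \<le> card {x. x \<noteq> 0 \<and> exact_period g d x}"
  obtains D \<gamma> and p :: "nat \<Rightarrow> nat" where "S = image_mset D (mset_set {0..<n})" "\<forall>i<n. D i \<noteq> 0"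
    "inj_on \<gamma> {0..<n}" "\<forall>i<n. \<gamma> i \<noteq> 0" "p permutes {0..<n}"
    "\<forall>i<n. D i = g (D (p i))" "\<forall>i<n. \<gamma> i = g (\<gamma> (p i))"
proof -
  obtain xs where xs: "mset xs = S" using ex_mset by blast
  define D where "D i = xs ! i" for i
  have len: "length xs = n" using assms(1) xs by (metis size_mset)
  have "S = mset (map D [0..<n])" unfolding D_def by (simp add: xs[symmetric] len[symmetric] map_nth del: map_map)
  then have S: "S = image_mset D (mset_set {0..<n})" by simp
  have "image_mset D (mset_set {0..<n}) = image_mset (\<lambda>i. g (D i)) (mset_set {0..<n})"
    using assms(3) unfolding S multiset.map_comp comp_def by (rule sym)
  then obtain p where p: "p permutes {0..<n}" "\<forall>i\<in>{0..<n}. D i = g (D (p i))"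
    by (rule image_mset_eq_implies_permutes[OF finite_atLeastLessThan])
  have D0: "\<forall>i<n. D i \<noteq> 0" using assms(2) unfolding S by auto
  \<comment> \<open>The nodes are an equivariant embedding of the index set, on which the inverse
    \<open>r\<close> of \<open>p\<close> acts. The eigenvalues \<open>D i\<close> themselves would
    not do, since they may coincide.\<close>
  define r where "r = inv_into UNIV p"
  have r: "r permutes {0..<n}" unfolding r_def by (rule permutes_inv[OF p(1)])
  have rp: "r (p i) = i" for i unfolding r_def by (rule permutes_inverses(2)[OF p(1)])
  have "r ` {0..<n} \<subseteq> {0..<n}" using permutes_image[OF r] by simp
  from equivariant_embedding[OF finite_atLeastLessThan _ permutes_inj[OF r] this g plenty]
  obtain \<gamma> where \<gamma>: "inj_on \<gamma> {0..<n}" "\<forall>i\<in>{0..<n}. \<gamma> i \<noteq> 0 \<and> \<gamma> (r i) = g (\<gamma> i)" by auto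
  have "\<gamma> i = g (\<gamma> (p i))" if "i < n" for i
  proof -
    have "p i \<in> {0..<n}" using permutes_in_image[OF p(1), of i] that by simp
    then show ?thesis using \<gamma>(2) rp[of i] by metis
  qed
  then show thesis using that[OF S D0 \<gamma>(1) _ p(1)] \<gamma>(2) p(2) by auto
qed

text \<open>\<open>W\<close> is \<open>V\<close> with permuted columns, so its product with the
  inverse of \<open>V\<close> is a permutation matrix.\<close>

lemma permuted_inverse_entry:
  fixes V :: "'a :: field mat"
  assumes c: "V \<in> carrier_mat n n" "W \<in> carrier_mat n n" "R \<in> carrier_mat n n" and RV: "R * V = 1\<^sub>m n"
    and p: "p permutes {0..<n}" and W: "\<And>k i. k < n \<Longrightarrow> i < n \<Longrightarrow> W $$ (k, p i) = V $$ (k, i)"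
    and ij: "i < n" "j < n" "(R * W) $$ (i, j) \<noteq> 0"
  shows "j = p i"
proof -
  have "j \<in> p ` {0..<n}" using ij permutes_image[OF p] by simp
  then obtain l where l: "l < n" "j = p l" by auto
  have "(R * W) $$ (i, j) = (\<Sum>k = 0..<n. R $$ (i, k) * W $$ (k, j))"
    using ij c by (simp add: scalar_prod_def)
  also have "\<dots> = (\<Sum>k = 0..<n. R $$ (i, k) * V $$ (k, l))"
    using l by (intro sum.cong) (simp_all add: W)
  also have "\<dots> = (R * V) $$ (i, l)" using ij l c by (simp add: scalar_prod_def)
  also have "\<dots> = (if i = l then 1 else 0)" unfolding RV using ij l by simp
  finally show ?thesis using ij(3) l by (auto split: if_splits)
qed

text \<open>To realize a spectrum, note that the \<open>q\<close>-power permutes the columns of the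
  Vandermonde matrix \<open>V\<close> on the nodes \<open>\<gamma>\<close>. The matrix that
  \<open>GL_twist\<close> attaches to \<open>V\<close> is then a permutation matrix, and its
  conditions reduce to the relation between \<open>D i\<close> and \<open>D (p i)\<close>.\<close>

theorem semisimple_frame_general_linear_group:
  assumes frob: "frobenius_field q (\<lambda>x :: 'a :: {finite, field} alg_closure. x ^ q)"
    and q: "q = card (UNIV :: 'a set)" "of_nat q = (0 :: 'a alg_closure)" "q \<ge> 3" and n: "n < q"
    and two: "(2 :: 'a) \<noteq> 0"
  shows "semisimple_frame n (general_linear_group TYPE('a) n) (\<lambda>x. x ^ q)"
proof (intro semisimple_frame.intro semisimple_frame_axioms.intro)
  interpret frobenius_field q "\<lambda>x :: 'a alg_closure. x ^ q" by fact
  have carrier: "carrier (general_linear_group TYPE('a) n) = GL n"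
    by (simp add: general_linear_group_def units_of_def)
  show "ample_matrix_group n (general_linear_group TYPE('a) n)" by (rule ample_general_linear_group[OF two])
  show "n < card (UNIV :: 'a set)" using n q(1) by simp
  show "inj (\<lambda>x :: 'a alg_closure. x ^ q)" by (rule inj_frob)
  show "\<exists>Q\<in>(GL n :: 'a alg_closure mat set). \<forall>D. (\<forall>i<n. D i \<noteq> 0) \<longrightarrow>
      (\<exists>s\<in>carrier (general_linear_group TYPE('a) n). diagonalizes n P s D) \<longleftrightarrow>
      (\<forall>i<n. \<forall>j<n. Q $$ (i, j) \<noteq> 0 \<longrightarrow> D i = D j ^ q)" if P: "P \<in> GL n" for P :: "'a alg_closure mat"
  proof -
    obtain R where R: "R \<in> carrier_mat n n" "P * R = 1\<^sub>m n" "R * P = 1\<^sub>m n" using GL_E[OF P] by metis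
    have "R * bar_mat q P \<in> GL n"
      using GL_mult[OF GL_I[OF R(1) GL_carrier[OF P] R(3)] bar_GL[OF P]] .
    then show ?thesis unfolding carrier using GL_twist[OF frob q(1) P R] by (intro bexI allI impI)
  qed
  fix S :: "'a alg_closure multiset"
  assume S: "size S = n" "0 \<notin># S" "image_mset (\<lambda>x. x ^ q) S = S"
  have zero: "(0 :: 'a alg_closure) ^ q = 0" using q_pos by simp
  obtain D and \<gamma> :: "nat \<Rightarrow> 'a alg_closure" and p where D: "S = image_mset D (mset_set {0..<n})" "\<forall>i<n. D i \<noteq> 0"
    and \<gamma>: "inj_on \<gamma> {0..<n}" "\<forall>i<n. \<gamma> i \<noteq> 0" and p: "p permutes {0..<n}"
    and eqs: "\<forall>i<n. D i = D (p i) ^ q" "\<forall>i<n. \<gamma> i = \<gamma> (p i) ^ q"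
    by (rule spectrum_enumeration[OF S inj_frob zero frobenius_plenty[OF q(2,3) _ n]]) (assumption, rule that)
  define V where "V = mat n n (\<lambda>(i, j). \<gamma> j ^ i)"
  have V: "V \<in> GL n" unfolding V_def by (rule vandermonde_GL[OF \<gamma>(1)])
  obtain R where R: "R \<in> carrier_mat n n" "V * R = 1\<^sub>m n" "R * V = 1\<^sub>m n" using GL_E[OF V] by metis
  have pn: "p i < n" if "i < n" for i using permutes_in_image[OF p, of i] that by simp
  have bV: "bar_mat q V $$ (k, p i) = V $$ (k, i)" if "k < n" "i < n" for k i
  proof -
    have "bar_mat q V $$ (k, p i) = (\<gamma> (p i) ^ q) ^ k"
      using that pn by (simp add: V_def bar_mat_def power_mult[symmetric] mult.commute)
    also have "\<gamma> (p i) ^ q = \<gamma> i" using eqs(2) that by metis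
    finally show ?thesis using that by (simp add: V_def)
  qed
  have "D i = D j ^ q" if "i < n" "j < n" "(R * bar_mat q V) $$ (i, j) \<noteq> 0" for i j
    using permuted_inverse_entry[OF GL_carrier[OF V] bar_closed[OF GL_carrier[OF V]] R(1,3) p bV that] eqs(1) that(1)
    by metis
  then obtain s where s: "s \<in> GL n" "diagonalizes n V s D"
    using GL_twist[OF frob q(1) V R D(2)] by blast
  have "semisimple_mat s" using semisimple_iff_diagonalizes[OF GL_carrier[OF s(1)]] s(2) by blast
  moreover have "spec s = S" unfolding D(1) by (rule spec_diagonalizes[OF s(2)])
  ultimately show "\<exists>t\<in>carrier (general_linear_group TYPE('a) n). semisimple_mat t \<and> spec t = S"
    unfolding carrier using s(1) by blast
qed

context hermitian_space
begin

lemma carrier_unitary_iff: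
  "g \<in> carrier (unitary_group q n J) \<longleftrightarrow> g \<in> carrier_mat n n \<and> g\<^sup>T * J * bar_mat q g = J"
proof
  assume "g \<in> carrier (unitary_group q n J)"
  from unitary_group_eqs(1,2)[OF this] show "g \<in> carrier_mat n n \<and> g\<^sup>T * J * bar_mat q g = J"
    using unitary_iff by blast
next
  assume "g \<in> carrier_mat n n \<and> g\<^sup>T * J * bar_mat q g = J"
  then show "g \<in> carrier (unitary_group q n J)" using unitaryI unitary_iff by blast
qed

text \<open>
  With \<open>V = (\<gamma>\<^sub>j\<^sup>i)\<close>, the hermitian form with matrix \<open>H\<close>, where \<open>H\<inverse>\<close> has entries \<open>\<Sum>\<^sub>k \<gamma>\<^sub>k\<^sup>j\<^sup>-\<^sup>i\<close>,
  is invariant under \<open>V diag(D) V\<inverse>\<close>; as all hermitian forms are equivalent, \<open>H\<close> may replace \<open>J\<close>.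
\<close>

theorem semisimple_frame_unitary_group:
  assumes frob: "frobenius_field q (\<lambda>x :: 'b alg_closure. x ^ q)"
    and q: "q ^ 2 = card (UNIV :: 'b set)" "of_nat q = (0 :: 'b alg_closure)" "q \<ge> 3" and n: "n < q"
  shows "semisimple_frame n (unitary_group q n J) (\<lambda>x. inverse (x ^ q))"
proof (intro semisimple_frame.intro semisimple_frame_axioms.intro)
  interpret K: frobenius_field q "\<lambda>x :: 'b alg_closure. x ^ q" by fact
  let ?G = "unitary_group q n J"
  show "ample_matrix_group n ?G" by (rule unitary.ample_matrix_group_axioms)
  have "q * 1 \<le> q * q" using q(3) by (intro mult_le_mono) simp_all
  then show "n < card (UNIV :: 'b set)" using n q(1) unfolding power2_eq_square by linarith
  show "inj (\<lambda>x :: 'b alg_closure. inverse (x ^ q))" by (rule K.inj_inverse_frob)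
  show "\<exists>Q\<in>(GL n :: 'b alg_closure mat set). \<forall>D. (\<forall>i<n. D i \<noteq> 0) \<longrightarrow>
      (\<exists>s\<in>carrier ?G. diagonalizes n P s D) \<longleftrightarrow>
      (\<forall>i<n. \<forall>j<n. Q $$ (i, j) \<noteq> 0 \<longrightarrow> D i = inverse (D j ^ q))" if P: "P \<in> GL n" for P :: "'b alg_closure mat"
  proof -
    have JK: "ac_mat J \<in> GL n" using J unfolding ac_mat_GL_iff .
    have Q: "P\<^sup>T * ac_mat J * bar_mat q P \<in> GL n"
      using GL_mult[OF GL_mult[OF GL_transpose[OF P] JK] K.bar_GL[OF P]] .
    have eq: "(\<exists>s\<in>carrier ?G. diagonalizes n P s D) \<longleftrightarrow>
        (\<exists>s\<in>carrier_mat n n. s\<^sup>T * J * bar_mat q s = J \<and> diagonalizes n P s D)" for D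
      unfolding Bex_def carrier_unitary_iff by (simp only: conj_assoc)
    show ?thesis unfolding eq using unitary_twist[OF frob q(1) J hermitian P] by (intro bexI[OF _ Q] allI impI)
  qed
  fix S :: "'b alg_closure multiset"
  assume S: "size S = n" "0 \<notin># S" "image_mset (\<lambda>x. inverse (x ^ q)) S = S"
  have zero: "inverse ((0 :: 'b alg_closure) ^ q) = 0" using q_pos by simp
  obtain D and \<gamma> :: "nat \<Rightarrow> 'b alg_closure" and p where D: "S = image_mset D (mset_set {0..<n})" "\<forall>i<n. D i \<noteq> 0"
    and \<gamma>: "inj_on \<gamma> {0..<n}" "\<forall>i<n. \<gamma> i \<noteq> 0" and p: "p permutes {0..<n}"
    and eqs: "\<forall>i<n. D i = inverse (D (p i) ^ q)" "\<forall>i<n. \<gamma> i = inverse (\<gamma> (p i) ^ q)"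
    by (rule spectrum_enumeration[OF S K.inj_inverse_frob zero inverse_frobenius_plenty[OF q(2,3) _ n]]) (assumption, rule that)
  have pn: "p i < n" if "i < n" for i using permutes_in_image[OF p, of i] that by simp
  have \<gamma>q: "\<gamma> (p i) ^ q = inverse (\<gamma> i)" if "i < n" for i using eqs(2) that by (metis inverse_inverse_eq)
  define V where "V = mat n n (\<lambda>(i, j). \<gamma> j ^ i)"
  define V' where "V' = mat n n (\<lambda>(i, j). inverse (\<gamma> j) ^ i)"
  have V: "V \<in> GL n" unfolding V_def by (rule vandermonde_GL[OF \<gamma>(1)])
  have "inj_on (\<lambda>j. inverse (\<gamma> j)) {0..<n}" using \<gamma>(1) by (auto simp: inj_on_def)
  then have V': "V' \<in> GL n" unfolding V'_def by (rule vandermonde_GL)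
  note c = GL_carrier[OF V] GL_carrier[OF V'] GL_carrier[OF GL_transpose[OF V]] K.bar_closed[OF GL_carrier[OF V]]
  define N where "N = V' * V\<^sup>T"
  have N: "N \<in> GL n" unfolding N_def by (rule GL_mult[OF V' GL_transpose[OF V]])
  have N_entry: "N $$ (i, j) = (\<Sum>k\<in>{0..<n}. inverse (\<gamma> k) ^ i * \<gamma> k ^ j)" if "i < n" "j < n" for i j
    using that by (simp add: N_def V_def V'_def scalar_prod_def)
  \<comment> \<open>Up to the permutation \<open>p\<close>, the \<open>q\<close>-power inverts the
    nodes; reindexing the sum along \<open>p\<close> therefore exchanges the exponents
    \<open>i\<close> and \<open>j\<close>.\<close>
  have bN: "bar_mat q N = N\<^sup>T"
  proof (rule eq_matI)
    fix i j assume "i < dim_row (N\<^sup>T)" "j < dim_col (N\<^sup>T)"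
    then have ij: "i < n" "j < n" using GL_carrier[OF N] by simp_all
    have "bar_mat q N $$ (i, j) = (\<Sum>k\<in>{0..<n}. inverse (\<gamma> k) ^ i * \<gamma> k ^ j) ^ q"
      using ij GL_carrier[OF N] by (simp add: bar_mat_def N_entry)
    also have "\<dots> = (\<Sum>k\<in>{0..<n}. (inverse (\<gamma> k) ^ i * \<gamma> k ^ j) ^ q)" by (rule K.frob.hom_sum)
    also have "\<dots> = (\<Sum>k\<in>{0..<n}. inverse (\<gamma> k ^ q) ^ i * (\<gamma> k ^ q) ^ j)"
      by (simp add: power_mult_distrib power_inverse power_mult[symmetric] mult.commute[of q])
    also have "\<dots> = (\<Sum>k\<in>{0..<n}. inverse (\<gamma> (p k) ^ q) ^ i * (\<gamma> (p k) ^ q) ^ j)"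
      by (subst sum.permute[OF p]) (simp add: comp_def)
    also have "\<dots> = (\<Sum>k\<in>{0..<n}. inverse (\<gamma> k) ^ j * \<gamma> k ^ i)"
      by (rule sum.cong) (simp_all add: \<gamma>q)
    also have "\<dots> = N\<^sup>T $$ (i, j)" using ij GL_carrier[OF N] by (simp add: N_entry)
    finally show "bar_mat q N $$ (i, j) = N\<^sup>T $$ (i, j)" .
  qed (use GL_carrier[OF N] in \<open>simp_all add: bar_mat_def\<close>)
  \<comment> \<open>Applying the \<open>q\<close>-power twice is the \<open>q^2\<close>-power, so
    \<open>N\<close> comes from a matrix over the base field, and the inverse of that matrix is the
    form \<open>H\<close>.\<close>
  have "bar_mat q (bar_mat q N) = N" unfolding bN bar_mat_transpose by (simp add: bN)
  moreover have "bar_mat q (bar_mat q N) = map_mat (\<lambda>x. x ^ card (UNIV :: 'b set)) N"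
    by (auto simp: bar_mat_def mat_eq_iff power_mult[symmetric] power2_eq_square q(1)[symmetric])
  ultimately obtain N0 :: "'b mat" where N0: "N0 \<in> carrier_mat n n" "N = ac_mat N0"
    using ac_mat_lift[OF GL_carrier[OF N]] by metis
  have N0_GL: "N0 \<in> GL n" using N unfolding N0(2) ac_mat_GL_iff .
  have N0_bar: "bar_mat q N0 = N0\<^sup>T"
    using bN unfolding N0(2) bar_ac_mat ac_mat_transpose ac_mat_eq_iff .
  obtain H where H: "H \<in> carrier_mat n n" "N0 * H = 1\<^sub>m n" "H * N0 = 1\<^sub>m n" "H \<in> GL n"
    using GL_E[OF N0_GL] by metis
  have HT: "H\<^sup>T = bar_mat q H"
  proof -
    have "H\<^sup>T * N0\<^sup>T = 1\<^sub>m n" unfolding square_transpose_mult[OF N0(1) H(1), symmetric] H(2) by simp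
    moreover have "bar_mat q H * N0\<^sup>T = 1\<^sub>m n"
      unfolding N0_bar[symmetric] bar_mult[OF H(1) N0(1), symmetric] H(3) by (rule bar_one)
    ultimately show ?thesis using GL_cancel_right[OF GL_transpose[OF N0_GL], of "H\<^sup>T" "bar_mat q H"] H(1) by simp
  qed
  have HK: "ac_mat H \<in> carrier_mat n n" using H(1) by simp
  \<comment> \<open>This is the inverse of \<open>V'\<close>. As \<open>bar_mat q V\<close> is
    \<open>V'\<close> with permuted columns, the Gram matrix of \<open>H\<close> in the basis
    \<open>V\<close> becomes a permutation matrix.\<close>
  define R where "R = V\<^sup>T * ac_mat H"
  have R: "R \<in> carrier_mat n n" unfolding R_def using c HK by simp
  have "V' * R = N * ac_mat H" unfolding R_def N_def using c HK by (simp add: square_mult_assoc[where n = n])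
  also have "\<dots> = 1\<^sub>m n"
    unfolding N0(2) ac_mat_mult[OF N0(1) H(1), symmetric] H(2) by (rule to_ac.mat_hom_one)
  finally have RV': "R * V' = 1\<^sub>m n" by (rule mat_mult_left_right_inverse[OF c(2) R])
  have bV: "bar_mat q V $$ (k, p i) = V' $$ (k, i)" if "k < n" "i < n" for k i
  proof -
    have "bar_mat q V $$ (k, p i) = (\<gamma> (p i) ^ q) ^ k"
      using that pn by (simp add: V_def bar_mat_def power_mult[symmetric] mult.commute)
    also have "\<dots> = V' $$ (k, i)" using that by (simp add: \<gamma>q V'_def)
    finally show ?thesis .
  qed
  have "D i = inverse (D j ^ q)" if "i < n" "j < n" "(V\<^sup>T * ac_mat H * bar_mat q V) $$ (i, j) \<noteq> 0" for i j
    using permuted_inverse_entry[OF c(2,4) R RV' p bV, of i j] eqs(1) that unfolding R_def by metis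
  then obtain u where u: "u \<in> carrier_mat n n" "u\<^sup>T * H * bar_mat q u = H" "diagonalizes n V u D"
    using unitary_twist[OF frob q(1) H(4) HT V D(2)] by blast
  obtain s where s: "s \<in> carrier ?G" "similar_mat s u"
    using similar_unitary_exists[OF H(4) HT u(1,2)] by blast
  have "semisimple_mat u" using semisimple_iff_diagonalizes[OF u(1)] u(3) by blast
  then have "semisimple_mat s" by (rule semisimple_similar[OF _ similar_mat_sym[OF s(2)]])
  moreover have "spec s = S" unfolding D(1) spec_similar[OF s(2)] by (rule spec_diagonalizes[OF u(3)])
  ultimately show "\<exists>t\<in>carrier ?G. semisimple_mat t \<and> spec t = S" using s(1) by blast
qed

end

section \<open>Verification of the assumptions for the given fields\<close>

lemma frobenius_field_char:
  assumes "Factorial_Ring.prime p" "CHAR('k :: field) = p" "q = p ^ k"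
  shows "frobenius_field q (\<lambda>x :: 'k. x ^ q)"
proof
  show "(x + y) ^ q = x ^ q + y ^ q" for x y :: 'k
    by (rule freshmans_dream') (use assms in simp_all)
  show "q > 0" using assms prime_gt_0_nat by simp
qed simp

text \<open>Otherwise the \<open>q^2\<close> elements of the field would all be roots of
  \<open>X^q - X\<close>, a polynomial of degree \<open>q\<close>.\<close>

lemma exists_frobenius_nontrivial:
  assumes q: "q \<ge> 2" "card (UNIV :: 'b :: {finite, field} set) = q ^ 2"
  shows "\<exists>a :: 'b. a ^ q \<noteq> a"
proof (rule ccontr)
  assume "\<nexists>a :: 'b. a ^ q \<noteq> a"
  then have all: "a ^ q = a" for a :: 'b by blast
  define f :: "'b poly" where "f = monom 1 q - monom 1 1"
  have deg: "degree f = q"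
    using q degree_add_eq_left[of "- monom 1 1 :: 'b poly" "monom 1 q"] by (simp add: f_def degree_monom_eq)
  then have "f \<noteq> 0" using q by auto
  have "{x. poly f x = 0} = UNIV" by (simp add: f_def poly_monom all)
  then have "q ^ 2 \<le> q" using card_poly_roots_bound[OF \<open>f \<noteq> 0\<close>] q deg by simp
  then show False using q(1) by (simp add: power2_eq_square)
qed

theorem proposition4p5:
  fixes p k q n :: nat
    and J :: "'b :: {finite, field} mat"
  assumes "n \<ge> 1"
    and "Factorial_Ring.prime p" and "odd p" and "k \<ge> 1" and "q = p ^ k"
    and "card (UNIV :: 'a :: {finite, field} set) = q"
    and "card (UNIV :: 'b set) = q ^ 2"
    and "J \<in> carrier_mat n n" and "invertible_mat J" and "hermitian_mat q J"
  shows "(num_z_classes (unitary_group q n J) unipotent_mat = num_partitions n \<and>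
          num_partitions n = num_z_classes (general_linear_group TYPE('a) n) unipotent_mat) \<and>
         (q > n \<longrightarrow>
            num_z_classes (unitary_group q n J) semisimple_mat =
            num_z_classes (general_linear_group TYPE('a) n) semisimple_mat)"
proof -
  note p = assms(2)
  have "p \<noteq> 2" using assms(3) by auto
  \<comment> \<open>Oddness of \<open>p\<close> acts twice: it makes \<open>2\<close> nonzero in
    both fields, and it gives \<open>q \<ge> 3\<close>, the base for which the estimate of periodic
    points holds.\<close>
  then have p3: "p \<ge> 3" using prime_ge_2_nat[OF p] by linarith
  have "p ^ 1 \<le> q" unfolding assms(5) using p3 assms(4) by (intro power_increasing) auto
  then have q3: "q \<ge> 3" using p3 by simp
  have charA: "CHAR('a) = p"
    by (rule char_of_card_prime_power[OF p, of k]) (use assms(5,6) in simp)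
  have charB: "CHAR('b) = p"
    by (rule char_of_card_prime_power[OF p, of "k * 2"]) (use assms(5,7) in \<open>simp add: power_mult\<close>)
  have not_dvd: "\<not> p dvd 2" using p3 by (auto dest: dvd_imp_le)
  have twoA: "(2 :: 'a) \<noteq> 0" using of_nat_eq_0_iff_char_dvd[of 2, where 'a = 'a] not_dvd charA by simp
  have twoB: "(2 :: 'b) \<noteq> 0" using of_nat_eq_0_iff_char_dvd[of 2, where 'a = 'b] not_dvd charB by simp
  interpret B: frobenius_field q "\<lambda>x :: 'b. x ^ q" by (rule frobenius_field_char[OF p charB assms(5)])
  have J: "J \<in> GL n"
  proof -
    obtain I where I: "J * I = 1\<^sub>m (dim_row J)" "I * J = 1\<^sub>m (dim_row I)"
      using assms(9) by (auto simp: invertible_mat_def inverts_mat_def)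
    have "dim_row I = n" using arg_cong[OF I(2), of dim_col] assms(8) by simp
    moreover have "dim_col I = n" using arg_cong[OF I(1), of dim_col] assms(8) by simp
    ultimately show ?thesis using GL_I[OF assms(8), of I] I(1) assms(8) by auto
  qed
  interpret hermitian_space n q J
  proof
    show "(x + y) ^ q = x ^ q + y ^ q" for x y :: 'b by (rule B.frob_add)
    show "(x ^ q) ^ q = x" for x :: 'b
      using power_card_UNIV[of x] assms(7) by (simp add: power_mult[symmetric] power2_eq_square)
    show "\<exists>a :: 'b. a ^ q \<noteq> a" by (rule exists_frobenius_nontrivial[OF _ assms(7)]) (use q3 in simp)
    show "J\<^sup>T = bar_mat q J" using assms(10) by (simp add: hermitian_mat_def)
  qed (rule twoB, rule J)
  have unipotent: "num_z_classes (unitary_group q n J) unipotent_mat = num_partitions n \<and>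
    num_partitions n = num_z_classes (general_linear_group TYPE('a) n) unipotent_mat"
    using num_unipotent_z_classes_unitary num_unipotent_z_classes_GL[OF twoA] by simp
  have semisimple: "num_z_classes (unitary_group q n J) semisimple_mat =
    num_z_classes (general_linear_group TYPE('a) n) semisimple_mat" if n: "q > n"
  proof -
    have frobA: "frobenius_field q (\<lambda>x :: 'a alg_closure. x ^ q)"
      by (rule frobenius_field_char[OF p _ assms(5)]) (simp add: charA)
    have frobB: "frobenius_field q (\<lambda>x :: 'b alg_closure. x ^ q)"
      by (rule frobenius_field_char[OF p _ assms(5)]) (simp add: charB)
    have dvd: "p dvd q" unfolding assms(5) using assms(4) by (intro dvd_power) simp
    have q0A: "of_nat q = (0 :: 'a alg_closure)" using dvd by (simp add: of_nat_eq_0_iff_char_dvd charA)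
    have q0B: "of_nat q = (0 :: 'b alg_closure)" using dvd by (simp add: of_nat_eq_0_iff_char_dvd charB)
    interpret KA: frobenius_field q "\<lambda>x :: 'a alg_closure. x ^ q" by (rule frobA)
    interpret KB: frobenius_field q "\<lambda>x :: 'b alg_closure. x ^ q" by (rule frobB)
    have zero: "(0 :: 'a alg_closure) ^ q = 0" "inverse ((0 :: 'b alg_closure) ^ q) = 0"
      using KA.q_pos by simp_all
    show ?thesis
    proof (rule num_semisimple_z_classes_eq)
      show "semisimple_frame n (unitary_group q n J) (\<lambda>x. inverse (x ^ q))"
        by (rule semisimple_frame_unitary_group[OF frobB _ q0B q3 n]) (simp add: assms(7))
      show "semisimple_frame n (general_linear_group TYPE('a) n) (\<lambda>x. x ^ q)"
        by (rule semisimple_frame_general_linear_group[OF frobA _ q0A q3 n twoA]) (simp add: assms(6))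
      show "\<forall>A \<pi>. finite (A :: 'a alg_closure set) \<longrightarrow> card A \<le> n \<longrightarrow> inj \<pi> \<longrightarrow> \<pi> ` A \<subseteq> A \<longrightarrow>
        (\<exists>\<theta>. inj_on \<theta> A \<and> (\<forall>x\<in>A. \<theta> x \<noteq> 0 \<and> \<theta> (\<pi> x) = inverse ((\<theta> x :: 'b alg_closure) ^ q)))"
        by (intro allI impI, rule equivariant_embedding[OF _ _ _ _ KB.inj_inverse_frob zero(2)
              inverse_frobenius_plenty[OF q0B q3 _ n]])
      show "\<forall>A \<pi>. finite (A :: 'b alg_closure set) \<longrightarrow> card A \<le> n \<longrightarrow> inj \<pi> \<longrightarrow> \<pi> ` A \<subseteq> A \<longrightarrow>
        (\<exists>\<theta>. inj_on \<theta> A \<and> (\<forall>x\<in>A. \<theta> x \<noteq> 0 \<and> \<theta> (\<pi> x) = (\<theta> x :: 'a alg_closure) ^ q))"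
        by (intro allI impI, rule equivariant_embedding[OF _ _ _ _ KA.inj_frob zero(1)
              frobenius_plenty[OF q0A q3 _ n]])
    qed
  qed
  show ?thesis using unipotent semisimple by blast
qed

end
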